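(* Let Assumptions (A) and (B) (stated in the context) hold, and let $L_2:=3C_1$, where $C_1$ is the constant in part (iv) of Assumption (A). For $k\in\mathbb{N}$, let $X^{-k\tau}_{-k\tau+jh}$ and $\tilde X^{-k\tau}_{-k\tau+jh}$, $j\in\mathbb{N}$, be respectively the exact solution of the additive-noise SDE and the projected Euler approximation, both started from $\xi$ at time $-k\tau$. Let $(\mu_1,\mu_2)$ be an arbitrary pair with $\mu_1\in(0,\lambda_1-c_f)$ and $\mu_2>0$. Then there exists a constant $C>0$, independent of $k$, $j$ and $h$, such that $$\sup_{k,j\in\mathbb{N}}\mathbb{E}\Big[\big\|X^{-k\tau}_{-k\tau+jh}-\tilde X^{-k\tau}_{-k\tau+jh}\big\|^2\Big]\le Ch^2,$$ where the time step $h$ satisfies $$h\in\Bigg(0,\min\Bigg\{\frac{(\lambda_1-c_f)^{\frac{p_1+1}{2}}}{(1+\mu_2)^{\frac{p_1+1}{2}}(\lambda_d+L_2)^{p_1+1}},\ \frac{1}{\lambda_1-c_f-\mu_1},\ 1\Bigg\}\Bigg).$$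
   Context: Notation: $\mathbb{N}=\{0,1,2,\dots\}$, $[d]=\{1,\dots,d\}$; $\|\cdot\|$ is the Euclidean norm on $\mathbb{R}^d$ and, for matrices, $\|B\|=\sqrt{\mathrm{trace}(B^TB)}$; $\langle\cdot,\cdot\rangle$ is the Euclidean inner product. SDE (additive noise): $W:\mathbb{R}\times\Omega\to\mathbb{R}^m$ is a standard two-sided Wiener process on a complete probability space $(\Omega,\mathcal{F},\mathbb{P})$, and $\mathcal{F}^t=\sigma\{W_u-W_v: v\le u\le t\}$. For $k\in\mathbb{N}$, $X^{-k\tau}_t$ ($t\ge-k\tau$) denotes the solution of $$\mathrm{d}X^{-k\tau}_t=\big(AX^{-k\tau}_t+f(t,X^{-k\tau}_t)\big)\,\mathrm{d}t+g(t)\,\mathrm{d}W_t,\qquad X^{-k\tau}_{-k\tau}=\xi,$$ where $A\in\mathbb{R}^{d\times d}$, $f:\mathbb{R}\times\mathbb{R}^d\to\mathbb{R}^d$, $g:\mathbb{R}\to\mathbb{R}^{d\times m}$, and the random initial value $\xi$ is $\mathcal{F}^{-k\tau}$-measurable. Assumption (A) (with $g(t,x)=g(t)$): (i) $A$ is self-adjoint and negative definite: there are a non-decreasing sequence $(\lambda_i)_{i\in[d]}$ of positive reals and an orthonormal basis $(e_i)_{i\in[d]}$ with $Ae_i=-\lambda_ie_i$; in particular $\langle x,Ax\rangle\le-\lambda_1\|x\|^2$ for all $x\in\mathbb{R}^d$. (ii) $f,g$ are continuous and periodic in time with period $\tau>0$. (iii) For some $p_1\in(1,\infty)$ there is a constant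 $\alpha_1<\lambda_1$ such that for all $x,y\in\mathbb{R}^d$, $t\in[0,\tau)$: $\langle x-y,f(t,x)-f(t,y)\rangle+\frac{2p_1-1}{2}\|g(t,x)-g(t,y)\|^2\le\alpha_1\|x-y\|^2$ (the $g$-term vanishes here). (iv) There are $\gamma\in[1,\frac{p_1+1}{2})$ and $C_1,C>0$ such that $\|f(t,x)-f(t,y)\|\vee\|g(t,x)-g(t,y)\|\le C_1(1+\|x\|^{\gamma-1}+\|y\|^{\gamma-1})\|x-y\|$ for all $x,y\in\mathbb{R}^d$ (and all $t$), and $\|f(t,x)-f(s,x)\|\vee\|g(t,x)-g(s,x)\|\le C(1+\|x\|^\gamma)|t-s|$ for all $x\in\mathbb{R}^d$, $s,t\in[0,\tau)$. (v) For any $p\ge1$ there is a constant $C^*>0$ depending on $p$ with $\mathbb{E}[\|\xi\|^{2p}]\le C^*$. Assumption (B): $g$ is continuous and $\tau$-periodic, and there is $c_g>0$ with $\sup_{t\in[0,\tau)}\|g(t)\|\le c_g$ and $\|g(t_1)-g(t_2)\|\le c_g|t_2-t_1|$ for all $t_1,t_2\in[0,\tau)$. Moreover $f$ is continuously differentiable and, with $\gamma\in[1,\frac{p_1+1}{2})$ and some constant $c_f<\lambda_1$, $$\langle x-y,f(t,x)-f(t,y)\rangle\le c_f\|x-y\|^2,$$ $$\Big\|\Big(\tfrac{\partial f}{\partial x}(t,x)-\tfrac{\partial f}{\partial x}(t,y)\Big)z\Big\|\le C(1+\|x\|+\|y\|)^{\max\{\gamma-2,0\}}\|x-y\|\|z\|$$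 for all $x,y,z\in\mathbb{R}^d$, $t\in[0,\tau)$, where $\frac{\partial f}{\partial x}$ is the partial derivative of $f$ with respect to the state variable. Projected Euler method: for a step size $h\in(0,1)$ put $\Phi(x)=\min\{1,h^{-\frac{1}{2\gamma}}\|x\|^{-1}\}x$ for $x\ne0$ and $\Phi(0)=0$. For $k\in\mathbb{N}$, $\tilde X^{-k\tau}_{-k\tau}=\xi$ and, for all $j\in\mathbb{N}$, $$\tilde X^{-k\tau}_{-k\tau+(j+1)h}=\Phi(\tilde X^{-k\tau}_{-k\tau+jh})+hA\Phi(\tilde X^{-k\tau}_{-k\tau+jh})+hf\big(jh,\Phi(\tilde X^{-k\tau}_{-k\tau+jh})\big)+g(jh)\Delta W_{-k\tau+jh},$$ where $\Delta W_{-k\tau+jh}=W_{-k\tau+(j+1)h}-W_{-k\tau+jh}$. *)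

theory Defs
  imports "HOL-Probability.Probability"
begin

text \<open>Standard \<open>m\<close>-dimensional Wiener process indexed by the whole real line.\<close>

definition two_sided_wiener :: "'w measure \<Rightarrow> (real \<Rightarrow> 'w \<Rightarrow> real ^ 'm) \<Rightarrow> bool" where
  "two_sided_wiener M W \<longleftrightarrow>
     (\<forall>t. W t \<in> borel_measurable M) \<and>
     (AE \<omega> in M. W 0 \<omega> = 0) \<and>
     (AE \<omega> in M. continuous_on UNIV (\<lambda>t. W t \<omega>)) \<and>
     (\<forall>s t. s < t \<longrightarrow>
        prob_space.indep_vars M (\<lambda>_. borel) (\<lambda>i \<omega>. (W t \<omega> - W s \<omega>) $ i) UNIV \<and>
        (\<forall>i. distributed M lborel (\<lambda>\<omega>. (W t \<omega> - W s \<omega>) $ i)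
               (normal_density 0 (sqrt (t - s))))) \<and>
     (\<forall>n (u :: nat \<Rightarrow> real). (\<forall>i<n. u i < u (Suc i)) \<longrightarrow>
        prob_space.indep_vars M (\<lambda>_. borel) (\<lambda>i \<omega>. W (u (Suc i)) \<omega> - W (u i) \<omega>) {..<n})"

definition wiener_filtration :: "'w measure \<Rightarrow> (real \<Rightarrow> 'w \<Rightarrow> real ^ 'm) \<Rightarrow> real \<Rightarrow> 'w measure" where
  "wiener_filtration M W t =
     sigma (space M)
       {(\<lambda>\<omega>. W u \<omega> - W v \<omega>) -` B \<inter> space M | u v B. v \<le> u \<and> u \<le> t \<and> B \<in> sets borel}"

definition is_partition :: "real \<Rightarrow> real \<Rightarrow> nat \<Rightarrow> (nat \<Rightarrow> real) \<Rightarrow> bool" where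
  "is_partition a b N u \<longleftrightarrow> u 0 = a \<and> u N = b \<and> (\<forall>i<N. u i \<le> u (Suc i))"

definition step_fun ::
    "nat \<Rightarrow> (nat \<Rightarrow> real) \<Rightarrow> (nat \<Rightarrow> real ^ 'm ^ 'd) \<Rightarrow> real \<Rightarrow> real ^ 'm ^ 'd" where
  "step_fun N u c s = (\<Sum>i<N. indicator {u i<..u (Suc i)} s *\<^sub>R c i)"

definition step_integral ::
    "(real \<Rightarrow> 'w \<Rightarrow> real ^ 'm) \<Rightarrow> nat \<Rightarrow> (nat \<Rightarrow> real) \<Rightarrow> (nat \<Rightarrow> real ^ 'm ^ 'd) \<Rightarrow> 'w \<Rightarrow> real ^ 'd" where
  "step_integral W N u c \<omega> = (\<Sum>i<N. c i *v (W (u (Suc i)) \<omega> - W (u i) \<omega>))"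

text \<open>
  \<open>I\<close> is (a version of) the stochastic integral of the deterministic integrand \<open>g\<close> over
  \<open>[a, b]\<close>: step functions converge to \<open>g\<close> in \<open>L\<^sup>2(a, b)\<close> and their elementary integrals
  converge to \<open>I\<close> in mean square. By the isometry the limit does not depend on the
  approximating sequence (up to null sets). The norm on matrices is the Frobenius norm.
\<close>

definition has_wiener_integral ::
    "'w measure \<Rightarrow> (real \<Rightarrow> 'w \<Rightarrow> real ^ 'm) \<Rightarrow> real \<Rightarrow> real \<Rightarrow> (real \<Rightarrow> real ^ 'm ^ 'd)
      \<Rightarrow> ('w \<Rightarrow> real ^ 'd) \<Rightarrow> bool" where
  "has_wiener_integral M W a b g I \<longleftrightarrow>
     I \<in> borel_measurable M \<and>
     (\<exists>N u c.
        (\<forall>n. is_partition a b (N n) (u n)) \<and>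
        ((\<lambda>n. \<integral>\<^sup>+ s\<in>{a..b}. ennreal ((norm (g s - step_fun (N n) (u n) (c n) s))\<^sup>2) \<partial>lborel)
           \<longlonglongrightarrow> 0) \<and>
        ((\<lambda>n. \<integral>\<^sup>+ \<omega>. ennreal ((norm (I \<omega> - step_integral W (N n) (u n) (c n) \<omega>))\<^sup>2) \<partial>M)
           \<longlonglongrightarrow> 0))"

text \<open>
  Adaptedness is with respect to the filtration augmented by null sets: \<open>X t\<close> has a
  version that is measurable with respect to the \<open>\<sigma>\<close>-algebra of increments up to time \<open>t\<close>.
\<close>

definition sde_solution ::
    "'w measure \<Rightarrow> (real \<Rightarrow> 'w \<Rightarrow> real ^ 'm) \<Rightarrow> real ^ 'd ^ 'd \<Rightarrow> (real \<Rightarrow> real ^ 'd \<Rightarrow> real ^ 'd)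
      \<Rightarrow> (real \<Rightarrow> real ^ 'm ^ 'd) \<Rightarrow> real \<Rightarrow> ('w \<Rightarrow> real ^ 'd) \<Rightarrow> (real \<Rightarrow> 'w \<Rightarrow> real ^ 'd) \<Rightarrow> bool" where
  "sde_solution M W A f g t0 \<xi> X \<longleftrightarrow>
     (\<forall>t\<ge>t0. \<exists>Y \<in> borel_measurable (wiener_filtration M W t). AE \<omega> in M. X t \<omega> = Y \<omega>) \<and>
     (AE \<omega> in M. continuous_on {t0..} (\<lambda>t. X t \<omega>)) \<and>
     (AE \<omega> in M. X t0 \<omega> = \<xi> \<omega>) \<and>
     (\<forall>t\<ge>t0. \<exists>I. has_wiener_integral M W t0 t g I \<and>
        (AE \<omega> in M. X t \<omega> =
           \<xi> \<omega> + integral {t0..t} (\<lambda>s. A *v X s \<omega> + f s (X s \<omega>)) + I \<omega>))"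

text \<open>Real power with the convention \<open>0\<^sup>0 = 1\<close>, whereas \<open>0 powr 0 = 0\<close>.\<close>

definition rpow :: "real \<Rightarrow> real \<Rightarrow> real" where
  "rpow r a = (if a = 0 then 1 else r powr a)"

text \<open>
  The eigenvalues \<open>\<lambda>\<^sub>1 \<le> \<dots> \<le> \<lambda>\<^sub>d\<close> of \<open>- A\<close> are \<open>lam 1, \<dots>, lam d\<close> with \<open>d = CARD('d)\<close>. The
  diffusion coefficient \<open>g\<close> may depend on the state here. The initial value of the solution
  started at time \<open>- k \<tau>\<close> is \<open>\<xi> k\<close>; the moment bounds are uniform in \<open>k\<close>.
\<close>

definition assumption_A ::
    "'w measure \<Rightarrow> real \<Rightarrow> real ^ 'd ^ 'd \<Rightarrow> (nat \<Rightarrow> real) \<Rightarrow> (real \<Rightarrow> real ^ 'd \<Rightarrow> real ^ 'd)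
      \<Rightarrow> (real \<Rightarrow> real ^ 'd \<Rightarrow> real ^ 'm ^ 'd) \<Rightarrow> real \<Rightarrow> real \<Rightarrow> real
      \<Rightarrow> (nat \<Rightarrow> 'w \<Rightarrow> real ^ 'd) \<Rightarrow> bool" where
  "assumption_A M \<tau> A lam f g p1 \<gamma> C1 \<xi> \<longleftrightarrow>
     transpose A = A \<and>
     (\<forall>x. x \<noteq> 0 \<longrightarrow> x \<bullet> (A *v x) < 0) \<and>
     (\<forall>i\<in>{1..CARD('d)}. 0 < lam i) \<and>
     mono_on {1..CARD('d)} lam \<and>
     (\<exists>e :: nat \<Rightarrow> real ^ 'd.
        (\<forall>i\<in>{1..CARD('d)}. \<forall>j\<in>{1..CARD('d)}. e i \<bullet> e j = (if i = j then 1 else 0)) \<and>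
        span (e ` {1..CARD('d)}) = UNIV \<and>
        (\<forall>i\<in>{1..CARD('d)}. A *v e i = - lam i *\<^sub>R e i)) \<and>
     0 < \<tau> \<and>
     continuous_on UNIV (\<lambda>(t, x). f t x) \<and>
     continuous_on UNIV (\<lambda>(t, x). g t x) \<and>
     (\<forall>t x. f (t + \<tau>) x = f t x) \<and>
     (\<forall>t x. g (t + \<tau>) x = g t x) \<and>
     1 < p1 \<and>
     (\<exists>\<alpha>1 < lam 1. \<forall>x y. \<forall>t\<in>{0..<\<tau>}.
        (x - y) \<bullet> (f t x - f t y) + (2 * p1 - 1) / 2 * (norm (g t x - g t y))\<^sup>2
          \<le> \<alpha>1 * (norm (x - y))\<^sup>2) \<and>
     1 \<le> \<gamma> \<and> \<gamma> < (p1 + 1) / 2 \<and> 0 < C1 \<and>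
     (\<forall>t x y. max (norm (f t x - f t y)) (norm (g t x - g t y))
        \<le> C1 * (1 + rpow (norm x) (\<gamma> - 1) + rpow (norm y) (\<gamma> - 1)) * norm (x - y)) \<and>
     (\<exists>C > 0. \<forall>x. \<forall>s\<in>{0..<\<tau>}. \<forall>t\<in>{0..<\<tau>}.
        max (norm (f t x - f s x)) (norm (g t x - g s x))
          \<le> C * (1 + norm x powr \<gamma>) * \<bar>t - s\<bar>) \<and>
     (\<forall>p \<ge> 1. \<exists>Cs > 0. \<forall>k. (\<integral>\<^sup>+ \<omega>. ennreal (norm (\<xi> k \<omega>) powr (2 * p)) \<partial>M) \<le> ennreal Cs)"

definition assumption_B ::
    "real \<Rightarrow> (nat \<Rightarrow> real) \<Rightarrow> (real \<Rightarrow> real ^ 'd \<Rightarrow> real ^ 'd)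
      \<Rightarrow> (real \<Rightarrow> real ^ 'm ^ 'd) \<Rightarrow> real \<Rightarrow> real \<Rightarrow> real \<Rightarrow> bool" where
  "assumption_B \<tau> lam f g p1 \<gamma> cf \<longleftrightarrow>
     continuous_on UNIV g \<and>
     (\<forall>t. g (t + \<tau>) = g t) \<and>
     (\<exists>cg > 0. (\<forall>t\<in>{0..<\<tau>}. norm (g t) \<le> cg) \<and>
        (\<forall>t1\<in>{0..<\<tau>}. \<forall>t2\<in>{0..<\<tau>}. norm (g t1 - g t2) \<le> cg * \<bar>t2 - t1\<bar>)) \<and>
     (\<exists>Df :: real \<times> (real ^ 'd) \<Rightarrow> (real \<times> (real ^ 'd)) \<Rightarrow>\<^sub>L (real ^ 'd).
        continuous_on UNIV Df \<and>
        (\<forall>z. ((\<lambda>(t, x). f t x) has_derivative blinfun_apply (Df z)) (at z))) \<and>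
     1 \<le> \<gamma> \<and> \<gamma> < (p1 + 1) / 2 \<and> cf < lam 1 \<and>
     (\<forall>x y. \<forall>t\<in>{0..<\<tau>}. (x - y) \<bullet> (f t x - f t y) \<le> cf * (norm (x - y))\<^sup>2) \<and>
     (\<exists>C > 0. \<forall>x y z. \<forall>t\<in>{0..<\<tau>}.
        norm (frechet_derivative (f t) (at x) z - frechet_derivative (f t) (at y) z)
          \<le> C * (1 + norm x + norm y) powr (max (\<gamma> - 2) 0) * norm (x - y) * norm z)"

definition proj :: "real \<Rightarrow> real \<Rightarrow> real ^ 'd \<Rightarrow> real ^ 'd" where
  "proj \<gamma> h x = (if x = 0 then 0
     else min 1 (h powr (- (1 / (2 * \<gamma>))) * inverse (norm x)) *\<^sub>R x)"

text \<open>\<open>proj_euler \<dots> k j\<close> is the approximation at time \<open>- k \<tau> + j h\<close> started at time \<open>- k \<tau>\<close>.\<close>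

primrec proj_euler ::
    "(real \<Rightarrow> 'w \<Rightarrow> real ^ 'm) \<Rightarrow> real \<Rightarrow> real ^ 'd ^ 'd \<Rightarrow> (real \<Rightarrow> real ^ 'd \<Rightarrow> real ^ 'd)
      \<Rightarrow> (real \<Rightarrow> real ^ 'm ^ 'd) \<Rightarrow> real \<Rightarrow> real \<Rightarrow> ('w \<Rightarrow> real ^ 'd) \<Rightarrow> nat \<Rightarrow> nat
      \<Rightarrow> 'w \<Rightarrow> real ^ 'd" where
  "proj_euler W \<tau> A f g \<gamma> h \<xi> k 0 = \<xi>"
| "proj_euler W \<tau> A f g \<gamma> h \<xi> k (Suc j) = (\<lambda>\<omega>.
     let y = proj \<gamma> h (proj_euler W \<tau> A f g \<gamma> h \<xi> k j \<omega>)
     in y + h *\<^sub>R (A *v y) + h *\<^sub>R f (real j * h) y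
        + g (real j * h) *v (W (- (real k * \<tau>) + real (Suc j) * h) \<omega> - W (- (real k * \<tau>) + real j * h) \<omega>))"

end

theory Submission
  imports Defs
begin

text \<open>
  Write \<open>\<Psi>\<^sub>t(x) = \<Phi>(x) + h A \<Phi>(x) + h f(t, \<Phi>(x))\<close>, so that the scheme is \<open>x \<mapsto> \<Psi>\<^sub>t(x) + g(t) \<Delta>W\<close>, and
  \<open>a = \<lambda>\<^sub>1 - c\<^sub>f\<close>. The projection \<open>\<Phi>\<close> is nonexpansive, and on its range the Lipschitz constant of \<open>f\<close> is so small
  that the step size restriction gives \<open>|\<Psi>\<^sub>t(x) - \<Psi>\<^sub>t(y)|\<^sup>2 \<le> (1 - a h) |x - y|\<^sup>2\<close>.

  Over one step the exact solution satisfies \<open>X\<^sub>t\<^sub>+\<^sub>h = \<Psi>\<^sub>t(X\<^sub>t) + g(t) \<Delta>W + R + S\<close>. With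
  \<open>N\<^sub>s = X\<^sub>s - X\<^sub>t - \<integral>\<^sub>t\<^sup>s (A X\<^sub>r + f(r, X\<^sub>r)) dr\<close>, the noise accumulated since \<open>t\<close>, one puts
  \<open>S = (A + D\<^sub>x f(t, X\<^sub>t)) \<integral> N\<^sub>s ds + (N\<^sub>t\<^sub>+\<^sub>h - g(t) \<Delta>W)\<close>. It is of size \<open>h\<^sup>3\<^sup>/\<^sup>2\<close> in mean square norm, but orthogonal to every
  bounded vector that is measurable with respect to the past, in particular to \<open>\<Psi>\<^sub>t(X\<^sub>t) - \<Psi>\<^sub>t(Y)\<close> for an iterate \<open>Y\<close>
  of the scheme, which is bounded because \<open>\<Phi>\<close> is. Since the noise is additive, a Taylor expansion of \<open>f\<close> shows that the rest
  \<open>R\<close> has size \<open>h\<^sup>2\<close>. Hence the mean square error obeys \<open>E\<^sub>j\<^sub>+\<^sub>1 \<le> (1 - a h / 2) E\<^sub>j + C h\<^sup>3\<close>, so it stays below a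
  multiple of \<open>h\<^sup>2\<close>.

  All moments of \<open>X\<close> are bounded uniformly in time by a pathwise estimate: \<open>X - N\<close> solves an ordinary differential
  equation with a dissipative right-hand side, so no Ito formula is needed.
\<close>

section \<open>Time integrals and uniformly bounded moments\<close>

text \<open>Adding about 1/h local errors of size h^(3/2) per unit of time by the triangle
  inequality would give order 1/2 only. Orthogonality lets S enter through its second moment h^3
  without a cross term; R keeps its cross term, which costs a factor 1/(a h) in Young's inequality
  and turns h^4 into h^3. Damping sums about 1/(a h) such contributions. The obstacle is how little
  a solution provides: each X_t is adapted only up to a null set, the Wiener integral is given
  separately at each time by some partitions, and no joint measurability in time and \<omega> is at
  hand. So the noise is read off pathwise from X, which makes it continuous in time outside one null
  set for each k; at fixed times it is an increment of Wiener integrals, hence a mean square limit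
  of grid sums over later increments. Orders in h are recorded by dividing an error term by its
  expected size and bounding all moments of the quotient uniformly in k, t and h.\<close>

definition riemann :: "real \<Rightarrow> real \<Rightarrow> (real \<Rightarrow> 'a::real_vector) \<Rightarrow> nat \<Rightarrow> 'a" where
  "riemann a b \<phi> n = (\<Sum>i<n. ((b - a) / real n) *\<^sub>R \<phi> (a + real i * ((b - a) / real n)))"

lemma integral_sum_partition:
  fixes \<phi> :: "real \<Rightarrow> 'a::banach"
  assumes "\<And>i. i < n \<Longrightarrow> p i \<le> p (Suc i)" and "\<phi> integrable_on {p 0..p n}"
  shows "p 0 \<le> p n \<and> integral {p 0..p n} \<phi> = (\<Sum>i<n. integral {p i..p (Suc i)} \<phi>)"
  using assms
proof (induction n)
  case (Suc n)
  note step = Suc.prems(1)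
  have le: "p n \<le> p (Suc n)" using step by simp
  have "p 0 \<le> p j" if "j \<le> n" for j
    using that
  proof (induction j)
    case (Suc j)
    then show ?case using step[of j] by simp
  qed simp
  then have le0: "p 0 \<le> p n" by simp
  have "\<phi> integrable_on {p 0..p n}"
    by (rule integrable_on_subinterval[OF Suc.prems(2)]) (use le in auto)
  then have IH: "integral {p 0..p n} \<phi> = (\<Sum>i<n. integral {p i..p (Suc i)} \<phi>)"
    using Suc.IH Suc.prems(1) by simp
  have "integral {p 0..p (Suc n)} \<phi> = integral {p 0..p n} \<phi> + integral {p n..p (Suc n)} \<phi>"
    using Henstock_Kurzweil_Integration.integral_combine[OF le0 le Suc.prems(2)] by simp
  then show ?case using IH le0 le by simp
qed auto

lemma integral_uniform_partition:
  fixes \<phi> :: "real \<Rightarrow> 'a::banach"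
  assumes "a \<le> b" "0 < n" "\<phi> integrable_on {a..b}"
  defines "\<delta> \<equiv> (b - a) / real n"
  shows "integral {a..b} \<phi> = (\<Sum>i<n. integral {a + real i * \<delta>..a + real (Suc i) * \<delta>} \<phi>)"
proof -
  have "\<delta> \<ge> 0" using assms by simp
  moreover have "a + real n * \<delta> = b" using assms by simp
  ultimately show ?thesis
    using integral_sum_partition[of n "\<lambda>i. a + real i * \<delta>" \<phi>] assms(3)
    by (simp add: algebra_simps)
qed

lemma uniform_point_in:
  assumes "a \<le> b" "i < n" "s \<in> {a + real i * ((b - a) / real n)..a + real (Suc i) * ((b - a) / real n)}"
  shows "s \<in> {a..b}"
proof -
  have n: "real n > 0" using assms by simp
  have "real (Suc i) * ((b - a) / real n) \<le> real n * ((b - a) / real n)"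
    using assms by (intro mult_right_mono) auto
  also have "\<dots> = b - a" using n by simp
  finally have "s \<le> b" using assms(3) by simp
  moreover have "0 \<le> real i * ((b - a) / real n)" using assms by simp
  ultimately show ?thesis using assms(3) by auto
qed

lemma uniform_point_in':
  assumes "a \<le> b" "i < n" shows "a + real i * ((b - a) / real n) \<in> {a..b}"
proof (rule uniform_point_in[OF assms])
  have "0 \<le> (b - a) / real n" using assms by simp
  then show "a + real i * ((b - a) / real n) \<in> {a + real i * ((b - a) / real n)..a + real (Suc i) * ((b - a) / real n)}"
    by (simp add: algebra_simps del: times_divide_eq_right)
qed

lemma riemann_tendsto:
  fixes \<phi> :: "real \<Rightarrow> 'a::banach"
  assumes ab: "a \<le> b" and cont: "continuous_on {a..b} \<phi>"
  shows "riemann a b \<phi> \<longlonglongrightarrow> integral {a..b} \<phi>"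
proof (rule LIMSEQ_I)
  fix r :: real assume "0 < r"
  \<comment> \<open>Adding 1 to the length keeps the denominator positive when \<open>a = b\<close>;
    the factor 2 makes the final inequality strict.\<close>
  define e where "e = r / (2 * (b - a + 1))"
  have e: "e > 0" using \<open>0 < r\<close> ab by (simp add: e_def)
  have "uniformly_continuous_on {a..b} \<phi>"
    by (rule compact_uniformly_continuous[OF cont]) auto
  then obtain d where d: "d > 0" "\<And>x y. x \<in> {a..b} \<Longrightarrow> y \<in> {a..b} \<Longrightarrow> dist x y < d \<Longrightarrow> dist (\<phi> x) (\<phi> y) < e"
    unfolding uniformly_continuous_on_def using e by metis
  obtain N :: nat where N: "real N > (b - a) / d" using reals_Archimedean2 by blast
  show "\<exists>no. \<forall>n\<ge>no. norm (riemann a b \<phi> n - integral {a..b} \<phi>) < r"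
  proof (intro exI[of _ "Suc N"] allI impI)
    fix n assume n: "Suc N \<le> n"
    then have n0: "0 < n" by simp
    define \<delta> where "\<delta> = (b - a) / real n"
    have \<delta>0: "\<delta> \<ge> 0" using ab by (simp add: \<delta>_def)
    have "(b - a) / d < real n" using N n by linarith
    then have \<delta>d: "\<delta> < d" using n0 d(1) by (simp add: \<delta>_def field_simps)
    have io: "\<phi> integrable_on {a..b}" by (rule integrable_continuous_real[OF cont])
    have piece: "norm (\<delta> *\<^sub>R \<phi> (a + real i * \<delta>) - integral {a + real i * \<delta>..a + real (Suc i) * \<delta>} \<phi>) \<le> e * \<delta>"
      if "i < n" for i
    proof -
      let ?l = "a + real i * \<delta>" and ?u = "a + real (Suc i) * \<delta>"
      have lu: "?l \<le> ?u" using \<delta>0 by (simp add: algebra_simps)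
      have sub: "{?l..?u} \<subseteq> {a..b}"
        using uniform_point_in[OF ab that] unfolding \<delta>_def by blast
      have c: "continuous_on {?l..?u} \<phi>" by (rule continuous_on_subset[OF cont sub])
      have "norm (integral {?l..?u} (\<lambda>s. \<phi> ?l - \<phi> s)) \<le> e * (?u - ?l)"
      proof (rule integral_bound[OF lu])
        show "continuous_on {?l..?u} (\<lambda>s. \<phi> ?l - \<phi> s)" by (intro continuous_intros c)
        fix t assume t: "t \<in> {?l..?u}"
        have "dist ?l t < d" using t \<delta>d lu by (auto simp: dist_real_def algebra_simps)
        then show "norm (\<phi> ?l - \<phi> t) \<le> e"
          using d(2)[of ?l t] sub t lu by (force simp: dist_norm)
      qed
      also have "integral {?l..?u} (\<lambda>s. \<phi> ?l - \<phi> s) = \<delta> *\<^sub>R \<phi> ?l - integral {?l..?u} \<phi>"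
        using lu integrable_continuous_real[OF c]
        by (subst Henstock_Kurzweil_Integration.integral_diff) (auto simp: algebra_simps)
      finally show ?thesis by (simp add: algebra_simps)
    qed
    have "riemann a b \<phi> n - integral {a..b} \<phi> =
        (\<Sum>i<n. \<delta> *\<^sub>R \<phi> (a + real i * \<delta>) - integral {a + real i * \<delta>..a + real (Suc i) * \<delta>} \<phi>)"
      unfolding riemann_def integral_uniform_partition[OF ab n0 io] \<delta>_def[symmetric] sum_subtractf ..
    also have "norm \<dots> \<le> (\<Sum>i<n. e * \<delta>)"
      by (intro order.trans[OF norm_sum] sum_mono piece) auto
    also have "\<dots> = e * (b - a)" using n0 by (simp add: \<delta>_def)
    also have "\<dots> \<le> e * (b - a + 1)" using e by (simp add: algebra_simps)
    also have "\<dots> = r / 2" using ab by (simp add: e_def field_simps)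
    also have "\<dots> < r" using \<open>0 < r\<close> by simp
    finally show "norm (riemann a b \<phi> n - integral {a..b} \<phi>) < r" .
  qed
qed

section \<open>Convexity inequalities for powers\<close>

lemma convex_on_power_nonneg: "convex_on {0..} (\<lambda>x::real. x ^ p)"
  by (cases "even p") (auto intro: convex_power_odd convex_on_subset[OF convex_power_even])

text \<open>Jensen's inequality with equal weights, multiplied by a power of the number of
  terms.\<close>

lemma power_sum_mean:
  fixes x :: "'i \<Rightarrow> real"
  assumes "finite I" "\<And>i. i \<in> I \<Longrightarrow> 0 \<le> x i" "1 \<le> p"
  shows "(\<Sum>i\<in>I. x i) ^ p \<le> real (card I) ^ (p - 1) * (\<Sum>i\<in>I. x i ^ p)"
proof (cases "I = {}")
  case True then show ?thesis using assms by (simp add: power_0_left)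
next
  case False
  then have n: "card I > 0" using assms(1) by (simp add: card_gt_0_iff)
  note cv = convex_on_power_nonneg[of p]
  have "((\<Sum>i\<in>I. (1 / real (card I)) *\<^sub>R x i)) ^ p \<le> (\<Sum>i\<in>I. (1 / real (card I)) * x i ^ p)"
    by (rule convex_on_sum[OF _ _ cv]) (use False assms n in auto)
  then have "(\<Sum>i\<in>I. x i) ^ p / real (card I) ^ p \<le> (\<Sum>i\<in>I. x i ^ p) / real (card I)"
    by (simp add: sum_divide_distrib[symmetric] power_divide)
  then have "(\<Sum>i\<in>I. x i) ^ p \<le> (\<Sum>i\<in>I. x i ^ p) * (real (card I) ^ p / real (card I))"
    using n by (simp add: field_simps)
  also have "real (card I) ^ p / real (card I) = real (card I) ^ (p - 1)"
    using n assms(3) by (simp add: power_diff)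
  finally show ?thesis by (simp add: mult.commute)
qed

text \<open>Convexity at \<theta> u + (1 - \<theta>) (v / (1 - \<theta>)). The factor in front of
  u^p stays \<theta> < 1, so a recursion with geometric decay keeps its decay after passing to p-th
  powers.\<close>

lemma power_add_weighted:
  fixes u v \<theta> :: real
  assumes "0 \<le> u" "0 \<le> v" "0 < \<theta>" "\<theta> < 1" "1 \<le> p"
  shows "(\<theta> * u + v) ^ p \<le> \<theta> * u ^ p + v ^ p / (1 - \<theta>) ^ (p - 1)"
proof -
  note cv = convex_on_power_nonneg[of p]
  have "((1 - \<theta>) *\<^sub>R (v / (1 - \<theta>)) + \<theta> *\<^sub>R u) ^ p \<le> (1 - \<theta>) * (v / (1 - \<theta>)) ^ p + \<theta> * u ^ p"
    by (rule convex_onD[OF cv]) (use assms in auto)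
  moreover have "(1 - \<theta>) * (v / (1 - \<theta>)) ^ p = v ^ p / (1 - \<theta>) ^ (p - 1)"
    using assms by (cases p) (auto simp: power_divide)
  ultimately show ?thesis using assms by (simp add: add.commute)
qed

section \<open>Families of random variables with uniformly bounded moments\<close>

text \<open>Completeness enters here: solutions and their time integrals are known only up to null
  sets.\<close>

lemma (in complete_measure) borel_measurable_AE_eq:
  fixes X Y :: "'a \<Rightarrow> 'b::topological_space"
  assumes Y: "Y \<in> borel_measurable M" and eq: "AE \<omega> in M. X \<omega> = Y \<omega>"
  shows "X \<in> borel_measurable M"
proof (rule measurableI)
  fix B :: "'b set" assume B: "B \<in> sets borel"
  show "X -` B \<inter> space M \<in> sets M"
    by (rule in_sets_AE[of "Y -` B \<inter> space M"])
      (use eq Y B in \<open>auto intro: measurable_sets elim!: eventually_mono\<close>)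
qed simp

text \<open>The index set carries start index, times and step size, so one constant \<open>K\<close>
  per order expresses uniformity in all of them. Since every order is included, the class is closed
  under products and powers, and polynomial bounds on error terms can be checked factor by factor.
  Nonnegative integrals avoid integrability side conditions.\<close>

definition bdd_moments :: "'w measure \<Rightarrow> 'i set \<Rightarrow> ('i \<Rightarrow> 'w \<Rightarrow> 'e::real_normed_vector) \<Rightarrow> bool" where
  "bdd_moments M S Z \<longleftrightarrow> (\<forall>i\<in>S. Z i \<in> borel_measurable M) \<and>
     (\<forall>p\<ge>1. \<exists>K\<ge>0. \<forall>i\<in>S. (\<integral>\<^sup>+ \<omega>. ennreal (norm (Z i \<omega>) ^ p) \<partial>M) \<le> ennreal K)"

lemma bdd_momentsD: "bdd_moments M S Z \<Longrightarrow> i \<in> S \<Longrightarrow> Z i \<in> borel_measurable M"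
  by (simp add: bdd_moments_def)

lemma bdd_momentsE:
  assumes "bdd_moments M S Z" "1 \<le> p"
  obtains K where "K \<ge> 0" "\<And>i. i \<in> S \<Longrightarrow> (\<integral>\<^sup>+ \<omega>. ennreal (norm (Z i \<omega>) ^ p) \<partial>M) \<le> ennreal K"
  using assms unfolding bdd_moments_def by metis

text \<open>Pathwise estimates control squares of norms, hence even powers; the other orders follow
  from u^p <= 1 + u^(2p).\<close>

lemma bdd_moments_even:
  assumes meas: "\<And>i. i \<in> S \<Longrightarrow> Z i \<in> borel_measurable M" and M: "prob_space M"
    and *: "\<And>p. 1 \<le> p \<Longrightarrow> \<exists>K\<ge>0. \<forall>i\<in>S. (\<integral>\<^sup>+ \<omega>. ennreal (norm (Z i \<omega>) ^ (2 * p)) \<partial>M) \<le> ennreal K"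
  shows "bdd_moments M S Z"
  unfolding bdd_moments_def
proof (intro conjI ballI allI impI meas)
  fix p :: nat assume "1 \<le> p"
  then obtain K where K: "K \<ge> 0" "\<And>i. i \<in> S \<Longrightarrow> (\<integral>\<^sup>+ \<omega>. ennreal (norm (Z i \<omega>) ^ (2 * p)) \<partial>M) \<le> ennreal K"
    using * by metis
  interpret prob_space M by (rule M)
  show "\<exists>K\<ge>0. \<forall>i\<in>S. (\<integral>\<^sup>+ \<omega>. ennreal (norm (Z i \<omega>) ^ p) \<partial>M) \<le> ennreal K"
  proof (intro exI[of _ "1 + K"] conjI ballI)
    fix i assume i: "i \<in> S"
    note meas[OF i, measurable]
    have "(\<integral>\<^sup>+ \<omega>. ennreal (norm (Z i \<omega>) ^ p) \<partial>M) \<le> (\<integral>\<^sup>+ \<omega>. 1 + ennreal (norm (Z i \<omega>) ^ (2 * p)) \<partial>M)"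
    proof (intro nn_integral_mono)
      fix \<omega>
      have "norm (Z i \<omega>) ^ p \<le> 1 + (norm (Z i \<omega>) ^ p)\<^sup>2"
        using zero_le_power2[of "norm (Z i \<omega>) ^ p - 1/2"] by (simp add: power2_eq_square algebra_simps)
      then have "norm (Z i \<omega>) ^ p \<le> 1 + norm (Z i \<omega>) ^ (2 * p)"
        by (simp add: power_mult[symmetric] mult.commute)
      then show "ennreal (norm (Z i \<omega>) ^ p) \<le> 1 + ennreal (norm (Z i \<omega>) ^ (2 * p))"
        by (metis ennreal_1 ennreal_leI ennreal_plus zero_le_one norm_ge_zero zero_le_power)
    qed
    also have "\<dots> = 1 + (\<integral>\<^sup>+ \<omega>. ennreal (norm (Z i \<omega>) ^ (2 * p)) \<partial>M)"
      by (subst nn_integral_add) (auto simp: emeasure_space_1)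
    also have "\<dots> \<le> 1 + ennreal K" using K(2)[OF i] by (intro add_left_mono)
    finally show "(\<integral>\<^sup>+ \<omega>. ennreal (norm (Z i \<omega>) ^ p) \<partial>M) \<le> ennreal (1 + K)"
      using K(1) by (simp add: ennreal_plus)
  qed (use K in simp)
qed

lemma bdd_moments_dominated:
  assumes Y: "bdd_moments M S Y" and Z: "\<And>i. i \<in> S \<Longrightarrow> Z i \<in> borel_measurable M"
    and le: "\<And>i. i \<in> S \<Longrightarrow> AE \<omega> in M. norm (Z i \<omega>) \<le> norm (Y i \<omega>)"
  shows "bdd_moments M S Z"
  unfolding bdd_moments_def
proof (intro conjI ballI allI impI Z)
  fix p :: nat assume "1 \<le> p"
  then obtain K where K: "K \<ge> 0" "\<And>i. i \<in> S \<Longrightarrow> (\<integral>\<^sup>+ \<omega>. ennreal (norm (Y i \<omega>) ^ p) \<partial>M) \<le> ennreal K"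
    using bdd_momentsE[OF Y] by metis
  have "(\<integral>\<^sup>+ \<omega>. ennreal (norm (Z i \<omega>) ^ p) \<partial>M) \<le> ennreal K" if i: "i \<in> S" for i
  proof -
    have "(\<integral>\<^sup>+ \<omega>. ennreal (norm (Z i \<omega>) ^ p) \<partial>M) \<le> (\<integral>\<^sup>+ \<omega>. ennreal (norm (Y i \<omega>) ^ p) \<partial>M)"
      by (rule nn_integral_mono_AE) (use le[OF i] in \<open>auto elim!: eventually_mono intro!: ennreal_leI power_mono\<close>)
    then show ?thesis using K(2)[OF i] by simp
  qed
  then show "\<exists>K\<ge>0. \<forall>i\<in>S. (\<integral>\<^sup>+ \<omega>. ennreal (norm (Z i \<omega>) ^ p) \<partial>M) \<le> ennreal K" using K by blast
qed

lemma bdd_moments_norm: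
  "bdd_moments M S Z \<Longrightarrow> bdd_moments M S (\<lambda>i \<omega>. norm (Z i \<omega>))"
  by (rule bdd_moments_dominated) (auto dest: bdd_momentsD)

lemma bdd_moments_const: "prob_space M \<Longrightarrow> bdd_moments M S (\<lambda>i \<omega>. c)"
  unfolding bdd_moments_def
  by (auto simp: prob_space.emeasure_space_1 intro!: exI[of _ "norm c ^ _"])

lemma bdd_moments_add:
  fixes Y Z :: "'i \<Rightarrow> 'w \<Rightarrow> 'e::{real_normed_vector, second_countable_topology}"
  assumes Y: "bdd_moments M S Y" and Z: "bdd_moments M S Z"
  shows "bdd_moments M S (\<lambda>i \<omega>. Y i \<omega> + Z i \<omega>)"
  unfolding bdd_moments_def
proof (intro conjI ballI allI impI)
  fix i assume "i \<in> S"
  then show "(\<lambda>\<omega>. Y i \<omega> + Z i \<omega>) \<in> borel_measurable M"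
    using bdd_momentsD[OF Y] bdd_momentsD[OF Z] by (intro borel_measurable_add) auto
next
  fix p :: nat assume p: "1 \<le> p"
  obtain K where K: "K \<ge> 0" "\<And>i. i \<in> S \<Longrightarrow> (\<integral>\<^sup>+ \<omega>. ennreal (norm (Y i \<omega>) ^ p) \<partial>M) \<le> ennreal K"
    using bdd_momentsE[OF Y p] by metis
  obtain L where L: "L \<ge> 0" "\<And>i. i \<in> S \<Longrightarrow> (\<integral>\<^sup>+ \<omega>. ennreal (norm (Z i \<omega>) ^ p) \<partial>M) \<le> ennreal L"
    using bdd_momentsE[OF Z p] by metis
  have "(\<integral>\<^sup>+ \<omega>. ennreal (norm (Y i \<omega> + Z i \<omega>) ^ p) \<partial>M) \<le> ennreal (2 ^ p * (K + L))" if i: "i \<in> S" for i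
  proof -
    note bdd_momentsD[OF Y i, measurable] bdd_momentsD[OF Z i, measurable]
    have "(\<integral>\<^sup>+ \<omega>. ennreal (norm (Y i \<omega> + Z i \<omega>) ^ p) \<partial>M) \<le>
      (\<integral>\<^sup>+ \<omega>. ennreal (2 ^ p) * (ennreal (norm (Y i \<omega>) ^ p) + ennreal (norm (Z i \<omega>) ^ p)) \<partial>M)"
    proof (intro nn_integral_mono)
      fix \<omega>
      let ?y = "norm (Y i \<omega>)" and ?z = "norm (Z i \<omega>)"
      have "norm (Y i \<omega> + Z i \<omega>) ^ p \<le> (?y + ?z) ^ p"
        by (intro power_mono norm_triangle_ineq) auto
      also have "\<dots> \<le> (2 * max ?y ?z) ^ p" by (intro power_mono) auto
      also have "\<dots> = 2 ^ p * max ?y ?z ^ p" by (simp add: power_mult_distrib)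
      also have "\<dots> \<le> 2 ^ p * (?y ^ p + ?z ^ p)"
        by (intro mult_left_mono) (auto simp: max_def)
      finally show "ennreal (norm (Y i \<omega> + Z i \<omega>) ^ p) \<le> ennreal (2 ^ p) * (ennreal (?y ^ p) + ennreal (?z ^ p))"
        by (simp add: ennreal_leI flip: ennreal_plus ennreal_mult)
    qed
    also have "\<dots> = ennreal (2 ^ p) * ((\<integral>\<^sup>+ \<omega>. ennreal (norm (Y i \<omega>) ^ p) \<partial>M) + (\<integral>\<^sup>+ \<omega>. ennreal (norm (Z i \<omega>) ^ p) \<partial>M))"
      by (subst nn_integral_cmult) (auto simp: nn_integral_add)
    also have "\<dots> \<le> ennreal (2 ^ p) * (ennreal K + ennreal L)"
      by (intro mult_left_mono add_mono K L i) auto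
    also have "\<dots> = ennreal (2 ^ p * (K + L))" using K L by (simp add: ennreal_mult ennreal_plus)
    finally show ?thesis .
  qed
  then show "\<exists>K\<ge>0. \<forall>i\<in>S. (\<integral>\<^sup>+ \<omega>. ennreal (norm (Y i \<omega> + Z i \<omega>) ^ p) \<partial>M) \<le> ennreal K"
    using K L by (intro exI[of _ "2 ^ p * (K + L)"]) auto
qed

text \<open>In place of the Cauchy-Schwarz inequality, y z <= y^2 + z^2 is applied to p-th powers;
  the price is moments of order 2p, available because all orders are bounded.\<close>

lemma bdd_moments_mult:
  fixes Y Z :: "'i \<Rightarrow> 'w \<Rightarrow> real"
  assumes Y: "bdd_moments M S Y" and Z: "bdd_moments M S Z"
  shows "bdd_moments M S (\<lambda>i \<omega>. Y i \<omega> * Z i \<omega>)"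
  unfolding bdd_moments_def
proof (intro conjI ballI allI impI)
  fix i assume "i \<in> S"
  then show "(\<lambda>\<omega>. Y i \<omega> * Z i \<omega>) \<in> borel_measurable M"
    using bdd_momentsD[OF Y] bdd_momentsD[OF Z] by (intro borel_measurable_times) auto
next
  fix p :: nat assume p: "1 \<le> p"
  then have p2: "1 \<le> 2 * p" by simp
  obtain K where K: "K \<ge> 0" "\<And>i. i \<in> S \<Longrightarrow> (\<integral>\<^sup>+ \<omega>. ennreal (norm (Y i \<omega>) ^ (2 * p)) \<partial>M) \<le> ennreal K"
    using bdd_momentsE[OF Y p2] by metis
  obtain L where L: "L \<ge> 0" "\<And>i. i \<in> S \<Longrightarrow> (\<integral>\<^sup>+ \<omega>. ennreal (norm (Z i \<omega>) ^ (2 * p)) \<partial>M) \<le> ennreal L"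
    using bdd_momentsE[OF Z p2] by metis
  have "(\<integral>\<^sup>+ \<omega>. ennreal (norm (Y i \<omega> * Z i \<omega>) ^ p) \<partial>M) \<le> ennreal (K + L)" if i: "i \<in> S" for i
  proof -
    note bdd_momentsD[OF Y i, measurable] bdd_momentsD[OF Z i, measurable]
    have "(\<integral>\<^sup>+ \<omega>. ennreal (norm (Y i \<omega> * Z i \<omega>) ^ p) \<partial>M) \<le>
      (\<integral>\<^sup>+ \<omega>. ennreal (norm (Y i \<omega>) ^ (2 * p)) + ennreal (norm (Z i \<omega>) ^ (2 * p)) \<partial>M)"
    proof (intro nn_integral_mono)
      fix \<omega>
      let ?y = "norm (Y i \<omega>) ^ p" and ?z = "norm (Z i \<omega>) ^ p"
      have "0 \<le> (?y - ?z)\<^sup>2" "0 \<le> ?y * ?z" by auto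
      then have "?y * ?z \<le> ?y\<^sup>2 + ?z\<^sup>2"
        unfolding power2_diff by linarith
      then have "norm (Y i \<omega> * Z i \<omega>) ^ p \<le> norm (Y i \<omega>) ^ (2 * p) + norm (Z i \<omega>) ^ (2 * p)"
        by (simp add: abs_mult power_mult_distrib power_mult[symmetric] mult.commute)
      then show "ennreal (norm (Y i \<omega> * Z i \<omega>) ^ p) \<le> ennreal (norm (Y i \<omega>) ^ (2 * p)) + ennreal (norm (Z i \<omega>) ^ (2 * p))"
        by (simp add: ennreal_leI flip: ennreal_plus)
    qed
    also have "\<dots> = (\<integral>\<^sup>+ \<omega>. ennreal (norm (Y i \<omega>) ^ (2 * p)) \<partial>M) + (\<integral>\<^sup>+ \<omega>. ennreal (norm (Z i \<omega>) ^ (2 * p)) \<partial>M)"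
      by (rule nn_integral_add) auto
    also have "\<dots> \<le> ennreal K + ennreal L"
      by (intro add_mono K L i)
    also have "\<dots> = ennreal (K + L)" using K L by (simp add: ennreal_plus)
    finally show ?thesis .
  qed
  then show "\<exists>K\<ge>0. \<forall>i\<in>S. (\<integral>\<^sup>+ \<omega>. ennreal (norm (Y i \<omega> * Z i \<omega>) ^ p) \<partial>M) \<le> ennreal K"
    using K L by (intro exI[of _ "K + L"]) auto
qed

lemma bdd_moments_power:
  fixes Y :: "'i \<Rightarrow> 'w \<Rightarrow> real"
  assumes "prob_space M" "bdd_moments M S Y"
  shows "bdd_moments M S (\<lambda>i \<omega>. Y i \<omega> ^ n)"
  by (induction n) (auto intro!: bdd_moments_mult bdd_moments_const assms)

lemma bdd_moments_reindex:
  assumes "bdd_moments M S Z" "\<And>i. i \<in> S' \<Longrightarrow> r i \<in> S"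
  shows "bdd_moments M S' (\<lambda>i. Z (r i))"
  using assms unfolding bdd_moments_def by blast

text \<open>Time integrals are pointwise limits of Riemann sums, so that Fatou's lemma turns moment bounds on
  the integrand into moment bounds on the integral without joint measurability.\<close>

lemma measurable_time_integral:
  fixes \<Phi> :: "real \<Rightarrow> 'w \<Rightarrow> 'e::{banach, second_countable_topology}"
  assumes "complete_measure M" and ab: "a \<le> b"
    and meas: "\<And>s. s \<in> {a..b} \<Longrightarrow> \<Phi> s \<in> borel_measurable M"
    and cont: "AE \<omega> in M. continuous_on {a..b} (\<lambda>s. \<Phi> s \<omega>)"
  shows "(\<lambda>\<omega>. integral {a..b} (\<lambda>s. \<Phi> s \<omega>)) \<in> borel_measurable M"
proof -
  interpret complete_measure M by fact
  obtain N where N: "N \<in> null_sets M" "{\<omega> \<in> space M. \<not> continuous_on {a..b} (\<lambda>s. \<Phi> s \<omega>)} \<subseteq> N"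
    using cont by (auto simp: eventually_ae_filter)
  \<comment> \<open>Replacing the paths on a null set by 0 makes the Riemann sums converge for every
    \<omega>, as the measurability of a pointwise limit requires.\<close>
  define \<Psi> where "\<Psi> s \<omega> = (if \<omega> \<in> N then 0 else \<Phi> s \<omega>)" for s \<omega>
  have "(\<lambda>\<omega>. integral {a..b} (\<lambda>s. \<Psi> s \<omega>)) \<in> borel_measurable M"
  proof (rule borel_measurable_LIMSEQ_metric)
    show "(\<lambda>n. riemann a b (\<lambda>s. \<Psi> s \<omega>) n) \<longlonglongrightarrow> integral {a..b} (\<lambda>s. \<Psi> s \<omega>)"
      if "\<omega> \<in> space M" for \<omega>
      using that N(2) by (intro riemann_tendsto ab) (cases "\<omega> \<in> N", auto simp: \<Psi>_def)
    show "(\<lambda>\<omega>. riemann a b (\<lambda>s. \<Psi> s \<omega>) n) \<in> borel_measurable M" for n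
      unfolding riemann_def \<Psi>_def
    proof (intro borel_measurable_sum borel_measurable_scaleR borel_measurable_const measurable_If_set)
      fix i assume "i \<in> {..<n}"
      then have "a + real i * ((b - a) / real n) \<in> {a..b}" by (intro uniform_point_in' ab) simp
      then show "\<Phi> (a + real i * ((b - a) / real n)) \<in> borel_measurable M" by (rule meas)
    qed (use N(1) in auto)
  qed
  moreover have "AE \<omega> in M. integral {a..b} (\<lambda>s. \<Phi> s \<omega>) = integral {a..b} (\<lambda>s. \<Psi> s \<omega>)"
    using AE_not_in[OF N(1)] by eventually_elim (simp add: \<Psi>_def)
  ultimately show ?thesis by (rule borel_measurable_AE_eq)
qed

lemma nn_integral_time_integral_power:
  fixes \<Phi> :: "real \<Rightarrow> 'w \<Rightarrow> 'e::{banach, second_countable_topology}"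
  assumes ab: "a \<le> b"
    and meas: "\<And>s. s \<in> {a..b} \<Longrightarrow> \<Phi> s \<in> borel_measurable M"
    and cont: "AE \<omega> in M. continuous_on {a..b} (\<lambda>s. \<Phi> s \<omega>)" and p: "1 \<le> p" and K: "0 \<le> K"
    and bound: "\<And>s. s \<in> {a..b} \<Longrightarrow> (\<integral>\<^sup>+ \<omega>. ennreal (norm (\<Phi> s \<omega>) ^ p) \<partial>M) \<le> ennreal K"
  shows "(\<integral>\<^sup>+ \<omega>. ennreal (norm (integral {a..b} (\<lambda>s. \<Phi> s \<omega>)) ^ p) \<partial>M) \<le> ennreal ((b - a) ^ p * K)"
proof -
  let ?R = "\<lambda>n \<omega>. riemann a b (\<lambda>s. \<Phi> s \<omega>) n"
  have R[measurable]: "?R n \<in> borel_measurable M" for n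
    unfolding riemann_def
  proof (intro borel_measurable_sum borel_measurable_scaleR borel_measurable_const meas)
    fix i assume "i \<in> {..<n}"
    then show "a + real i * ((b - a) / real n) \<in> {a..b}" by (intro uniform_point_in' ab) simp
  qed
  have Rb: "(\<integral>\<^sup>+ \<omega>. ennreal (norm (?R n \<omega>) ^ p) \<partial>M) \<le> ennreal ((b - a) ^ p * K)" for n
  proof (cases "n = 0")
    case True
    then show ?thesis using p by (simp add: riemann_def power_0_left)
  next
    case n: False
    define \<delta> where "\<delta> = (b - a) / real n"
    have \<delta>: "0 \<le> \<delta>" using ab by (simp add: \<delta>_def)
    let ?s = "\<lambda>i. a + real i * \<delta>"
    have s: "?s i \<in> {a..b}" if "i < n" for i
      unfolding \<delta>_def by (rule uniform_point_in'[OF ab that])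
    have "(\<integral>\<^sup>+ \<omega>. ennreal (norm (?R n \<omega>) ^ p) \<partial>M) \<le>
       (\<integral>\<^sup>+ \<omega>. (\<Sum>i<n. ennreal (real n ^ (p - 1) * \<delta> ^ p) * ennreal (norm (\<Phi> (?s i) \<omega>) ^ p)) \<partial>M)"
    proof (intro nn_integral_mono)
      fix \<omega>
      have "norm (?R n \<omega>) ^ p \<le> (\<Sum>i<n. \<delta> * norm (\<Phi> (?s i) \<omega>)) ^ p"
        unfolding riemann_def \<delta>_def[symmetric]
        using \<delta> by (intro power_mono order.trans[OF norm_sum]) auto
      also have "\<dots> \<le> real n ^ (p - 1) * (\<Sum>i<n. (\<delta> * norm (\<Phi> (?s i) \<omega>)) ^ p)"
        using \<delta> p power_sum_mean[of "{..<n}" "\<lambda>i. \<delta> * norm (\<Phi> (?s i) \<omega>)" p] by simp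
      also have "\<dots> = (\<Sum>i<n. (real n ^ (p - 1) * \<delta> ^ p) * norm (\<Phi> (?s i) \<omega>) ^ p)"
        by (simp add: sum_distrib_left power_mult_distrib mult.assoc)
      finally have "ennreal (norm (?R n \<omega>) ^ p) \<le> ennreal (\<Sum>i<n. (real n ^ (p - 1) * \<delta> ^ p) * norm (\<Phi> (?s i) \<omega>) ^ p)"
        by (rule ennreal_leI)
      also have "\<dots> = (\<Sum>i<n. ennreal (real n ^ (p - 1) * \<delta> ^ p) * ennreal (norm (\<Phi> (?s i) \<omega>) ^ p))"
        using \<delta> by (subst sum_ennreal[symmetric]) (auto simp: ennreal_mult)
      finally show "ennreal (norm (?R n \<omega>) ^ p) \<le> \<dots>" .
    qed
    also have "\<dots> = (\<Sum>i<n. ennreal (real n ^ (p - 1) * \<delta> ^ p) * (\<integral>\<^sup>+ \<omega>. ennreal (norm (\<Phi> (?s i) \<omega>) ^ p) \<partial>M))"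
      by (subst nn_integral_sum) (use meas[OF s] in \<open>auto intro!: sum.cong nn_integral_cmult\<close>)
    also have "\<dots> \<le> (\<Sum>i<n. ennreal (real n ^ (p - 1) * \<delta> ^ p) * ennreal K)"
      by (intro sum_mono mult_left_mono bound s) auto
    also have "\<dots> = ennreal (real n * (real n ^ (p - 1) * \<delta> ^ p * K))"
      using K \<delta> by (simp add: ennreal_mult ennreal_of_nat_eq_real_of_nat)
    \<comment> \<open>The powers of \<open>n\<close> cancel, so the bound is uniform in the mesh and
      passes to the limit inferior.\<close>
    also have "real n * (real n ^ (p - 1) * \<delta> ^ p * K) = (b - a) ^ p * K"
      using n p by (cases p) (auto simp: \<delta>_def power_divide)
    finally show ?thesis .
  qed
  have "(\<integral>\<^sup>+ \<omega>. ennreal (norm (integral {a..b} (\<lambda>s. \<Phi> s \<omega>)) ^ p) \<partial>M)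
      = (\<integral>\<^sup>+ \<omega>. liminf (\<lambda>n. ennreal (norm (?R n \<omega>) ^ p)) \<partial>M)"
  proof (rule nn_integral_cong_AE)
    show "AE \<omega> in M. ennreal (norm (integral {a..b} (\<lambda>s. \<Phi> s \<omega>)) ^ p) = liminf (\<lambda>n. ennreal (norm (?R n \<omega>) ^ p))"
      using cont
    proof eventually_elim
      case (elim \<omega>)
      have "(\<lambda>n. ennreal (norm (?R n \<omega>) ^ p)) \<longlonglongrightarrow> ennreal (norm (integral {a..b} (\<lambda>s. \<Phi> s \<omega>)) ^ p)"
        by (intro tendsto_ennrealI tendsto_intros riemann_tendsto ab elim)
      from lim_imp_Liminf[OF _ this] show ?case by simp
    qed
  qed
  also have "\<dots> \<le> liminf (\<lambda>n. \<integral>\<^sup>+ \<omega>. ennreal (norm (?R n \<omega>) ^ p) \<partial>M)"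
    by (rule nn_integral_liminf) auto
  also have "\<dots> \<le> ennreal ((b - a) ^ p * K)"
    using Rb by (intro Liminf_le) auto
  finally show ?thesis .
qed

text \<open>The normalisation \<open>c i\<close> need only dominate the length of the interval, so
  that dividing by the step size covers all intermediate times of a step at once.\<close>

lemma bdd_moments_time_average:
  fixes \<Phi> :: "'i \<Rightarrow> real \<Rightarrow> 'w \<Rightarrow> 'e::{banach, second_countable_topology}"
  assumes M: "complete_measure M" and ab: "\<And>i. i \<in> S \<Longrightarrow> a i \<le> b i \<and> b i - a i \<le> c i"
    and c: "\<And>i. i \<in> S \<Longrightarrow> 0 < c i"
    and cont: "\<And>i. i \<in> S \<Longrightarrow> AE \<omega> in M. continuous_on {a i..b i} (\<lambda>s. \<Phi> i s \<omega>)"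
    and bm: "bdd_moments M (SIGMA i:S. {a i..b i}) (\<lambda>(i, s). \<Phi> i s)"
  shows "bdd_moments M S (\<lambda>i \<omega>. (1 / c i) *\<^sub>R integral {a i..b i} (\<lambda>s. \<Phi> i s \<omega>))"
  unfolding bdd_moments_def
proof (intro conjI ballI allI impI)
  fix i assume i: "i \<in> S"
  have m: "\<Phi> i s \<in> borel_measurable M" if "s \<in> {a i..b i}" for s
    using bdd_momentsD[OF bm, of "(i, s)"] i that by auto
  have "(\<lambda>\<omega>. integral {a i..b i} (\<lambda>s. \<Phi> i s \<omega>)) \<in> borel_measurable M"
    by (rule measurable_time_integral[OF M _ m cont[OF i]]) (use ab[OF i] in auto)
  then show "(\<lambda>\<omega>. (1 / c i) *\<^sub>R integral {a i..b i} (\<lambda>s. \<Phi> i s \<omega>)) \<in> borel_measurable M"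
    by (rule borel_measurable_scaleR[OF borel_measurable_const])
next
  fix p :: nat assume p: "1 \<le> p"
  obtain K where K0: "K \<ge> 0" and K': "\<And>j. j \<in> (SIGMA i:S. {a i..b i}) \<Longrightarrow>
      (\<integral>\<^sup>+ \<omega>. ennreal (norm ((case j of (i, s) \<Rightarrow> \<Phi> i s) \<omega>) ^ p) \<partial>M) \<le> ennreal K"
    using bdd_momentsE[OF bm p] by metis
  have K: "K \<ge> 0" "(\<integral>\<^sup>+ \<omega>. ennreal (norm (\<Phi> i s \<omega>) ^ p) \<partial>M) \<le> ennreal K"
    if "i \<in> S" "s \<in> {a i..b i}" for i s
    using K0 K'[of "(i, s)"] that by simp_all
  have "(\<integral>\<^sup>+ \<omega>. ennreal (norm ((1 / c i) *\<^sub>R integral {a i..b i} (\<lambda>s. \<Phi> i s \<omega>)) ^ p) \<partial>M) \<le> ennreal K"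
    if i: "i \<in> S" for i
  proof -
    have m: "\<Phi> i s \<in> borel_measurable M" if "s \<in> {a i..b i}" for s
      using bdd_momentsD[OF bm, of "(i, s)"] i that by auto
    have ci: "0 < c i" using c i by simp
    have [measurable]: "(\<lambda>\<omega>. integral {a i..b i} (\<lambda>s. \<Phi> i s \<omega>)) \<in> borel_measurable M"
      by (rule measurable_time_integral[OF M _ m cont[OF i]]) (use ab[OF i] in auto)
    have "(\<integral>\<^sup>+ \<omega>. ennreal (norm ((1 / c i) *\<^sub>R integral {a i..b i} (\<lambda>s. \<Phi> i s \<omega>)) ^ p) \<partial>M)
      = (\<integral>\<^sup>+ \<omega>. ennreal ((1 / c i) ^ p) * ennreal (norm (integral {a i..b i} (\<lambda>s. \<Phi> i s \<omega>)) ^ p) \<partial>M)"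
      using ci by (intro nn_integral_cong) (simp add: power_divide flip: ennreal_mult)
    also have "\<dots> = ennreal ((1 / c i) ^ p) * (\<integral>\<^sup>+ \<omega>. ennreal (norm (integral {a i..b i} (\<lambda>s. \<Phi> i s \<omega>)) ^ p) \<partial>M)"
      by (rule nn_integral_cmult) auto
    also have "\<dots> \<le> ennreal ((1 / c i) ^ p) * ennreal ((b i - a i) ^ p * K)"
      by (intro mult_left_mono nn_integral_time_integral_power[OF _ m cont[OF i] p K0 K(2)[OF i]])
         (use ab[OF i] in auto)
    also have "\<dots> = ennreal (((b i - a i) / c i) ^ p * K)"
      using ci K0 ab[OF i] by (simp add: power_divide flip: ennreal_mult)
    also have "\<dots> \<le> ennreal (1 * K)"
      using ci K0 ab[OF i] by (intro ennreal_leI mult_right_mono power_le_one) (auto simp: field_simps)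
    finally show ?thesis by simp
  qed
  then show "\<exists>K\<ge>0. \<forall>i\<in>S. (\<integral>\<^sup>+ \<omega>. ennreal (norm ((1 / c i) *\<^sub>R integral {a i..b i} (\<lambda>s. \<Phi> i s \<omega>)) ^ p) \<partial>M) \<le> ennreal K"
    using K0 by blast
qed

section \<open>Wiener increments and elementary stochastic integrals\<close>

lemma nn_integral_exp_normal:
  assumes \<sigma>: "0 < \<sigma>" and D: "distributed M lborel Z (normal_density 0 \<sigma>)"
  shows "(\<integral>\<^sup>+ \<omega>. ennreal (exp (c * Z \<omega>)) \<partial>M) = ennreal (exp (c\<^sup>2 * \<sigma>\<^sup>2 / 2))"
proof -
  \<comment> \<open>Completing the square: exponential tilting shifts the mean of the Gaussian to c
    \<sigma>^2.\<close>
  have sq: "normal_density 0 \<sigma> x * exp (c * x) = exp (c\<^sup>2 * \<sigma>\<^sup>2 / 2) * normal_density (c * \<sigma>\<^sup>2) \<sigma> x" for x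
  proof -
    have "- (x - 0)\<^sup>2 / (2 * \<sigma>\<^sup>2) + c * x = c\<^sup>2 * \<sigma>\<^sup>2 / 2 + - (x - c * \<sigma>\<^sup>2)\<^sup>2 / (2 * \<sigma>\<^sup>2)"
      using \<sigma> by (simp add: field_simps power2_eq_square)
    then show ?thesis
      unfolding normal_density_def by (simp add: mult_exp_exp)
  qed
  have "(\<integral>\<^sup>+ \<omega>. ennreal (exp (c * Z \<omega>)) \<partial>M)
      = (\<integral>\<^sup>+ x. ennreal (normal_density 0 \<sigma> x) * ennreal (exp (c * x)) \<partial>lborel)"
    using distributed_nn_integral[OF D, of "\<lambda>x. ennreal (exp (c * x))"] by simp
  also have "\<dots> = (\<integral>\<^sup>+ x. ennreal (exp (c\<^sup>2 * \<sigma>\<^sup>2 / 2)) * ennreal (normal_density (c * \<sigma>\<^sup>2) \<sigma> x) \<partial>lborel)"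
    by (intro nn_integral_cong) (simp add: sq flip: ennreal_mult)
  also have "\<dots> = ennreal (exp (c\<^sup>2 * \<sigma>\<^sup>2 / 2)) * (\<integral>\<^sup>+ x. ennreal (normal_density (c * \<sigma>\<^sup>2) \<sigma> x) \<partial>lborel)"
    by (rule nn_integral_cmult) auto
  also have "(\<integral>\<^sup>+ x. ennreal (normal_density (c * \<sigma>\<^sup>2) \<sigma> x) \<partial>lborel) = 1"
    using integral_normal_density[OF \<sigma>] integrable_normal_density[OF \<sigma>]
    by (subst nn_integral_eq_integral) auto
  finally show ?thesis by simp
qed

lemma
  assumes \<sigma>: "0 < \<sigma>" and D: "distributed M lborel Z (normal_density 0 \<sigma>)"
  shows integrable_normal_var: "integrable M Z"
    and integral_normal_var: "(\<integral>\<omega>. Z \<omega> \<partial>M) = 0"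
    and integrable_normal_var_square: "integrable M (\<lambda>\<omega>. (Z \<omega>)\<^sup>2)"
    and integral_normal_var_square: "(\<integral>\<omega>. (Z \<omega>)\<^sup>2 \<partial>M) = \<sigma>\<^sup>2"
proof -
  show "integrable M Z"
    using distributed_integrable[OF D, of "\<lambda>x. x"] integrable_normal_moment_nz_1[OF \<sigma>, of 0] by auto
  show "(\<integral>\<omega>. Z \<omega> \<partial>M) = 0"
    using distributed_integral[OF D, of "\<lambda>x. x"] integral_normal_moment_nz_1[OF \<sigma>, of 0] by auto
  show "integrable M (\<lambda>\<omega>. (Z \<omega>)\<^sup>2)"
    using distributed_integrable[OF D, of "\<lambda>x. x\<^sup>2"] integrable_normal_moment[OF \<sigma>, of 0 2] by auto
  show "(\<integral>\<omega>. (Z \<omega>)\<^sup>2 \<partial>M) = \<sigma>\<^sup>2"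
    using distributed_integral[OF D, of "\<lambda>x. x\<^sup>2"] integral_normal_moment_even[OF \<sigma>, of 0 1] \<sigma> by auto
qed

lemma borel_measurable_vec_nth: "(\<lambda>x :: real ^ 'n. x $ i) \<in> borel_measurable borel"
  by (intro borel_measurable_continuous_onI continuous_intros)

section \<open>Covariances of Wiener increments\<close>

locale wiener = prob_space M for M :: "'w measure" +
  fixes W :: "real \<Rightarrow> 'w \<Rightarrow> real ^ 'm::finite"
  assumes wiener: "two_sided_wiener M W"
begin

lemma W_measurable [measurable]: "W t \<in> borel_measurable M"
  using wiener by (simp add: two_sided_wiener_def)

lemma W_nth_measurable [measurable]: "(\<lambda>\<omega>. W t \<omega> $ i) \<in> borel_measurable M"
  by (rule measurable_compose[OF W_measurable borel_measurable_vec_nth])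

lemma indep_components:
  "s < t \<Longrightarrow> indep_vars (\<lambda>_. borel) (\<lambda>i \<omega>. (W t \<omega> - W s \<omega>) $ i) UNIV"
  using wiener by (simp add: two_sided_wiener_def)

lemma normal_component:
  "s < t \<Longrightarrow> distributed M lborel (\<lambda>\<omega>. (W t \<omega> - W s \<omega>) $ i) (normal_density 0 (sqrt (t - s)))"
  using wiener by (simp add: two_sided_wiener_def)

lemma indep_increments:
  fixes u :: "nat \<Rightarrow> real"
  shows "(\<And>i. i < n \<Longrightarrow> u i < u (Suc i)) \<Longrightarrow>
    indep_vars (\<lambda>_. borel) (\<lambda>i \<omega>. W (u (Suc i)) \<omega> - W (u i) \<omega>) {..<n}"
  using wiener by (auto simp: two_sided_wiener_def)

lemma
  assumes "s \<le> t"
  shows increment_integrable: "integrable M (\<lambda>\<omega>. (W t \<omega> - W s \<omega>) $ i)"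
    and increment_mean: "(\<integral>\<omega>. (W t \<omega> - W s \<omega>) $ i \<partial>M) = 0"
    and increment_square_integrable: "integrable M (\<lambda>\<omega>. ((W t \<omega> - W s \<omega>) $ i)\<^sup>2)"
    and increment_variance: "(\<integral>\<omega>. ((W t \<omega> - W s \<omega>) $ i)\<^sup>2 \<partial>M) = t - s"
proof -
  have *: "integrable M (\<lambda>\<omega>. (W t \<omega> - W s \<omega>) $ i) \<and> (\<integral>\<omega>. (W t \<omega> - W s \<omega>) $ i \<partial>M) = 0 \<and>
     integrable M (\<lambda>\<omega>. ((W t \<omega> - W s \<omega>) $ i)\<^sup>2) \<and> (\<integral>\<omega>. ((W t \<omega> - W s \<omega>) $ i)\<^sup>2 \<partial>M) = t - s"
  proof (cases "s = t")
    case False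
    then have st: "s < t" "0 < sqrt (t - s)" using assms by auto
    note D = normal_component[OF st(1), of i]
    show ?thesis
      using integrable_normal_var[OF st(2) D] integral_normal_var[OF st(2) D]
        integrable_normal_var_square[OF st(2) D] integral_normal_var_square[OF st(2) D] st by simp
  qed auto
  show "integrable M (\<lambda>\<omega>. (W t \<omega> - W s \<omega>) $ i)" "(\<integral>\<omega>. (W t \<omega> - W s \<omega>) $ i \<partial>M) = 0"
    "integrable M (\<lambda>\<omega>. ((W t \<omega> - W s \<omega>) $ i)\<^sup>2)" "(\<integral>\<omega>. ((W t \<omega> - W s \<omega>) $ i)\<^sup>2 \<partial>M) = t - s"
    using * by blast+
qed

lemma
  assumes "s \<le> t"
  shows increment_components_integrable: "integrable M (\<lambda>\<omega>. (W t \<omega> - W s \<omega>) $ i * (W t \<omega> - W s \<omega>) $ j)" (is ?int)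
    and increment_components: "(\<integral>\<omega>. (W t \<omega> - W s \<omega>) $ i * (W t \<omega> - W s \<omega>) $ j \<partial>M) = (if i = j then t - s else 0)" (is ?eq)
proof -
  have "?int \<and> ?eq"
  proof (cases "i = j \<or> s = t")
    case True
    then show ?thesis
      using increment_square_integrable[OF assms, of i] increment_variance[OF assms, of i]
      by (auto simp: power2_eq_square)
  next
    case False
    then have st: "s < t" and ij: "i \<noteq> j" using assms by auto
    have ind: "indep_vars (\<lambda>_. borel) (\<lambda>i \<omega>. (W t \<omega> - W s \<omega>) $ i) {i, j}"
      by (rule indep_vars_subset[OF indep_components[OF st]]) simp
    show ?thesis
      using indep_vars_lebesgue_integral[OF _ ind] indep_vars_integrable[OF _ ind]
        increment_integrable[OF assms] increment_mean[OF assms] ij by simp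
  qed
  then show ?int ?eq by blast+
qed

lemma
  assumes "a < b" "b < c"
  shows disjoint_increments_integrable: "integrable M (\<lambda>\<omega>. (W b \<omega> - W a \<omega>) $ i * (W c \<omega> - W b \<omega>) $ j)" (is ?int)
    and disjoint_increments: "(\<integral>\<omega>. (W b \<omega> - W a \<omega>) $ i * (W c \<omega> - W b \<omega>) $ j \<partial>M) = 0" (is ?eq)
proof -
  \<comment> \<open>Only the first two increments are requested, so the sequence may be constant
    from index 2 on.\<close>
  define u where "u n = (if n = 0 then a else if n = 1 then b else c)" for n :: nat
  define k where "k n = (if n = 0 then i else j)" for n :: nat
  have "indep_vars (\<lambda>_. borel) (\<lambda>n \<omega>. W (u (Suc n)) \<omega> - W (u n) \<omega>) {..<2}"
    by (rule indep_increments) (use assms in \<open>auto simp: u_def less_2_cases_iff\<close>)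
  then have ind: "indep_vars (\<lambda>_. borel) (\<lambda>n \<omega>. (W (u (Suc n)) \<omega> - W (u n) \<omega>) $ k n) {..<2}"
    by (rule indep_vars_compose2) (auto intro: borel_measurable_vec_nth)
  have int: "integrable M (\<lambda>\<omega>. (W (u (Suc n)) \<omega> - W (u n) \<omega>) $ k n)" if "n \<in> {..<2}" for n
    by (rule increment_integrable) (use that assms in \<open>auto simp: u_def\<close>)
  have "(\<integral>\<omega>. (\<Prod>n<2. (W (u (Suc n)) \<omega> - W (u n) \<omega>) $ k n) \<partial>M) =
      (\<Prod>n<2. \<integral>\<omega>. (W (u (Suc n)) \<omega> - W (u n) \<omega>) $ k n \<partial>M)"
    by (rule indep_vars_lebesgue_integral[OF _ ind int]) auto
  also have "\<dots> = 0"
    using increment_mean[of a b i] assms by (simp add: numeral_2_eq_2 u_def k_def)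
  finally show ?eq by (simp add: numeral_2_eq_2 u_def k_def)
  have "integrable M (\<lambda>\<omega>. \<Prod>n<2. (W (u (Suc n)) \<omega> - W (u n) \<omega>) $ k n)"
    by (rule indep_vars_integrable[OF _ ind int]) auto
  then show ?int by (simp add: numeral_2_eq_2 u_def k_def)
qed

text \<open>The later increment is the earlier one plus an increment over a disjoint interval, which
  is uncorrelated with it; what remains is the variance of the earlier one.\<close>

lemma
  assumes "T < s" "T < t"
  shows covariance_from_base_integrable: "integrable M (\<lambda>\<omega>. (W s \<omega> - W T \<omega>) $ i * (W t \<omega> - W T \<omega>) $ j)"
    and covariance_from_base: "(\<integral>\<omega>. (W s \<omega> - W T \<omega>) $ i * (W t \<omega> - W T \<omega>) $ j \<partial>M) = (if i = j then min s t - T else 0)"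
proof -
  have main: "integrable M (\<lambda>\<omega>. (W s \<omega> - W T \<omega>) $ i * (W t \<omega> - W T \<omega>) $ j) \<and>
     (\<integral>\<omega>. (W s \<omega> - W T \<omega>) $ i * (W t \<omega> - W T \<omega>) $ j \<partial>M) = (if i = j then s - T else 0)"
    if "T < s" "s \<le> t" for s t i j
  proof (cases "s = t")
    case True
    then show ?thesis
      using increment_components[of T t i j] increment_components_integrable[of T t i j] that by auto
  next
    case False
    then have st: "s < t" using that by simp
    have eq: "(W s \<omega> - W T \<omega>) $ i * (W t \<omega> - W T \<omega>) $ j =
      (W s \<omega> - W T \<omega>) $ i * (W s \<omega> - W T \<omega>) $ j + (W s \<omega> - W T \<omega>) $ i * (W t \<omega> - W s \<omega>) $ j" for \<omega>
      by (simp add: algebra_simps)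
    show ?thesis
      unfolding eq
      using increment_components[of T s i j] increment_components_integrable[of T s i j]
        disjoint_increments[OF that(1) st, of i j] disjoint_increments_integrable[OF that(1) st, of i j] that
      by (subst Bochner_Integration.integral_add) auto
  qed
  show "integrable M (\<lambda>\<omega>. (W s \<omega> - W T \<omega>) $ i * (W t \<omega> - W T \<omega>) $ j)"
    using main[of s t i j] main[of t s j i] assms by (cases "s \<le> t") (auto simp: mult.commute)
  show "(\<integral>\<omega>. (W s \<omega> - W T \<omega>) $ i * (W t \<omega> - W T \<omega>) $ j \<partial>M) = (if i = j then min s t - T else 0)"
    using main[of s t i j] main[of t s j i] assms by (cases "s \<le> t") (auto simp: mult.commute min_def)
qed

text \<open>Both increments are written as differences of increments from a common base point
  \<open>T\<close>; bilinearity leaves an alternating sum of minima, which is the length of the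
  overlap for every relative position of the two intervals.\<close>

lemma
  assumes uv: "u \<le> v" "u' \<le> v'"
  shows covariance_integrable: "integrable M (\<lambda>\<omega>. (W v \<omega> - W u \<omega>) $ i * (W v' \<omega> - W u' \<omega>) $ j)"
    and covariance: "(\<integral>\<omega>. (W v \<omega> - W u \<omega>) $ i * (W v' \<omega> - W u' \<omega>) $ j \<partial>M) =
      (if i = j then measure lborel ({u<..v} \<inter> {u'<..v'}) else 0)"
proof -
  \<comment> \<open>One unit further left, since the covariance formula asks for points strictly
    after the base.\<close>
  define T where "T = min u u' - 1"
  have T: "T < u" "T < v" "T < u'" "T < v'" using uv by (auto simp: T_def)
  have eq: "(W v \<omega> - W u \<omega>) $ i * (W v' \<omega> - W u' \<omega>) $ j =
     (W v \<omega> - W T \<omega>) $ i * (W v' \<omega> - W T \<omega>) $ j - (W v \<omega> - W T \<omega>) $ i * (W u' \<omega> - W T \<omega>) $ j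
     - ((W u \<omega> - W T \<omega>) $ i * (W v' \<omega> - W T \<omega>) $ j - (W u \<omega> - W T \<omega>) $ i * (W u' \<omega> - W T \<omega>) $ j)" for \<omega>
    by (simp add: algebra_simps)
  note I = covariance_from_base_integrable and E = covariance_from_base
  show "integrable M (\<lambda>\<omega>. (W v \<omega> - W u \<omega>) $ i * (W v' \<omega> - W u' \<omega>) $ j)"
    unfolding eq by (intro Bochner_Integration.integrable_diff I T)
  have overlap: "measure lborel ({u<..v} \<inter> {u'<..v'}) = max 0 (min v v' - max u u')"
  proof -
    have "{u<..v} \<inter> {u'<..v'} = {max u u'<..min v v'}" by auto
    then show ?thesis by (cases "max u u' \<le> min v v'") (auto simp: not_le)
  qed
  have "(\<integral>\<omega>. (W v \<omega> - W u \<omega>) $ i * (W v' \<omega> - W u' \<omega>) $ j \<partial>M) =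
     (if i = j then (min v v' - T) - (min v u' - T) - ((min u v' - T) - (min u u' - T)) else 0)"
    unfolding eq
    by (simp add: I E T Bochner_Integration.integral_diff Bochner_Integration.integrable_diff
        del: vector_minus_component)
  also have "(min v v' - T) - (min v u' - T) - ((min u v' - T) - (min u u' - T)) = max 0 (min v v' - max u u')"
    using uv by (auto simp: min_def max_def)
  finally show "(\<integral>\<omega>. (W v \<omega> - W u \<omega>) $ i * (W v' \<omega> - W u' \<omega>) $ j \<partial>M) =
      (if i = j then measure lborel ({u<..v} \<inter> {u'<..v'}) else 0)"
    by (simp only: overlap)
qed

section \<open>Isometry for step functions with overlapping intervals\<close>

lemma inner_matrix_vector:
  fixes c d :: "real ^ 'm ^ 'd"
  shows "(c *v x) \<bullet> (d *v y) = (\<Sum>r\<in>UNIV. \<Sum>i\<in>UNIV. \<Sum>j\<in>UNIV. c $ r $ i * d $ r $ j * (x $ i * y $ j))"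
  by (simp add: inner_vec_def matrix_vector_mult_def sum_product algebra_simps)

text \<open>Distinct components are uncorrelated and equal ones contribute the overlap, so the sum
  over rows and columns collapses to the Frobenius inner product of the two matrices.\<close>

lemma
  fixes c d :: "real ^ 'm ^ 'd"
  assumes uv: "u \<le> v" "u' \<le> v'"
  shows isometry_increments_integrable: "integrable M (\<lambda>\<omega>. (c *v (W v \<omega> - W u \<omega>)) \<bullet> (d *v (W v' \<omega> - W u' \<omega>)))"
    and isometry_increments: "(\<integral>\<omega>. (c *v (W v \<omega> - W u \<omega>)) \<bullet> (d *v (W v' \<omega> - W u' \<omega>)) \<partial>M) =
      (c \<bullet> d) * measure lborel ({u<..v} \<inter> {u'<..v'})"
proof -
  note I = covariance_integrable[OF uv] and E = covariance[OF uv]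
  show "integrable M (\<lambda>\<omega>. (c *v (W v \<omega> - W u \<omega>)) \<bullet> (d *v (W v' \<omega> - W u' \<omega>)))"
    unfolding inner_matrix_vector by (intro Bochner_Integration.integrable_sum integrable_mult_right I)
  show "(\<integral>\<omega>. (c *v (W v \<omega> - W u \<omega>)) \<bullet> (d *v (W v' \<omega> - W u' \<omega>)) \<partial>M) =
      (c \<bullet> d) * measure lborel ({u<..v} \<inter> {u'<..v'})"
  proof -
    have "(\<integral>\<omega>. (\<Sum>r\<in>UNIV. \<Sum>i\<in>UNIV. \<Sum>j\<in>UNIV. c $ r $ i * d $ r $ j *
          ((W v \<omega> - W u \<omega>) $ i * (W v' \<omega> - W u' \<omega>) $ j)) \<partial>M) =
        (\<Sum>r\<in>UNIV. \<Sum>i\<in>UNIV. \<Sum>j\<in>UNIV. c $ r $ i * d $ r $ j *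
          (if i = j then measure lborel ({u<..v} \<inter> {u'<..v'}) else 0))"
      by (subst Bochner_Integration.integral_sum | intro sum.cong Bochner_Integration.integrable_sum integrable_mult_right I refl)+
         (simp add: E del: vector_minus_component)
    also have "\<dots> = (c \<bullet> d) * measure lborel ({u<..v} \<inter> {u'<..v'})"
      by (simp add: inner_vec_def sum_distrib_right if_distrib[of "\<lambda>x. _ * x"] sum.delta cong: if_cong)
    finally show ?thesis unfolding inner_matrix_vector .
  qed
qed

text \<open>Step functions over arbitrary, possibly overlapping intervals together with their stochastic
  integrals. Allowing overlaps makes differences of step functions for different partitions available
  without passing to a common refinement.\<close>

inductive elementary :: "(real \<Rightarrow> real ^ 'm ^ 'd) \<Rightarrow> ('w \<Rightarrow> real ^ 'd) \<Rightarrow> bool" where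
  elementary_zero: "elementary (\<lambda>s. 0) (\<lambda>\<omega>. 0)"
| elementary_step: "elementary \<phi> J \<Longrightarrow> u \<le> v \<Longrightarrow>
    elementary (\<lambda>s. \<phi> s + indicator {u<..v} s *\<^sub>R c) (\<lambda>\<omega>. J \<omega> + c *v (W v \<omega> - W u \<omega>))"

lemma elementary_measurable:
  "elementary \<phi> J \<Longrightarrow> \<phi> \<in> borel_measurable borel \<and> J \<in> borel_measurable M"
proof (induction rule: elementary.induct)
  case (elementary_step \<phi> J u v c)
  then show ?case
    by (auto intro!: borel_measurable_add borel_measurable_scaleR borel_measurable_diff
        borel_measurable_continuous_on[of "\<lambda>x. c *v x"] continuous_intros)
qed auto

lemma elementary_diff:
  assumes "elementary \<psi> K" "elementary \<phi> J"
  shows "elementary (\<lambda>s. \<phi> s - \<psi> s) (\<lambda>\<omega>. J \<omega> - K \<omega>)"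
  using assms
proof (induction rule: elementary.induct)
  case (elementary_step \<psi> K u v c)
  then have "elementary (\<lambda>s. (\<phi> s - \<psi> s) + indicator {u<..v} s *\<^sub>R (- c))
     (\<lambda>\<omega>. (J \<omega> - K \<omega>) + (- c) *v (W v \<omega> - W u \<omega>))"
    by (intro elementary.intros) auto
  moreover have "(- c) *v x = - (c *v x)" for x
    by (simp add: matrix_vector_mult_def vec_eq_iff sum_negf)
  ultimately show ?case by (simp add: algebra_simps)
qed simp

lemma elementary_step_fun:
  assumes "\<And>i. i < N \<Longrightarrow> u i \<le> u (Suc i)"
  shows "elementary (step_fun N u c) (step_integral W N u c)"
  using assms
proof (induction N)
  case 0
  then show ?case by (simp add: step_fun_def[abs_def] step_integral_def[abs_def] elementary_zero)
next
  case (Suc N)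
  then have "elementary (step_fun N u c) (step_integral W N u c)" by simp
  from elementary_step[OF this, of "u N" "u (Suc N)" "c N"] Suc.prems
  show ?case unfolding step_fun_def step_integral_def by (simp only: sum.lessThan_Suc)
qed

lemma lborel_indicator_inner:
  fixes c d :: "'e::euclidean_space"
  shows "integrable lborel (\<lambda>s. (indicator {u<..v} s *\<^sub>R c) \<bullet> (indicator {u'<..v'} s *\<^sub>R d))"
    and "(\<integral>s. (indicator {u<..v} s *\<^sub>R c) \<bullet> (indicator {u'<..v'} s *\<^sub>R d) \<partial>lborel) =
      (c \<bullet> d) * measure lborel ({u<..v::real} \<inter> {u'<..v'})"
proof -
  have eq: "(indicator {u<..v} s *\<^sub>R c) \<bullet> (indicator {u'<..v'} s *\<^sub>R d) =
    (c \<bullet> d) * indicator ({u<..v} \<inter> {u'<..v'}) s" for s :: real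
    by (auto simp: indicator_def)
  have "emeasure lborel ({u<..v} \<inter> {u'<..v'}) \<le> emeasure lborel {u<..v}"
    by (rule emeasure_mono) auto
  also have "\<dots> < \<infinity>" by (cases "u \<le> v") auto
  finally have fin: "emeasure lborel ({u<..v} \<inter> {u'<..v'}) < \<infinity>" .
  show "integrable lborel (\<lambda>s. (indicator {u<..v} s *\<^sub>R c) \<bullet> (indicator {u'<..v'} s *\<^sub>R d))"
    unfolding eq by (intro integrable_mult_right integrable_real_indicator) (use fin in auto)
  show "(\<integral>s. (indicator {u<..v} s *\<^sub>R c) \<bullet> (indicator {u'<..v'} s *\<^sub>R d) \<partial>lborel) =
      (c \<bullet> d) * measure lborel ({u<..v::real} \<inter> {u'<..v'})"
    unfolding eq by simp
qed

text \<open>The bilinear isometry is built one interval at a time in each argument; cross terms of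
  overlapping intervals are covered by \<open>isometry_increments\<close>.\<close>

lemma elementary_isometry_step:
  assumes "elementary \<phi> J" "u \<le> v"
  shows "integrable M (\<lambda>\<omega>. J \<omega> \<bullet> (c *v (W v \<omega> - W u \<omega>))) \<and>
    integrable lborel (\<lambda>s. \<phi> s \<bullet> (indicator {u<..v} s *\<^sub>R c)) \<and>
    (\<integral>\<omega>. J \<omega> \<bullet> (c *v (W v \<omega> - W u \<omega>)) \<partial>M) = (\<integral>s. \<phi> s \<bullet> (indicator {u<..v} s *\<^sub>R c) \<partial>lborel)"
  using assms
proof (induction rule: elementary.induct)
  case (elementary_step \<phi> J u' v' c')
  then show ?case
    using isometry_increments[of u' v' u v c' c] isometry_increments_integrable[of u' v' u v c' c]
      lborel_indicator_inner[of u' v' c' u v c]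
    unfolding inner_add_left by simp
qed simp

lemma elementary_isometry_inner:
  assumes "elementary \<psi> K" "elementary \<phi> J"
  shows "integrable M (\<lambda>\<omega>. J \<omega> \<bullet> K \<omega>) \<and> integrable lborel (\<lambda>s. \<phi> s \<bullet> \<psi> s) \<and>
    (\<integral>\<omega>. J \<omega> \<bullet> K \<omega> \<partial>M) = (\<integral>s. \<phi> s \<bullet> \<psi> s \<partial>lborel)"
  using assms
proof (induction rule: elementary.induct)
  case (elementary_step \<psi> K u v c)
  then show ?case
    using elementary_isometry_step[of \<phi> J u v c]
    unfolding inner_add_right by simp
qed simp

lemma elementary_isometry:
  assumes "elementary \<phi> J"
  shows "(\<integral>\<^sup>+ \<omega>. ennreal ((norm (J \<omega>))\<^sup>2) \<partial>M) = (\<integral>\<^sup>+ s. ennreal ((norm (\<phi> s))\<^sup>2) \<partial>lborel)"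
  using elementary_isometry_inner[OF assms assms]
  by (simp add: power2_norm_eq_inner nn_integral_eq_integral)

end

text \<open>A single term of the exponential series. It turns a bound on exponential moments into
  bounds on all moments.\<close>

lemma abs_power_le_exp: "\<bar>x\<bar> ^ q \<le> fact q * (exp x + exp (- x :: real))"
proof -
  have "\<bar>x\<bar> ^ q / fact q \<le> (\<Sum>n. inverse (fact n) *\<^sub>R \<bar>x\<bar> ^ n)"
    using sum_le_suminf[OF summable_exp[of "\<bar>x\<bar>"], of "{q}"]
    by (simp add: divide_inverse mult.commute)
  also have "\<dots> = exp \<bar>x\<bar>" by (simp add: exp_def)
  also have "\<dots> \<le> exp x + exp (- x)" by (simp add: abs_if)
  finally show ?thesis by (simp add: field_simps)
qed

section \<open>Exponential and absolute moments of grid sums\<close>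

context wiener
begin

lemma mgf_increment:
  assumes st: "s < t"
  shows "(\<integral>\<^sup>+ \<omega>. ennreal (exp (a \<bullet> (W t \<omega> - W s \<omega>))) \<partial>M) = ennreal (exp ((norm a)\<^sup>2 * (t - s) / 2))"
proof -
  have ind: "indep_vars (\<lambda>_. borel) (\<lambda>i \<omega>. ennreal (exp (a $ i * (W t \<omega> - W s \<omega>) $ i))) UNIV"
    by (rule indep_vars_compose2[OF indep_components[OF st]]) measurable
  have "(\<integral>\<^sup>+ \<omega>. ennreal (exp (a \<bullet> (W t \<omega> - W s \<omega>))) \<partial>M) =
     (\<integral>\<^sup>+ \<omega>. (\<Prod>i\<in>UNIV. ennreal (exp (a $ i * (W t \<omega> - W s \<omega>) $ i))) \<partial>M)"
    by (intro nn_integral_cong) (simp add: inner_vec_def exp_sum prod_ennreal)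
  also have "\<dots> = (\<Prod>i\<in>UNIV. (\<integral>\<^sup>+ \<omega>. ennreal (exp (a $ i * (W t \<omega> - W s \<omega>) $ i)) \<partial>M))"
    by (rule indep_vars_nn_integral[OF _ ind]) auto
  also have "\<dots> = (\<Prod>i\<in>UNIV. ennreal (exp ((a $ i)\<^sup>2 * (t - s) / 2)))"
    by (intro prod.cong refl, subst nn_integral_exp_normal[OF _ normal_component[OF st]]) (use st in auto)
  also have "\<dots> = ennreal (exp ((norm a)\<^sup>2 * (t - s) / 2))"
    by (simp add: prod_ennreal norm_vec_def L2_set_def sum_nonneg sum_distrib_right sum_divide_distrib flip: exp_sum)
  finally show ?thesis .
qed

lemma mgf_increments:
  fixes u :: "nat \<Rightarrow> real"
  assumes u: "\<And>i. i < n \<Longrightarrow> u i < u (Suc i)"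
  shows "(\<integral>\<^sup>+ \<omega>. ennreal (exp (\<Sum>i<n. a i \<bullet> (W (u (Suc i)) \<omega> - W (u i) \<omega>))) \<partial>M) =
    ennreal (exp (\<Sum>i<n. (norm (a i))\<^sup>2 * (u (Suc i) - u i) / 2))"
proof -
  have "indep_vars (\<lambda>_. borel) (\<lambda>i \<omega>. W (u (Suc i)) \<omega> - W (u i) \<omega>) {..<n}"
    by (rule indep_increments) (rule u)
  then have ind: "indep_vars (\<lambda>_. borel) (\<lambda>i \<omega>. ennreal (exp (a i \<bullet> (W (u (Suc i)) \<omega> - W (u i) \<omega>)))) {..<n}"
    by (rule indep_vars_compose2) measurable
  have "(\<integral>\<^sup>+ \<omega>. ennreal (exp (\<Sum>i<n. a i \<bullet> (W (u (Suc i)) \<omega> - W (u i) \<omega>))) \<partial>M) =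
     (\<integral>\<^sup>+ \<omega>. (\<Prod>i<n. ennreal (exp (a i \<bullet> (W (u (Suc i)) \<omega> - W (u i) \<omega>)))) \<partial>M)"
    by (intro nn_integral_cong) (simp add: exp_sum prod_ennreal)
  also have "\<dots> = (\<Prod>i<n. (\<integral>\<^sup>+ \<omega>. ennreal (exp (a i \<bullet> (W (u (Suc i)) \<omega> - W (u i) \<omega>))) \<partial>M))"
    by (rule indep_vars_nn_integral[OF _ ind]) auto
  also have "\<dots> = (\<Prod>i<n. ennreal (exp ((norm (a i))\<^sup>2 * (u (Suc i) - u i) / 2)))"
    by (intro prod.cong refl mgf_increment u) auto
  also have "\<dots> = ennreal (exp (\<Sum>i<n. (norm (a i))\<^sup>2 * (u (Suc i) - u i) / 2))"
    by (simp add: prod_ennreal exp_sum)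
  finally show ?thesis .
qed

text \<open>Uniform grids of a nondegenerate interval have strictly increasing points, as
  independence of the increments requires; the partitions in the definition of the Wiener integral
  are only weakly increasing.\<close>

definition grid_integral :: "real \<Rightarrow> real \<Rightarrow> nat \<Rightarrow> (nat \<Rightarrow> real ^ 'm ^ 'd) \<Rightarrow> 'w \<Rightarrow> real ^ 'd" where
  "grid_integral a b n c = step_integral W n (\<lambda>i. a + real i * ((b - a) / real n)) c"

lemma grid_integral_eq:
  "grid_integral a b n c \<omega> = (\<Sum>i<n. c i *v (W (a + real (Suc i) * ((b - a) / real n)) \<omega> - W (a + real i * ((b - a) / real n)) \<omega>))"
  by (simp add: grid_integral_def step_integral_def)

lemma grid_step:
  assumes "a < b" "i < n"
  shows "a + real i * ((b - a) / real n) < a + real (Suc i) * ((b - a) / real n)"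
proof -
  have "0 < (b - a) / real n" using assms by simp
  then show ?thesis by (simp add: distrib_right del: times_divide_eq_right)
qed

lemma grid_elementary:
  assumes "a < b"
  shows "elementary (step_fun n (\<lambda>i. a + real i * ((b - a) / real n)) c) (grid_integral a b n c)"
  unfolding grid_integral_def
  by (rule elementary_step_fun) (use grid_step[OF assms] in \<open>auto simp: less_imp_le simp del: of_nat_Suc\<close>)

lemma grid_integral_measurable [measurable]:
  "a < b \<Longrightarrow> grid_integral a b n c \<in> borel_measurable M"
  using elementary_measurable[OF grid_elementary] by blast

text \<open>The factor 2 q! e^(1/2) comes from two exponential moments, at plus and minus the
  inverse of a bound for the standard deviation, via one term of the exponential series; d^q is the
  price of passing from components to the norm.\<close>

definition gauss_const :: "nat \<Rightarrow> nat \<Rightarrow> real" where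
  "gauss_const d q = real d ^ q * (2 * fact q * exp (1 / 2))"

lemma gauss_const_nonneg: "0 \<le> gauss_const d q"
  by (simp add: gauss_const_def)

text \<open>A component of the grid sum is a sum of independent Gaussians with total variance at
  most C^2 (b - a). Exponential moments give the right scaling in all orders without identifying its
  law.\<close>

lemma grid_integral_component_moment:
  fixes c :: "nat \<Rightarrow> real ^ 'm ^ 'd"
  assumes ab: "a < b" and C: "0 < C" and c: "\<And>i. i < n \<Longrightarrow> norm (c i) \<le> C" and n: "0 < n"
  shows "(\<integral>\<^sup>+ \<omega>. ennreal (\<bar>grid_integral a b n c \<omega> $ r\<bar> ^ q) \<partial>M) \<le>
    ennreal (2 * fact q * exp (1 / 2) * (C * sqrt (b - a)) ^ q)"
proof -
  define \<sigma> where "\<sigma> = C * sqrt (b - a)"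
  have \<sigma>: "0 < \<sigma>" "\<sigma>\<^sup>2 = C\<^sup>2 * (b - a)" using ab C by (auto simp: \<sigma>_def power_mult_distrib)
  define u where "u i = a + real i * ((b - a) / real n)" for i
  have u: "u i < u (Suc i)" if "i < n" for i using grid_step[OF ab that] by (simp add: u_def)
  have du: "u (Suc i) - u i = (b - a) / real n" for i by (simp add: u_def distrib_right del: times_divide_eq_right times_divide_eq_left)
  let ?J = "\<lambda>\<omega>. grid_integral a b n c \<omega> $ r"
  \<comment> \<open>At k = 1/\<sigma> and k = -1/\<sigma> the exponent of the generating function is
    at most 1/2.\<close>
  have mgf: "(\<integral>\<^sup>+ \<omega>. ennreal (exp (k * ?J \<omega>)) \<partial>M) \<le> ennreal (exp (1 / 2))" if k: "k\<^sup>2 * \<sigma>\<^sup>2 = 1" for k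
  proof -
    have "(\<integral>\<^sup>+ \<omega>. ennreal (exp (k * ?J \<omega>)) \<partial>M) =
       (\<integral>\<^sup>+ \<omega>. ennreal (exp (\<Sum>i<n. (k *\<^sub>R c i $ r) \<bullet> (W (u (Suc i)) \<omega> - W (u i) \<omega>))) \<partial>M)"
      by (intro nn_integral_cong)
         (simp add: grid_integral_eq u_def matrix_vector_mul_component sum_distrib_left)
    also have "\<dots> = ennreal (exp (\<Sum>i<n. (norm (k *\<^sub>R c i $ r))\<^sup>2 * (u (Suc i) - u i) / 2))"
      by (rule mgf_increments) (rule u)
    also have "(\<Sum>i<n. (norm (k *\<^sub>R c i $ r))\<^sup>2 * (u (Suc i) - u i) / 2) \<le> (\<Sum>i<n. k\<^sup>2 * C\<^sup>2 * ((b - a) / real n) / 2)"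
    proof (intro sum_mono)
      fix i assume "i \<in> {..<n}"
      then have "norm (c i $ r) \<le> C"
        using c[of i] Finite_Cartesian_Product.norm_nth_le[of "c i" r] by simp
      then have "(norm (k *\<^sub>R c i $ r))\<^sup>2 \<le> k\<^sup>2 * C\<^sup>2"
        by (simp add: power_mult_distrib power_mono mult_left_mono)
      then show "(norm (k *\<^sub>R c i $ r))\<^sup>2 * (u (Suc i) - u i) / 2 \<le> k\<^sup>2 * C\<^sup>2 * ((b - a) / real n) / 2"
        unfolding du using ab by (intro divide_right_mono mult_right_mono) auto
    qed
    also have "\<dots> = 1 / 2" using k n unfolding \<sigma> by simp
    finally show ?thesis by (simp add: ennreal_leI)
  qed
  have "(\<integral>\<^sup>+ \<omega>. ennreal (\<bar>?J \<omega>\<bar> ^ q) \<partial>M) \<le>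
    (\<integral>\<^sup>+ \<omega>. ennreal (fact q * \<sigma> ^ q) * (ennreal (exp (1 / \<sigma> * ?J \<omega>)) + ennreal (exp (- (1 / \<sigma>) * ?J \<omega>))) \<partial>M)"
  proof (intro nn_integral_mono)
    fix \<omega>
    have "\<bar>?J \<omega>\<bar> ^ q = \<sigma> ^ q * \<bar>1 / \<sigma> * ?J \<omega>\<bar> ^ q"
      using \<sigma>(1) by (simp add: abs_mult power_divide)
    also have "\<dots> \<le> \<sigma> ^ q * (fact q * (exp (1 / \<sigma> * ?J \<omega>) + exp (- (1 / \<sigma> * ?J \<omega>))))"
      using \<sigma>(1) by (intro mult_left_mono abs_power_le_exp) auto
    finally show "ennreal (\<bar>?J \<omega>\<bar> ^ q) \<le>
        ennreal (fact q * \<sigma> ^ q) * (ennreal (exp (1 / \<sigma> * ?J \<omega>)) + ennreal (exp (- (1 / \<sigma>) * ?J \<omega>)))"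
      using \<sigma>(1) by (simp add: ennreal_leI mult_ac flip: ennreal_plus ennreal_mult)
  qed
  also have "\<dots> = ennreal (fact q * \<sigma> ^ q) *
     ((\<integral>\<^sup>+ \<omega>. ennreal (exp (1 / \<sigma> * ?J \<omega>)) \<partial>M) + (\<integral>\<^sup>+ \<omega>. ennreal (exp (- (1 / \<sigma>) * ?J \<omega>)) \<partial>M))"
  proof -
    have [measurable]: "?J \<in> borel_measurable M"
      by (rule measurable_compose[OF grid_integral_measurable[OF ab] borel_measurable_vec_nth])
    show ?thesis by (subst nn_integral_cmult, measurable, subst nn_integral_add, measurable)
  qed
  also have "\<dots> \<le> ennreal (fact q * \<sigma> ^ q) * (ennreal (exp (1 / 2)) + ennreal (exp (1 / 2)))"
    using \<sigma>(1) by (intro mult_left_mono add_mono mgf) (auto simp: power_divide)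
  also have "\<dots> = ennreal (2 * fact q * exp (1 / 2) * \<sigma> ^ q)"
    using \<sigma>(1) by (simp add: mult_ac flip: ennreal_plus ennreal_mult)
  finally show ?thesis unfolding \<sigma>_def .
qed

lemma grid_integral_moment:
  fixes c :: "nat \<Rightarrow> real ^ 'm ^ 'd"
  assumes ab: "a < b" and C: "0 < C" and c: "\<And>i. i < n \<Longrightarrow> norm (c i) \<le> C" and q: "1 \<le> q"
  shows "(\<integral>\<^sup>+ \<omega>. ennreal (norm (grid_integral a b n c \<omega>) ^ q) \<partial>M) \<le>
    ennreal (gauss_const CARD('d) q * (C * sqrt (b - a)) ^ q)"
proof (cases "n = 0")
  case True
  then show ?thesis using q by (simp add: grid_integral_eq power_0_left)
next
  case False
  let ?J = "grid_integral a b n c" and ?d = "real CARD('d)"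
  let ?K = "2 * fact q * exp (1 / 2) * (C * sqrt (b - a)) ^ q"
  have K: "0 \<le> ?K" using C ab by simp
  have [measurable]: "(\<lambda>\<omega>. ?J \<omega> $ r) \<in> borel_measurable M" for r
    by (rule measurable_compose[OF grid_integral_measurable[OF ab] borel_measurable_vec_nth])
  have "(\<integral>\<^sup>+ \<omega>. ennreal (norm (?J \<omega>) ^ q) \<partial>M) \<le>
     (\<integral>\<^sup>+ \<omega>. ennreal (?d ^ (q - 1)) * (\<Sum>r\<in>UNIV. ennreal (\<bar>?J \<omega> $ r\<bar> ^ q)) \<partial>M)"
  proof (intro nn_integral_mono)
    fix \<omega>
    have "norm (?J \<omega>) ^ q \<le> (\<Sum>r\<in>UNIV. \<bar>?J \<omega> $ r\<bar>) ^ q"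
      by (intro power_mono norm_le_l1_cart) auto
    also have "\<dots> \<le> ?d ^ (q - 1) * (\<Sum>r\<in>UNIV. \<bar>?J \<omega> $ r\<bar> ^ q)"
      using q by (intro power_sum_mean) auto
    finally show "ennreal (norm (?J \<omega>) ^ q) \<le> ennreal (?d ^ (q - 1)) * (\<Sum>r\<in>UNIV. ennreal (\<bar>?J \<omega> $ r\<bar> ^ q))"
      by (simp add: ennreal_leI sum_nonneg flip: ennreal_mult)
  qed
  also have "\<dots> = ennreal (?d ^ (q - 1)) * (\<Sum>r\<in>UNIV. \<integral>\<^sup>+ \<omega>. ennreal (\<bar>?J \<omega> $ r\<bar> ^ q) \<partial>M)"
    by (subst nn_integral_cmult, measurable, subst nn_integral_sum, measurable)
  also have "\<dots> \<le> ennreal (?d ^ (q - 1)) * (\<Sum>r\<in>(UNIV :: 'd set). ennreal ?K)"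
    using False by (intro mult_left_mono sum_mono grid_integral_component_moment ab C c) auto
  also have "\<dots> = ennreal (?d ^ (q - 1) * (?d * ?K))"
    using K by (simp add: ennreal_mult ennreal_of_nat_eq_real_of_nat)
  also have "?d ^ (q - 1) * (?d * ?K) = ?d ^ (q - 1) * ?d * ?K" by (simp only: mult.assoc)
  also have "?d ^ (q - 1) * ?d = ?d ^ q" using q by (cases q) auto
  finally show ?thesis by (simp add: gauss_const_def mult.assoc)
qed

end

section \<open>Mean square limits\<close>

lemma L2_tendsto_AE_subseq:
  fixes Z :: "'w \<Rightarrow> 'e::{banach, second_countable_topology}"
  assumes [measurable]: "\<And>n. J n \<in> borel_measurable M" "Z \<in> borel_measurable M"
    and lim: "(\<lambda>n. \<integral>\<^sup>+ \<omega>. ennreal ((norm (Z \<omega> - J n \<omega>))\<^sup>2) \<partial>M) \<longlonglongrightarrow> 0"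
  obtains r :: "nat \<Rightarrow> nat" where "strict_mono r" "AE \<omega> in M. (\<lambda>n. J (r n) \<omega>) \<longlonglongrightarrow> Z \<omega>"
proof -
  let ?I = "\<lambda>n. \<integral>\<^sup>+ \<omega>. ennreal ((norm (Z \<omega> - J n \<omega>))\<^sup>2) \<partial>M"
  have "eventually (\<lambda>n. ?I n < 1) sequentially"
    using order_tendstoD(2)[OF lim, of 1] by simp
  then obtain N where N: "\<And>n. N \<le> n \<Longrightarrow> ?I n < 1" by (auto simp: eventually_sequentially)
  \<comment> \<open>Finitely many of the distances may be infinite; the shift by \<open>N\<close>
    skips them.\<close>
  let ?u = "\<lambda>n \<omega>. (norm (Z \<omega> - J (n + N) \<omega>))\<^sup>2"
  have fin: "?I (n + N) < \<infinity>" for n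
    using N[of "n + N"] by (auto intro: less_trans)
  have int: "integrable M (?u n)" for n
    by (rule integrableI_bounded) (use fin[of n] in auto)
  have eq: "ennreal (\<integral>\<omega>. norm (?u n \<omega>) \<partial>M) = ?I (n + N)" for n
    using nn_integral_eq_integral[OF int[of n]] by simp
  have "(\<lambda>n. ?I (n + N)) \<longlonglongrightarrow> 0" using lim by (rule LIMSEQ_ignore_initial_segment)
  then have "(\<lambda>n. ennreal (\<integral>\<omega>. norm (?u n \<omega>) \<partial>M)) \<longlonglongrightarrow> ennreal 0"
    unfolding eq by simp
  then have "(\<lambda>n. \<integral>\<omega>. norm (?u n \<omega>) \<partial>M) \<longlonglongrightarrow> 0"
    by (subst (asm) tendsto_ennreal_iff) (auto intro!: always_eventually)
  then obtain r :: "nat \<Rightarrow> nat" where r: "strict_mono r" "AE \<omega> in M. (\<lambda>n. ?u (r n) \<omega>) \<longlonglongrightarrow> 0"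
    using tendsto_L1_AE_subseq[of M ?u, OF int] by blast
  have "AE \<omega> in M. (\<lambda>n. J (r n + N) \<omega>) \<longlonglongrightarrow> Z \<omega>"
    using r(2)
  proof eventually_elim
    case (elim \<omega>)
    then have "(\<lambda>n. sqrt (?u (r n) \<omega>)) \<longlonglongrightarrow> sqrt 0" by (rule tendsto_real_sqrt)
    then have "(\<lambda>n. Z \<omega> - J (r n + N) \<omega>) \<longlonglongrightarrow> 0"
      by (simp add: tendsto_norm_zero_iff)
    then have "(\<lambda>n. Z \<omega> - (Z \<omega> - J (r n + N) \<omega>)) \<longlonglongrightarrow> Z \<omega> - 0" by (intro tendsto_diff tendsto_const)
    then show ?case by simp
  qed
  moreover have "strict_mono (\<lambda>n. r n + N)" using r(1) by (simp add: strict_mono_def)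
  ultimately show ?thesis using that by blast
qed

text \<open>Mean square convergence does not control higher moments; an almost surely convergent
  subsequence and Fatou's lemma carry a uniform bound over to the limit.\<close>

lemma L2_limit_moment:
  fixes Z :: "'w \<Rightarrow> 'e::{banach, second_countable_topology}"
  assumes J[measurable]: "\<And>n. J n \<in> borel_measurable M" and Z: "Z \<in> borel_measurable M"
    and lim: "(\<lambda>n. \<integral>\<^sup>+ \<omega>. ennreal ((norm (Z \<omega> - J n \<omega>))\<^sup>2) \<partial>M) \<longlonglongrightarrow> 0"
    and bound: "\<And>n. (\<integral>\<^sup>+ \<omega>. ennreal (norm (J n \<omega>) ^ q) \<partial>M) \<le> K"
  shows "(\<integral>\<^sup>+ \<omega>. ennreal (norm (Z \<omega>) ^ q) \<partial>M) \<le> K"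
proof -
  obtain r :: "nat \<Rightarrow> nat" where r: "strict_mono r" "AE \<omega> in M. (\<lambda>n. J (r n) \<omega>) \<longlonglongrightarrow> Z \<omega>"
    using L2_tendsto_AE_subseq[OF J Z lim] by blast
  have "(\<integral>\<^sup>+ \<omega>. ennreal (norm (Z \<omega>) ^ q) \<partial>M)
      = (\<integral>\<^sup>+ \<omega>. liminf (\<lambda>n. ennreal (norm (J (r n) \<omega>) ^ q)) \<partial>M)"
  proof (rule nn_integral_cong_AE)
    show "AE \<omega> in M. ennreal (norm (Z \<omega>) ^ q) = liminf (\<lambda>n. ennreal (norm (J (r n) \<omega>) ^ q))"
      using r(2)
    proof eventually_elim
      case (elim \<omega>)
      have "(\<lambda>n. ennreal (norm (J (r n) \<omega>) ^ q)) \<longlonglongrightarrow> ennreal (norm (Z \<omega>) ^ q)"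
        by (intro tendsto_ennrealI tendsto_intros elim)
      from lim_imp_Liminf[OF _ this] show ?case by simp
    qed
  qed
  also have "\<dots> \<le> liminf (\<lambda>n. \<integral>\<^sup>+ \<omega>. ennreal (norm (J (r n) \<omega>) ^ q) \<partial>M)"
    by (rule nn_integral_liminf) auto
  also have "\<dots> \<le> K"
    using bound by (intro Liminf_le) auto
  finally show ?thesis .
qed

section \<open>Orthogonality to the past\<close>

lemma integrable_mult_square:
  fixes U V :: "'w \<Rightarrow> real"
  assumes [measurable]: "U \<in> borel_measurable M" "V \<in> borel_measurable M"
    and U: "integrable M (\<lambda>\<omega>. (U \<omega>)\<^sup>2)" and V: "integrable M (\<lambda>\<omega>. (V \<omega>)\<^sup>2)"
  shows "integrable M (\<lambda>\<omega>. U \<omega> * V \<omega>)"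
proof (rule Bochner_Integration.integrable_bound[OF Bochner_Integration.integrable_add[OF U V]])
  show "AE \<omega> in M. norm (U \<omega> * V \<omega>) \<le> norm ((U \<omega>)\<^sup>2 + (V \<omega>)\<^sup>2)"
  proof (intro AE_I2)
    fix \<omega>
    have "0 \<le> (\<bar>U \<omega>\<bar> - \<bar>V \<omega>\<bar>)\<^sup>2" "0 \<le> \<bar>U \<omega>\<bar> * \<bar>V \<omega>\<bar>" by auto
    then have "\<bar>U \<omega>\<bar> * \<bar>V \<omega>\<bar> \<le> (U \<omega>)\<^sup>2 + (V \<omega>)\<^sup>2" unfolding power2_diff power2_abs by linarith
    then show "norm (U \<omega> * V \<omega>) \<le> norm ((U \<omega>)\<^sup>2 + (V \<omega>)\<^sup>2)" by (simp add: abs_mult)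
  qed
qed auto

lemma power2_sum_le: "(x + y :: real)\<^sup>2 \<le> 2 * x\<^sup>2 + 2 * y\<^sup>2"
  using zero_le_power2[of "x - y"] unfolding power2_sum power2_diff by linarith

lemma integrable_norm_square_add:
  fixes X Y :: "'w \<Rightarrow> 'e::{real_normed_vector, second_countable_topology}"
  assumes [measurable]: "X \<in> borel_measurable M" "Y \<in> borel_measurable M"
    and X: "integrable M (\<lambda>\<omega>. (norm (X \<omega>))\<^sup>2)" and Y: "integrable M (\<lambda>\<omega>. (norm (Y \<omega>))\<^sup>2)"
  shows "integrable M (\<lambda>\<omega>. (norm (X \<omega> + Y \<omega>))\<^sup>2)"
proof (rule Bochner_Integration.integrable_bound)
  show "integrable M (\<lambda>\<omega>. 2 * (norm (X \<omega>))\<^sup>2 + 2 * (norm (Y \<omega>))\<^sup>2)"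
    by (intro Bochner_Integration.integrable_add integrable_mult_right X Y)
  show "AE \<omega> in M. norm ((norm (X \<omega> + Y \<omega>))\<^sup>2) \<le> norm (2 * (norm (X \<omega>))\<^sup>2 + 2 * (norm (Y \<omega>))\<^sup>2)"
  proof (intro AE_I2)
    fix \<omega>
    have "(norm (X \<omega> + Y \<omega>))\<^sup>2 \<le> (norm (X \<omega>) + norm (Y \<omega>))\<^sup>2" by (intro power_mono norm_triangle_ineq) auto
    also have "\<dots> \<le> 2 * (norm (X \<omega>))\<^sup>2 + 2 * (norm (Y \<omega>))\<^sup>2" by (rule power2_sum_le)
    finally show "norm ((norm (X \<omega> + Y \<omega>))\<^sup>2) \<le> norm (2 * (norm (X \<omega>))\<^sup>2 + 2 * (norm (Y \<omega>))\<^sup>2)" by simp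
  qed
qed measurable

section \<open>Independence of the past and later increments\<close>

context wiener
begin

abbreviation past :: "real \<Rightarrow> 'w measure" where
  "past \<equiv> wiener_filtration M W"

definition increment_events :: "real \<Rightarrow> real \<Rightarrow> 'w set set" where
  "increment_events q p = {(\<lambda>\<omega>. W p \<omega> - W q \<omega>) -` B \<inter> space M | B. B \<in> sets borel}"

text \<open>For finitely many times the increments can be refined to consecutive ones, to which the
  independence assumption on the Wiener process applies.\<close>

definition finite_past :: "real set \<Rightarrow> 'w set set" where
  "finite_past P = sigma_sets (space M) (\<Union>p\<in>P. \<Union>q\<in>P. increment_events q p)"

lemma increment_events_Pow: "increment_events q p \<subseteq> Pow (space M)"
  by (auto simp: increment_events_def)

lemma increment_events_sets: "increment_events q p \<subseteq> sets M"
  unfolding increment_events_def by (auto intro!: measurable_sets)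

lemma Int_stable_increment_events: "Int_stable (increment_events q p)"
proof (rule Int_stableI)
  fix a b assume "a \<in> increment_events q p" "b \<in> increment_events q p"
  then obtain A B where *: "a = (\<lambda>\<omega>. W p \<omega> - W q \<omega>) -` A \<inter> space M" "A \<in> sets borel"
      "b = (\<lambda>\<omega>. W p \<omega> - W q \<omega>) -` B \<inter> space M" "B \<in> sets borel"
    unfolding increment_events_def by blast
  then have "a \<inter> b = (\<lambda>\<omega>. W p \<omega> - W q \<omega>) -` (A \<inter> B) \<inter> space M" "A \<inter> B \<in> sets borel" by auto
  then show "a \<inter> b \<in> increment_events q p" unfolding increment_events_def by blast
qed

lemma space_past [simp]: "space (past t) = space M"
  by (simp add: wiener_filtration_def space_measure_of_conv)

lemma sets_past: "sets (past t) = sigma_sets (space M) (\<Union>(v, u)\<in>{(v, u). v \<le> u \<and> u \<le> t}. increment_events v u)"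
proof -
  have "{(\<lambda>\<omega>. W u \<omega> - W v \<omega>) -` B \<inter> space M | u v B. v \<le> u \<and> u \<le> t \<and> B \<in> sets borel} =
    (\<Union>(v, u)\<in>{(v, u). v \<le> u \<and> u \<le> t}. increment_events v u)"
    unfolding increment_events_def by auto
  then show ?thesis
    unfolding wiener_filtration_def using increment_events_Pow by (subst sets_measure_of) auto
qed

lemma sets_past_subset: "sets (past t) \<subseteq> sets M"
  unfolding sets_past by (rule sets.sigma_sets_subset) (use increment_events_sets in auto)

lemma past_mono:
  assumes "s \<le> t"
  shows "sets (past s) \<subseteq> sets (past t)"
  unfolding sets_past by (rule sigma_sets_mono') (use assms in auto)

lemma past_measurable: "U \<in> borel_measurable (past t) \<Longrightarrow> U \<in> borel_measurable M"
  using sets_past_subset[of t] by (auto simp: measurable_def)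

lemma past_measurable_mono: "U \<in> borel_measurable (past s) \<Longrightarrow> s \<le> t \<Longrightarrow> U \<in> borel_measurable (past t)"
  using past_mono[of s t] by (auto simp: measurable_def)

lemma increment_past_measurable:
  assumes "v \<le> u" "u \<le> t"
  shows "(\<lambda>\<omega>. W u \<omega> - W v \<omega>) \<in> borel_measurable (past t)"
proof (rule measurableI)
  fix B :: "(real ^ 'm) set" assume "B \<in> sets borel"
  then have "(\<lambda>\<omega>. W u \<omega> - W v \<omega>) -` B \<inter> space M \<in> increment_events v u"
    by (auto simp: increment_events_def)
  then show "(\<lambda>\<omega>. W u \<omega> - W v \<omega>) -` B \<inter> space (past t) \<in> sets (past t)"
    unfolding sets_past using assms by (auto intro!: sigma_sets.Basic)
qed simp

text \<open>An increment between two grid points is a difference of telescoping sums that start at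
  \<open>x 0\<close>, hence measurable with respect to the consecutive increments.\<close>

lemma finite_past_subset_grid:
  assumes P: "P \<subseteq> x ` {..n}"
  shows "finite_past P \<subseteq> sigma_sets (space M) (\<Union>i<n. increment_events (x i) (x (Suc i)))"
proof -
  define N where "N = sigma (space M) (\<Union>i<n. increment_events (x i) (x (Suc i)))"
  have pow: "(\<Union>i<n. increment_events (x i) (x (Suc i))) \<subseteq> Pow (space M)" using increment_events_Pow by blast
  have N: "space N = space M" "sets N = sigma_sets (space M) (\<Union>i<n. increment_events (x i) (x (Suc i)))"
    using pow by (auto simp: N_def)
  have step: "(\<lambda>\<omega>. W (x (Suc i)) \<omega> - W (x i) \<omega>) \<in> borel_measurable N" if "i < n" for i
  proof (rule measurableI)
    fix B :: "(real ^ 'm) set" assume "B \<in> sets borel"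
    then have "(\<lambda>\<omega>. W (x (Suc i)) \<omega> - W (x i) \<omega>) -` B \<inter> space M \<in> increment_events (x i) (x (Suc i))"
      by (auto simp: increment_events_def)
    then show "(\<lambda>\<omega>. W (x (Suc i)) \<omega> - W (x i) \<omega>) -` B \<inter> space N \<in> sets N"
      unfolding N using that by (auto intro!: sigma_sets.Basic)
  qed simp
  have base: "(\<lambda>\<omega>. W (x k) \<omega> - W (x 0) \<omega>) \<in> borel_measurable N" if "k \<le> n" for k
  proof -
    have "(\<lambda>\<omega>. W (x k) \<omega> - W (x 0) \<omega>) = (\<lambda>\<omega>. \<Sum>i<k. W (x (Suc i)) \<omega> - W (x i) \<omega>)"
      by (subst sum_lessThan_telescope) simp
    then show ?thesis using that by (auto intro!: borel_measurable_sum step)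
  qed
  have "increment_events q p \<subseteq> sets N" if pq: "p \<in> P" "q \<in> P" for p q
  proof -
    obtain k l where kl: "p = x k" "k \<le> n" "q = x l" "l \<le> n" using pq P by blast
    have "(\<lambda>\<omega>. W p \<omega> - W q \<omega>) = (\<lambda>\<omega>. (W (x k) \<omega> - W (x 0) \<omega>) - (W (x l) \<omega> - W (x 0) \<omega>))"
      by (simp add: kl)
    also have "\<dots> \<in> borel_measurable N"
      by (intro borel_measurable_diff[of "\<lambda>\<omega>. W (x k) \<omega> - W (x 0) \<omega>" _ "\<lambda>\<omega>. W (x l) \<omega> - W (x 0) \<omega>"] base kl)
    finally show ?thesis
      unfolding increment_events_def using N(1) by (auto dest: measurable_sets)
  qed
  then have "sigma_sets (space N) (\<Union>p\<in>P. \<Union>q\<in>P. increment_events q p) \<subseteq> sets N"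
    by (intro sets.sigma_sets_subset) blast
  then show ?thesis
    unfolding finite_past_def by (simp only: N)
qed

text \<open>Sorting P together with u and appending v makes the increment from u to v the last of a
  chain of consecutive increments; it is independent of all earlier ones, and these generate the
  increments between points of P.\<close>

lemma finite_past_indep:
  assumes fin: "finite P" and P: "P \<subseteq> {..u}" and uv: "u < v"
    and A: "a \<in> finite_past P" and B: "b \<in> increment_events u v"
  shows "prob (a \<inter> b) = prob a * prob b"
proof -
  define l where "l = sorted_list_of_set (insert u P)"
  have l: "sorted_wrt (<) l" "set l = insert u P"
    unfolding l_def using fin by (simp_all add: strict_sorted_list_of_set del: sorted_list_of_set_insert_remove)
  define n where "n = length l - 1"
  have len: "length l = Suc n" using l(2) by (cases l) (auto simp: n_def)
  \<comment> \<open>\<open>l ! n\<close> will be u, the largest point, and every index beyond n is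
    sent to v, so that step n leads from u to v.\<close>
  define x where "x i = (if i \<le> n then l ! i else v)" for i
  have last: "l ! n = u"
  proof -
    obtain k where k: "k < length l" "l ! k = u" using l(2) by (metis in_set_conv_nth insertI1)
    have "l ! n \<in> insert u P" using l(2) len by (metis lessI nth_mem)
    then have "l ! n \<le> u" using P by auto
    moreover have "k = n \<or> l ! k < l ! n"
      using sorted_wrt_nth_less[OF l(1), of k n] k(1) len by linarith
    ultimately show ?thesis using k(2) by auto
  qed
  have x: "x i < x (Suc i)" if "i < Suc n" for i
  proof (cases "i < n")
    case True
    then show ?thesis using sorted_wrt_nth_less[OF l(1), of i "Suc i"] len by (simp add: x_def)
  next
    case False
    then have "i = n" using that by simp
    then show ?thesis using last uv by (simp add: x_def)
  qed
  have Px: "P \<subseteq> x ` {..n}"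
  proof
    fix p assume "p \<in> P"
    then obtain k where "k < length l" "l ! k = p" using l(2) by (metis in_set_conv_nth insertI2)
    then show "p \<in> x ` {..n}" using len by (auto simp: x_def image_iff intro!: bexI[of _ k])
  qed
  define E where "E i = increment_events (x i) (x (Suc i))" for i
  have "indep_vars (\<lambda>_. borel) (\<lambda>i \<omega>. W (x (Suc i)) \<omega> - W (x i) \<omega>) {..<Suc n}"
    by (rule indep_increments) (rule x)
  then have indE: "indep_sets E {..<Suc n}"
    unfolding indep_vars_def2 E_def increment_events_def by blast
  \<comment> \<open>Two groups of increments, the first n and the last one; grouping an independent
    family yields independent generated sigma-algebras.\<close>
  define I where "I = case_bool {..<n} {n}"
  have "indep_sets (\<lambda>j. sigma_sets (space M) (\<Union>i\<in>I j. E i)) UNIV"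
  proof (rule indep_sets_collect_sigma)
    have "(\<Union>j\<in>UNIV. I j) = {..<Suc n}" by (auto simp: I_def UNIV_bool)
    then show "indep_sets E (\<Union>j\<in>UNIV. I j)" using indE by simp
    show "Int_stable (E i)" for i by (simp add: E_def Int_stable_increment_events)
    show "disjoint_family_on I UNIV" by (auto simp: I_def disjoint_family_on_def split: bool.splits)
  qed
  then have "prob (\<Inter>j\<in>{True, False}. (case_bool a b) j) = (\<Prod>j\<in>{True, False}. prob (case_bool a b j))"
  proof (rule indep_setsD)
    have "a \<in> sigma_sets (space M) (\<Union>i<n. E i)"
      using finite_past_subset_grid[OF Px] A by (auto simp: E_def)
    moreover have "b \<in> sigma_sets (space M) (E n)"
      using B last by (auto simp: E_def x_def intro: sigma_sets.Basic)
    ultimately show "\<forall>j\<in>{True, False}. case_bool a b j \<in> sigma_sets (space M) (\<Union>i\<in>I j. E i)"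
      by (simp add: I_def)
  qed auto
  then show ?thesis by simp
qed

text \<open>The finite pasts form a directed family, so their union is stable under intersections,
  and the sigma-algebra it generates contains the past. Independence extends from this
  generator.\<close>

lemma past_indep_increment:
  assumes "t \<le> u" "u < v"
  shows "indep_set (sets (past t)) (sigma_sets (space M) (increment_events u v))"
proof -
  define G where "G = (\<Union>P\<in>{P. finite P \<and> P \<subseteq> {..t}}. finite_past P)"
  have alg: "sigma_algebra (space M) (finite_past P)" for P
    unfolding finite_past_def by (rule sigma_algebra_sigma_sets) (use increment_events_Pow in blast)
  have mono: "finite_past P \<subseteq> finite_past Q" if "P \<subseteq> Q" for P Q
    unfolding finite_past_def by (rule sigma_sets_mono') (use that in blast)
  have fin_sets: "finite_past P \<subseteq> sets M" for P
    unfolding finite_past_def by (rule sets.sigma_sets_subset) (use increment_events_sets in auto)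
  have stable: "Int_stable G"
  proof (rule Int_stableI)
    fix a b assume "a \<in> G" "b \<in> G"
    then obtain P Q where PQ: "finite P" "P \<subseteq> {..t}" "a \<in> finite_past P" "finite Q" "Q \<subseteq> {..t}" "b \<in> finite_past Q"
      by (auto simp: G_def)
    interpret sigma_algebra "space M" "finite_past (P \<union> Q)" by (rule alg)
    have "a \<in> finite_past (P \<union> Q)" "b \<in> finite_past (P \<union> Q)" using PQ mono[of P "P \<union> Q"] mono[of Q "P \<union> Q"] by auto
    then have "a \<inter> b \<in> finite_past (P \<union> Q)" by blast
    then show "a \<inter> b \<in> G" unfolding G_def using PQ by blast
  qed
  have "indep_set G (increment_events u v)"
    unfolding indep_sets2_eq
  proof (intro conjI ballI)
    show "G \<subseteq> sets M" using fin_sets by (auto simp: G_def)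
    show "increment_events u v \<subseteq> sets M" by (rule increment_events_sets)
    fix a b assume "a \<in> G" "b \<in> increment_events u v"
    then obtain P where P: "finite P" "P \<subseteq> {..t}" "a \<in> finite_past P" by (auto simp: G_def)
    have "P \<subseteq> {..u}" using P(2) assms(1) by auto
    then show "prob (a \<inter> b) = prob a * prob b"
      using finite_past_indep[OF P(1) _ assms(2) P(3) \<open>b \<in> increment_events u v\<close>] by blast
  qed
  then have ind: "indep_set (sigma_sets (space M) G) (sigma_sets (space M) (increment_events u v))"
    by (rule indep_set_sigma_sets[OF _ stable Int_stable_increment_events])
  have "sets (past t) \<subseteq> sigma_sets (space M) G"
    unfolding sets_past
  proof (rule sigma_sets_mono')
    show "(\<Union>(v, u)\<in>{(v, u). v \<le> u \<and> u \<le> t}. increment_events v u) \<subseteq> G"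
    proof (clarify)
      fix a v u assume *: "v \<le> u" "u \<le> t" "a \<in> increment_events v u"
      then have "a \<in> finite_past {v, u}" unfolding finite_past_def by (auto intro!: sigma_sets.Basic)
      then show "a \<in> G" unfolding G_def using * by (intro UN_I[of "{v, u}"]) auto
    qed
  qed
  then show ?thesis using ind unfolding indep_sets2_eq by blast
qed

text \<open>Independence factorises the expectation, and the increment has mean zero.\<close>

lemma past_orthogonal_increment:
  assumes tu: "t \<le> u" "u \<le> v" and U: "U \<in> borel_measurable (past t)" and int: "integrable M (\<lambda>\<omega>. (U \<omega>)\<^sup>2)"
  shows "(\<integral>\<omega>. U \<omega> * (W v \<omega> - W u \<omega>) $ i \<partial>M) = 0"
proof (cases "u = v")
  case False
  then have uv: "u < v" using tu by simp
  have UM[measurable]: "U \<in> borel_measurable M" by (rule past_measurable[OF U])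
  have iU: "integrable M U" by (rule square_integrable_imp_integrable[OF UM int])
  have "indep_var borel U borel (\<lambda>\<omega>. (W v \<omega> - W u \<omega>) $ i)"
    unfolding indep_var_eq
  proof (intro conjI)
    have 1: "sigma_sets (space M) {U -` A \<inter> space M |A. A \<in> sets borel} \<subseteq> sets (past t)"
    proof -
      have "{U -` A \<inter> space M |A. A \<in> sets borel} \<subseteq> sets (past t)"
        using measurable_sets[OF U] by auto
      then show ?thesis
        using sets.sigma_sets_subset[of "{U -` A \<inter> space M |A. A \<in> sets borel}" "past t"] by simp
    qed
    have "{(\<lambda>\<omega>. (W v \<omega> - W u \<omega>) $ i) -` A \<inter> space M |A. A \<in> sets borel} \<subseteq> increment_events u v"
    proof clarify
      fix A :: "real set" assume "A \<in> sets borel"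
      then have "(\<lambda>x :: real ^ 'm. x $ i) -` A \<in> sets borel"
        using measurable_sets[OF borel_measurable_vec_nth, of A i] by simp
      moreover have "(\<lambda>\<omega>. (W v \<omega> - W u \<omega>) $ i) -` A \<inter> space M =
          (\<lambda>\<omega>. W v \<omega> - W u \<omega>) -` ((\<lambda>x. x $ i) -` A) \<inter> space M" by auto
      ultimately show "(\<lambda>\<omega>. (W v \<omega> - W u \<omega>) $ i) -` A \<inter> space M \<in> increment_events u v"
        unfolding increment_events_def by blast
    qed
    then have 2: "sigma_sets (space M) {(\<lambda>\<omega>. (W v \<omega> - W u \<omega>) $ i) -` A \<inter> space M |A. A \<in> sets borel}
       \<subseteq> sigma_sets (space M) (increment_events u v)"
      by (rule sigma_sets_mono')
    show "indep_set (sigma_sets (space M) {U -` A \<inter> space M |A. A \<in> sets borel})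
       (sigma_sets (space M) {(\<lambda>\<omega>. (W v \<omega> - W u \<omega>) $ i) -` A \<inter> space M |A. A \<in> sets borel})"
      using past_indep_increment[OF tu(1) uv] 1 2 unfolding indep_sets2_eq by blast
  qed (simp_all add: UM)
  from indep_var_lebesgue_integral[OF this iU increment_integrable] tu increment_mean[OF tu(2)]
  show ?thesis by simp
qed simp

text \<open>Replaces the statement that the conditional expectation given the past vanishes.\<close>

definition past_orthogonal :: "real \<Rightarrow> ('w \<Rightarrow> real ^ 'd) \<Rightarrow> bool" where
  "past_orthogonal t Z \<longleftrightarrow> Z \<in> borel_measurable M \<and> integrable M (\<lambda>\<omega>. (norm (Z \<omega>))\<^sup>2) \<and>
     (\<forall>U :: 'w \<Rightarrow> real. U \<in> borel_measurable (past t) \<longrightarrow> integrable M (\<lambda>\<omega>. (U \<omega>)\<^sup>2) \<longrightarrow> (\<forall>i. (\<integral>\<omega>. U \<omega> * Z \<omega> $ i \<partial>M) = 0))"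

section \<open>Stability of orthogonality to the past\<close>

lemma square_integrable_component:
  fixes Z :: "'w \<Rightarrow> real ^ 'd"
  assumes Z: "Z \<in> borel_measurable M" and int: "integrable M (\<lambda>\<omega>. (norm (Z \<omega>))\<^sup>2)"
  shows "integrable M (\<lambda>\<omega>. (Z \<omega> $ i)\<^sup>2)"
proof (rule Bochner_Integration.integrable_bound[OF int])
  have [measurable]: "(\<lambda>\<omega>. Z \<omega> $ i) \<in> borel_measurable M"
    by (rule measurable_compose[OF Z borel_measurable_vec_nth])
  show "(\<lambda>\<omega>. (Z \<omega> $ i)\<^sup>2) \<in> borel_measurable M" by measurable
  show "AE \<omega> in M. norm ((Z \<omega> $ i)\<^sup>2) \<le> norm ((norm (Z \<omega>))\<^sup>2)"
  proof (intro AE_I2)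
    fix \<omega>
    have "\<bar>Z \<omega> $ i\<bar>\<^sup>2 \<le> (norm (Z \<omega>))\<^sup>2" by (intro power_mono component_le_norm_cart) auto
    then show "norm ((Z \<omega> $ i)\<^sup>2) \<le> norm ((norm (Z \<omega>))\<^sup>2)" by simp
  qed
qed

lemma integrable_mult_component:
  fixes Z :: "'w \<Rightarrow> real ^ 'd"
  assumes "U \<in> borel_measurable M" "integrable M (\<lambda>\<omega>. (U \<omega>)\<^sup>2)"
    and Z: "Z \<in> borel_measurable M" "integrable M (\<lambda>\<omega>. (norm (Z \<omega>))\<^sup>2)"
  shows "integrable M (\<lambda>\<omega>. U \<omega> * Z \<omega> $ i)"
  by (intro integrable_mult_square assms square_integrable_component[OF Z]
      measurable_compose[OF Z(1) borel_measurable_vec_nth])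

lemma past_orthogonal_add:
  assumes "past_orthogonal t Y" "past_orthogonal t Z"
  shows "past_orthogonal t (\<lambda>\<omega>. Y \<omega> + Z \<omega>)"
proof -
  have Y: "Y \<in> borel_measurable M" "integrable M (\<lambda>\<omega>. (norm (Y \<omega>))\<^sup>2)"
    and Z: "Z \<in> borel_measurable M" "integrable M (\<lambda>\<omega>. (norm (Z \<omega>))\<^sup>2)"
    using assms by (auto simp: past_orthogonal_def)
  show ?thesis
    unfolding past_orthogonal_def
  proof (intro conjI impI allI)
    show "(\<lambda>\<omega>. Y \<omega> + Z \<omega>) \<in> borel_measurable M" using Y Z by auto
    show "integrable M (\<lambda>\<omega>. (norm (Y \<omega> + Z \<omega>))\<^sup>2)" by (rule integrable_norm_square_add) (use Y Z in auto)
    fix U :: "'w \<Rightarrow> real" and i assume U: "U \<in> borel_measurable (past t)" "integrable M (\<lambda>\<omega>. (U \<omega>)\<^sup>2)"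
    show "(\<integral>\<omega>. U \<omega> * (Y \<omega> + Z \<omega>) $ i \<partial>M) = 0"
      using assms U integrable_mult_component[OF past_measurable[OF U(1)] U(2) Y, of i]
        integrable_mult_component[OF past_measurable[OF U(1)] U(2) Z, of i]
      by (simp add: past_orthogonal_def distrib_left)
  qed
qed

lemma past_orthogonal_zero: "past_orthogonal t (\<lambda>\<omega>. 0)"
  by (simp add: past_orthogonal_def)

lemma past_orthogonal_sum:
  "(\<And>i. i < n \<Longrightarrow> past_orthogonal t (Z i)) \<Longrightarrow> past_orthogonal t (\<lambda>\<omega>. \<Sum>i<n. Z i \<omega>)" for n :: nat
  by (induction n) (auto intro: past_orthogonal_add past_orthogonal_zero)

lemma past_orthogonal_scaleR:
  assumes "past_orthogonal t Z"
  shows "past_orthogonal t (\<lambda>\<omega>. r *\<^sub>R Z \<omega>)"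
  using assms
  by (auto simp: past_orthogonal_def power_mult_distrib mult.left_commute[of _ r])

lemma matrix_vector_measurable [measurable]:
  fixes c :: "real ^ 'm ^ 'd"
  assumes "Y \<in> borel_measurable N"
  shows "(\<lambda>\<omega>. c *v Y \<omega>) \<in> borel_measurable N"
  by (rule borel_measurable_continuous_on[OF _ assms]) (intro continuous_intros)

lemma past_orthogonal_increment_integral:
  assumes tu: "t \<le> u" "u \<le> v"
  shows "past_orthogonal t (\<lambda>\<omega>. c *v (W v \<omega> - W u \<omega>))"
  unfolding past_orthogonal_def
proof (intro conjI impI allI)
  show "(\<lambda>\<omega>. c *v (W v \<omega> - W u \<omega>)) \<in> borel_measurable M" by measurable
  show "integrable M (\<lambda>\<omega>. (norm (c *v (W v \<omega> - W u \<omega>)))\<^sup>2)"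
    using isometry_increments_integrable[OF tu(2) tu(2), of c c] by (simp add: power2_norm_eq_inner)
  fix U :: "'w \<Rightarrow> real" and i assume U: "U \<in> borel_measurable (past t)" "integrable M (\<lambda>\<omega>. (U \<omega>)\<^sup>2)"
  have eq: "U \<omega> * (c *v (W v \<omega> - W u \<omega>)) $ i = (\<Sum>j\<in>UNIV. c $ i $ j * (U \<omega> * (W v \<omega> - W u \<omega>) $ j))" for \<omega>
    by (simp add: matrix_vector_mult_def sum_distrib_left mult_ac)
  have [measurable]: "(\<lambda>\<omega>. (W v \<omega> - W u \<omega>) $ j) \<in> borel_measurable M" for j
    by simp
  have "integrable M (\<lambda>\<omega>. U \<omega> * (W v \<omega> - W u \<omega>) $ j)" for j
    by (intro integrable_mult_square past_measurable[OF U(1)] U(2) increment_square_integrable tu) measurable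
  then show "(\<integral>\<omega>. U \<omega> * (c *v (W v \<omega> - W u \<omega>)) $ i \<partial>M) = 0"
    unfolding eq using past_orthogonal_increment[OF tu U]
    by (subst Bochner_Integration.integral_sum) (auto simp del: vector_minus_component)
qed

lemma past_orthogonal_grid:
  assumes "t \<le> a" "a < b"
  shows "past_orthogonal t (grid_integral a b n c)"
proof -
  have "past_orthogonal t (\<lambda>\<omega>. \<Sum>i<n. c i *v (W (a + real (Suc i) * ((b - a) / real n)) \<omega> - W (a + real i * ((b - a) / real n)) \<omega>))"
  proof (intro past_orthogonal_sum past_orthogonal_increment_integral)
    fix i assume "i < n"
    then show "a + real i * ((b - a) / real n) \<le> a + real (Suc i) * ((b - a) / real n)"
      by (intro less_imp_le grid_step assms)
    have "0 \<le> real i * ((b - a) / real n)" using assms by simp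
    then show "t \<le> a + real i * ((b - a) / real n)" using assms by linarith
  qed
  then show ?thesis by (simp add: grid_integral_eq[abs_def])
qed

text \<open>Pairing with a fixed square integrable variable is continuous in mean square, so the
  vanishing of the pairing passes to limits.\<close>

lemma past_orthogonal_L2_limit:
  fixes Z :: "'w \<Rightarrow> real ^ 'd"
  assumes J: "\<And>n. past_orthogonal t (J n)" and Z[measurable]: "Z \<in> borel_measurable M"
    and lim: "(\<lambda>n. \<integral>\<^sup>+ \<omega>. ennreal ((norm (Z \<omega> - J n \<omega>))\<^sup>2) \<partial>M) \<longlonglongrightarrow> 0"
  shows "past_orthogonal t Z"
proof -
  have Jm[measurable]: "J n \<in> borel_measurable M" and Ji: "integrable M (\<lambda>\<omega>. (norm (J n \<omega>))\<^sup>2)" for n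
    using J[of n] by (auto simp: past_orthogonal_def)
  have small: "\<exists>n. integrable M (\<lambda>\<omega>. (norm (Z \<omega> - J n \<omega>))\<^sup>2) \<and> (\<integral>\<omega>. (norm (Z \<omega> - J n \<omega>))\<^sup>2 \<partial>M) < e" if "e > 0" for e
  proof -
    have "eventually (\<lambda>n. (\<integral>\<^sup>+ \<omega>. ennreal ((norm (Z \<omega> - J n \<omega>))\<^sup>2) \<partial>M) < ennreal e) sequentially"
      using order_tendstoD(2)[OF lim, of "ennreal e"] that by simp
    then obtain n where n: "(\<integral>\<^sup>+ \<omega>. ennreal ((norm (Z \<omega> - J n \<omega>))\<^sup>2) \<partial>M) < ennreal e"
      by (auto simp: eventually_sequentially)
    have int: "integrable M (\<lambda>\<omega>. (norm (Z \<omega> - J n \<omega>))\<^sup>2)"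
      by (rule integrableI_bounded) (use n in \<open>auto intro: less_trans\<close>)
    then have "ennreal (\<integral>\<omega>. (norm (Z \<omega> - J n \<omega>))\<^sup>2 \<partial>M) < ennreal e"
      using n nn_integral_eq_integral[OF int] by simp
    then show ?thesis using int that by (auto simp: ennreal_less_iff)
  qed
  show ?thesis
    unfolding past_orthogonal_def
  proof (intro conjI impI allI Z)
    obtain n where "integrable M (\<lambda>\<omega>. (norm (Z \<omega> - J n \<omega>))\<^sup>2)" using small[of 1] by auto
    from integrable_norm_square_add[OF _ _ this Ji[of n]] show iZ: "integrable M (\<lambda>\<omega>. (norm (Z \<omega>))\<^sup>2)" by simp
    fix U :: "'w \<Rightarrow> real" and i assume U: "U \<in> borel_measurable (past t)" and iU: "integrable M (\<lambda>\<omega>. (U \<omega>)\<^sup>2)"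
    note UM[measurable] = past_measurable[OF U]
    define x where "x = \<bar>\<integral>\<omega>. U \<omega> * Z \<omega> $ i \<partial>M\<bar>"
    show "(\<integral>\<omega>. U \<omega> * Z \<omega> $ i \<partial>M) = 0"
    proof (rule ccontr)
      assume "(\<integral>\<omega>. U \<omega> * Z \<omega> $ i \<partial>M) \<noteq> 0"
      then have x: "x > 0" by (simp add: x_def)
      define S where "S = (\<integral>\<omega>. (U \<omega>)\<^sup>2 \<partial>M)"
      have S: "0 \<le> S" by (simp add: S_def)
      \<comment> \<open>Weight for Young's inequality: e S <= x, and a mean square distance below e
        x makes the bound for the pairing strictly smaller than its absolute value x, a
        contradiction.\<close>
      define e where "e = x / (S + 1)"
      have e: "e > 0" using x S by (simp add: e_def)
      obtain n where n: "integrable M (\<lambda>\<omega>. (norm (Z \<omega> - J n \<omega>))\<^sup>2)" "(\<integral>\<omega>. (norm (Z \<omega> - J n \<omega>))\<^sup>2 \<partial>M) < e * x"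
        using small[of "e * x"] e x by auto
      let ?D = "\<lambda>\<omega>. Z \<omega> - J n \<omega>"
      have iD: "integrable M (\<lambda>\<omega>. U \<omega> * ?D \<omega> $ i)"
        by (rule integrable_mult_component[OF UM iU _ n(1)]) measurable
      have "(\<integral>\<omega>. U \<omega> * Z \<omega> $ i \<partial>M) = (\<integral>\<omega>. U \<omega> * ?D \<omega> $ i + U \<omega> * J n \<omega> $ i \<partial>M)"
        by (intro Bochner_Integration.integral_cong) (auto simp: algebra_simps)
      also have "\<dots> = (\<integral>\<omega>. U \<omega> * ?D \<omega> $ i \<partial>M)"
        using iD integrable_mult_component[OF UM iU Jm[of n] Ji[of n], of i] J[of n] U iU
        by (subst Bochner_Integration.integral_add) (auto simp: past_orthogonal_def)
      finally have "x = \<bar>\<integral>\<omega>. U \<omega> * ?D \<omega> $ i \<partial>M\<bar>" by (simp add: x_def)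
      also have "\<dots> \<le> (\<integral>\<omega>. \<bar>U \<omega> * ?D \<omega> $ i\<bar> \<partial>M)" by (rule integral_abs_bound)
      also have "\<dots> \<le> (\<integral>\<omega>. (e * (U \<omega>)\<^sup>2 + (1 / e) * (norm (?D \<omega>))\<^sup>2) / 2 \<partial>M)"
      proof (rule integral_mono)
        show "integrable M (\<lambda>\<omega>. \<bar>U \<omega> * ?D \<omega> $ i\<bar>)" using iD by (rule integrable_abs)
        show "integrable M (\<lambda>\<omega>. (e * (U \<omega>)\<^sup>2 + (1 / e) * (norm (?D \<omega>))\<^sup>2) / 2)"
          by (intro integrable_divide Bochner_Integration.integrable_add integrable_mult_right iU n)
        fix \<omega>
        let ?d = "norm (?D \<omega>)"
        have "\<bar>U \<omega> * ?D \<omega> $ i\<bar> \<le> \<bar>U \<omega>\<bar> * ?d"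
          unfolding abs_mult by (intro mult_left_mono component_le_norm_cart) auto
        moreover have "0 \<le> (e * \<bar>U \<omega>\<bar> - ?d)\<^sup>2 / e" using e by simp
        then have "2 * (\<bar>U \<omega>\<bar> * ?d) \<le> e * (U \<omega>)\<^sup>2 + (1 / e) * ?d\<^sup>2"
          using e by (simp add: power2_eq_square field_simps)
        ultimately show "\<bar>U \<omega> * ?D \<omega> $ i\<bar> \<le> (e * (U \<omega>)\<^sup>2 + (1 / e) * ?d\<^sup>2) / 2" by simp
      qed
      also have "\<dots> = (e * S + (1 / e) * (\<integral>\<omega>. (norm (?D \<omega>))\<^sup>2 \<partial>M)) / 2"
        using iU n(1) by (simp add: S_def)
      also have "\<dots> < (x + (1 / e) * (e * x)) / 2"
      proof -
        have "e * S \<le> x" using S x by (simp add: e_def field_simps)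
        moreover have "(1 / e) * (\<integral>\<omega>. (norm (?D \<omega>))\<^sup>2 \<partial>M) < (1 / e) * (e * x)"
          using n(2) e by (intro mult_strict_left_mono) auto
        ultimately show ?thesis by (intro divide_strict_right_mono add_le_less_mono) auto
      qed
      also have "\<dots> = x" using e by simp
      finally show False by simp
    qed
  qed
qed

section \<open>Increments of the Wiener integral\<close>

lemma norm_add3_square:
  "(norm (x + y + z))\<^sup>2 \<le> 3 * ((norm x)\<^sup>2 + (norm y)\<^sup>2 + (norm z)\<^sup>2)" for x y z :: "'e::real_normed_vector"
proof -
  have "norm (x + y + z) \<le> norm x + norm y + norm z"
    using norm_triangle_ineq[of "x + y" z] norm_triangle_ineq[of x y] by linarith
  then have "(norm (x + y + z))\<^sup>2 \<le> (norm x + norm y + norm z)\<^sup>2" by (intro power_mono) auto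
  also have "\<dots> \<le> 3 * ((norm x)\<^sup>2 + (norm y)\<^sup>2 + (norm z)\<^sup>2)"
    using zero_le_power2[of "norm x - norm y"] zero_le_power2[of "norm x - norm z"] zero_le_power2[of "norm y - norm z"]
    by (simp add: power2_eq_square algebra_simps)
  finally show ?thesis .
qed

lemma ennreal_norm_add3_square:
  "ennreal ((norm (x + y + z))\<^sup>2) \<le>
    3 * (ennreal ((norm x)\<^sup>2) + ennreal ((norm y)\<^sup>2) + ennreal ((norm z)\<^sup>2))" for x y z :: "'e::real_normed_vector"
proof -
  have "ennreal ((norm (x + y + z))\<^sup>2) \<le> ennreal (3 * ((norm x)\<^sup>2 + (norm y)\<^sup>2 + (norm z)\<^sup>2))"
    by (intro ennreal_leI norm_add3_square)
  then show ?thesis by (simp add: ennreal_mult ennreal_plus)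
qed

lemma partition_mono:
  assumes "is_partition a b N u" "i \<le> j" "j \<le> N"
  shows "u i \<le> u j"
  using assms(2,3)
proof (induction j)
  case (Suc j)
  show ?case
  proof (cases "i = Suc j")
    case False
    then have "u i \<le> u j" using Suc by simp
    also have "u j \<le> u (Suc j)" using assms(1) Suc.prems by (simp add: is_partition_def)
    finally show ?thesis .
  qed simp
qed simp

lemma step_fun_outside:
  assumes p: "is_partition a b N u" and s: "s \<notin> {a<..b}"
  shows "step_fun N u c s = 0"
proof -
  have "indicator {u i<..u (Suc i)} s *\<^sub>R c i = 0" if "i < N" for i
  proof -
    have "a \<le> u i" "u (Suc i) \<le> b"
      using partition_mono[OF p, of 0 i] partition_mono[OF p, of "Suc i" N] that p
      by (auto simp: is_partition_def)
    then show ?thesis using s by (auto simp: indicator_def)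
  qed
  then show ?thesis unfolding step_fun_def by (intro sum.neutral) blast
qed

lemma partition_elementary:
  "is_partition a b N u \<Longrightarrow> elementary (step_fun N u c) (step_integral W N u c)"
  by (rule elementary_step_fun) (simp add: is_partition_def)

lemma partition_indicator_sum:
  assumes p: "is_partition a b N u" and s: "s \<in> {a<..b}"
  shows "(\<Sum>i<N. indicator {u i<..u (Suc i)} s) = (1::real)"
proof -
  have "(\<Sum>i<k. indicator {u i<..u (Suc i)} s) = (indicator {a<..u k} s :: real)" if "k \<le> N" for k
    using that
  proof (induction k)
    case 0
    then show ?case using p by (simp add: is_partition_def)
  next
    case (Suc k)
    have "a \<le> u k" "u k \<le> u (Suc k)"
      using partition_mono[OF p, of 0 k] partition_mono[OF p, of k "Suc k"] Suc.prems p by (auto simp: is_partition_def)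
    then show ?case using Suc by (auto simp: indicator_def)
  qed
  from this[of N] show ?thesis using p s by (simp add: is_partition_def)
qed

lemma grid_partition:
  assumes "a < b" "0 < n"
  shows "is_partition a b n (\<lambda>i. a + real i * ((b - a) / real n))"
  using assms grid_step[OF assms(1), of _ n] by (auto simp: is_partition_def less_imp_le simp del: of_nat_Suc)

text \<open>Exactly one of the half-open cells contains s, so the step function deviates from g by
  at most the variation of g over one cell.\<close>

lemma grid_step_fun_close:
  fixes g :: "real \<Rightarrow> real ^ 'm ^ 'd"
  assumes ab: "a < b" and n: "0 < n" and lip: "\<And>x y. norm (g x - g y) \<le> L * \<bar>x - y\<bar>" and L: "0 \<le> L" and s: "s \<in> {a<..b}"
  defines "u \<equiv> \<lambda>i. a + real i * ((b - a) / real n)"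
  shows "norm (step_fun n u (\<lambda>i. g (u i)) s - g s) \<le> L * ((b - a) / real n)"
proof -
  have one: "(\<Sum>i<n. indicator {u i<..u (Suc i)} s) = (1::real)"
    unfolding u_def by (rule partition_indicator_sum[OF grid_partition[OF ab n] s])
  have "step_fun n u (\<lambda>i. g (u i)) s - g s = (\<Sum>i<n. indicator {u i<..u (Suc i)} s *\<^sub>R (g (u i) - g s))"
    using one by (simp add: step_fun_def scaleR_diff_right sum_subtractf flip: scaleR_left.sum)
  also have "norm \<dots> \<le> (\<Sum>i<n. indicator {u i<..u (Suc i)} s * (L * ((b - a) / real n)))"
  proof (intro order.trans[OF norm_sum] sum_mono)
    fix i
    have "u (Suc i) - u i = (b - a) / real n" by (simp add: u_def distrib_right del: times_divide_eq_right times_divide_eq_left)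
    then have "s \<in> {u i<..u (Suc i)} \<Longrightarrow> L * \<bar>u i - s\<bar> \<le> L * ((b - a) / real n)"
      using L by (intro mult_left_mono) auto
    then show "norm (indicator {u i<..u (Suc i)} s *\<^sub>R (g (u i) - g s)) \<le> indicator {u i<..u (Suc i)} s * (L * ((b - a) / real n))"
      using lip[of "u i" s] by (auto simp: indicator_def)
  qed
  also have "\<dots> = L * ((b - a) / real n)" unfolding sum_distrib_right[symmetric] one by simp
  finally show ?thesis .
qed

text \<open>The integrals up to t and up to s come with unrelated partitions. The difference of
  their approximations and the grid sum is again elementary, so the isometry moves the comparison to
  the time axis, where the approximations of g cancel up to t and only the interval from t to s
  survives. The increment is thus expressed by Wiener increments after t.\<close>

lemma wiener_integral_increment:
  fixes g :: "real \<Rightarrow> real ^ 'm ^ 'd"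
  assumes It: "has_wiener_integral M W t0 t g I" and Is: "has_wiener_integral M W t0 s g I'"
    and ts: "t0 \<le> t" "t < s" and lip: "\<And>x y. norm (g x - g y) \<le> L * \<bar>x - y\<bar>" and L: "0 \<le> L"
  defines "G \<equiv> \<lambda>n. grid_integral t s n (\<lambda>i. g (t + real i * ((s - t) / real n)))"
  shows "(\<lambda>n. \<integral>\<^sup>+ \<omega>. ennreal ((norm (I' \<omega> - I \<omega> - G n \<omega>))\<^sup>2) \<partial>M) \<longlonglongrightarrow> 0"
proof -
  obtain N u c where p: "\<And>n. is_partition t0 t (N n) (u n)"
    and l1: "(\<lambda>n. \<integral>\<^sup>+ r\<in>{t0..t}. ennreal ((norm (g r - step_fun (N n) (u n) (c n) r))\<^sup>2) \<partial>lborel) \<longlonglongrightarrow> 0"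
    and l2: "(\<lambda>n. \<integral>\<^sup>+ \<omega>. ennreal ((norm (I \<omega> - step_integral W (N n) (u n) (c n) \<omega>))\<^sup>2) \<partial>M) \<longlonglongrightarrow> 0"
    using It unfolding has_wiener_integral_def by blast
  obtain N' u' c' where p': "\<And>n. is_partition t0 s (N' n) (u' n)"
    and l1': "(\<lambda>n. \<integral>\<^sup>+ r\<in>{t0..s}. ennreal ((norm (g r - step_fun (N' n) (u' n) (c' n) r))\<^sup>2) \<partial>lborel) \<longlonglongrightarrow> 0"
    and l2': "(\<lambda>n. \<integral>\<^sup>+ \<omega>. ennreal ((norm (I' \<omega> - step_integral W (N' n) (u' n) (c' n) \<omega>))\<^sup>2) \<partial>M) \<longlonglongrightarrow> 0"
    using Is unfolding has_wiener_integral_def by blast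
  have [measurable]: "I \<in> borel_measurable M" "I' \<in> borel_measurable M"
    using It Is by (auto simp: has_wiener_integral_def)
  define \<phi> where "\<phi> n = step_fun (N n) (u n) (c n)" for n
  define \<phi>' where "\<phi>' n = step_fun (N' n) (u' n) (c' n)" for n
  define \<eta> where "\<eta> n = step_fun n (\<lambda>i. t + real i * ((s - t) / real n)) (\<lambda>i. g (t + real i * ((s - t) / real n)))" for n
  define J where "J n = step_integral W (N n) (u n) (c n)" for n
  define J' where "J' n = step_integral W (N' n) (u' n) (c' n)" for n
  have el: "elementary (\<phi> n) (J n)" "elementary (\<phi>' n) (J' n)" "elementary (\<eta> n) (G n)" for n
    unfolding \<phi>_def \<phi>'_def J_def J'_def \<eta>_def G_def
    by (rule partition_elementary[OF p] partition_elementary[OF p'] grid_elementary[OF ts(2)])+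
  have [measurable]: "J n \<in> borel_measurable M" "J' n \<in> borel_measurable M" "G n \<in> borel_measurable M"
     "\<phi> n \<in> borel_measurable borel" "\<phi>' n \<in> borel_measurable borel" for n
    using el elementary_measurable by blast+
  have g[measurable]: "g \<in> borel_measurable borel"
  proof (intro borel_measurable_continuous_onI)
    have "L-lipschitz_on UNIV g" by (intro lipschitz_onI L) (use lip in \<open>auto simp: dist_norm\<close>)
    then show "continuous_on UNIV g" by (rule lipschitz_on_continuous_on)
  qed
  define \<alpha> where "\<alpha> n = (\<integral>\<^sup>+ r\<in>{t0..t}. ennreal ((norm (g r - \<phi> n r))\<^sup>2) \<partial>lborel)" for n
  define \<alpha>' where "\<alpha>' n = (\<integral>\<^sup>+ r\<in>{t0..s}. ennreal ((norm (g r - \<phi>' n r))\<^sup>2) \<partial>lborel)" for n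
  define \<beta> where "\<beta> n = (\<integral>\<^sup>+ \<omega>. ennreal ((norm (I \<omega> - J n \<omega>))\<^sup>2) \<partial>M)" for n
  define \<beta>' where "\<beta>' n = (\<integral>\<^sup>+ \<omega>. ennreal ((norm (I' \<omega> - J' n \<omega>))\<^sup>2) \<partial>M)" for n
  define \<epsilon> where "\<epsilon> n = (L * ((s - t) / real n))\<^sup>2 * (s - t)" for n
  have lims: "\<alpha> \<longlonglongrightarrow> 0" "\<alpha>' \<longlonglongrightarrow> 0" "\<beta> \<longlonglongrightarrow> 0" "\<beta>' \<longlonglongrightarrow> 0"
    using l1 l1' l2 l2' by (simp_all add: \<alpha>_def[abs_def] \<alpha>'_def[abs_def] \<beta>_def[abs_def] \<beta>'_def[abs_def] \<phi>_def \<phi>'_def J_def J'_def)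
  have E: "(\<integral>\<^sup>+ \<omega>. ennreal ((norm (J' n \<omega> - J n \<omega> - G n \<omega>))\<^sup>2) \<partial>M) \<le> 3 * (\<alpha>' n + \<alpha> n + ennreal (\<epsilon> n))"
    if n: "0 < n" for n
  proof -
    have "(\<integral>\<^sup>+ \<omega>. ennreal ((norm (J' n \<omega> - J n \<omega> - G n \<omega>))\<^sup>2) \<partial>M) =
        (\<integral>\<^sup>+ r. ennreal ((norm (\<phi>' n r - \<phi> n r - \<eta> n r))\<^sup>2) \<partial>lborel)"
      by (rule elementary_isometry) (intro elementary_diff el)
    also have "\<dots> \<le> (\<integral>\<^sup>+ r. 3 * (ennreal ((norm (g r - \<phi>' n r))\<^sup>2) * indicator {t0..s} r
       + ennreal ((norm (g r - \<phi> n r))\<^sup>2) * indicator {t0..t} r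
       + ennreal ((L * ((s - t) / real n))\<^sup>2) * indicator {t<..s} r) \<partial>lborel)"
    proof (intro nn_integral_mono)
      fix r
      \<comment> \<open>g cancels in x + y + z: between x and y before t, between x and z after t.
        Outside their intervals all step functions vanish.\<close>
      define x where "x = (if r \<in> {t0<..s} then \<phi>' n r - g r else 0)"
      define y where "y = (if r \<in> {t0<..t} then g r - \<phi> n r else 0)"
      define z where "z = (if r \<in> {t<..s} then g r - \<eta> n r else 0)"
      have "\<phi>' n r = 0" if "r \<notin> {t0<..s}" unfolding \<phi>'_def by (rule step_fun_outside[OF p' that])
      moreover have "\<phi> n r = 0" if "r \<notin> {t0<..t}" unfolding \<phi>_def by (rule step_fun_outside[OF p that])
      moreover have "\<eta> n r = 0" if "r \<notin> {t<..s}"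
        unfolding \<eta>_def by (rule step_fun_outside[OF grid_partition[OF ts(2) n] that])
      ultimately have "\<phi>' n r - \<phi> n r - \<eta> n r = x + y + z"
        using ts by (auto simp: x_def y_def z_def)
      then have "ennreal ((norm (\<phi>' n r - \<phi> n r - \<eta> n r))\<^sup>2) \<le>
          3 * (ennreal ((norm x)\<^sup>2) + ennreal ((norm y)\<^sup>2) + ennreal ((norm z)\<^sup>2))"
        using ennreal_norm_add3_square[of x y z] by simp
      also have "\<dots> \<le> 3 * (ennreal ((norm (g r - \<phi>' n r))\<^sup>2) * indicator {t0..s} r
         + ennreal ((norm (g r - \<phi> n r))\<^sup>2) * indicator {t0..t} r
         + ennreal ((L * ((s - t) / real n))\<^sup>2) * indicator {t<..s} r)"
      proof (intro mult_left_mono add_mono)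
        show "ennreal ((norm x)\<^sup>2) \<le> ennreal ((norm (g r - \<phi>' n r))\<^sup>2) * indicator {t0..s} r"
          by (auto simp: x_def norm_minus_commute indicator_def)
        show "ennreal ((norm y)\<^sup>2) \<le> ennreal ((norm (g r - \<phi> n r))\<^sup>2) * indicator {t0..t} r"
          by (auto simp: y_def indicator_def)
        have "norm (g r - \<eta> n r) \<le> L * ((s - t) / real n)" if "r \<in> {t<..s}"
          using grid_step_fun_close[OF ts(2) n lip L that] by (simp add: \<eta>_def norm_minus_commute)
        then have "(norm z)\<^sup>2 \<le> (L * ((s - t) / real n))\<^sup>2" if "r \<in> {t<..s}"
          using that by (simp add: z_def power_mono)
        then show "ennreal ((norm z)\<^sup>2) \<le> ennreal ((L * ((s - t) / real n))\<^sup>2) * indicator {t<..s} r"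
          by (cases "r \<in> {t<..s}") (auto simp: z_def intro: ennreal_leI)
      qed auto
      finally show "ennreal ((norm (\<phi>' n r - \<phi> n r - \<eta> n r))\<^sup>2) \<le> \<dots>" .
    qed
    also have "\<dots> = 3 * (\<alpha>' n + \<alpha> n + ennreal ((L * ((s - t) / real n))\<^sup>2) * emeasure lborel {t<..s})"
      unfolding \<alpha>_def \<alpha>'_def
      by (subst nn_integral_cmult, measurable, subst nn_integral_add, measurable, subst nn_integral_add, measurable,
          subst nn_integral_cmult_indicator, auto)
    also have "\<dots> = 3 * (\<alpha>' n + \<alpha> n + ennreal (\<epsilon> n))"
      using ts by (simp add: \<epsilon>_def ennreal_mult)
    finally show ?thesis .
  qed
  have "\<epsilon> \<longlonglongrightarrow> (L * 0)\<^sup>2 * (s - t)"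
    unfolding \<epsilon>_def by (intro tendsto_intros tendsto_divide_0[OF tendsto_const] filterlim_at_top_imp_at_infinity filterlim_real_sequentially)
  then have \<epsilon>: "(\<lambda>n. ennreal (\<epsilon> n)) \<longlonglongrightarrow> 0" using tendsto_ennrealI[of \<epsilon> 0] by simp
  have le: "(\<integral>\<^sup>+ \<omega>. ennreal ((norm (I' \<omega> - I \<omega> - G n \<omega>))\<^sup>2) \<partial>M) \<le>
      3 * (\<beta>' n + \<beta> n + 3 * (\<alpha>' n + \<alpha> n + ennreal (\<epsilon> n)))" if n: "0 < n" for n
  proof -
    have "(\<integral>\<^sup>+ \<omega>. ennreal ((norm (I' \<omega> - I \<omega> - G n \<omega>))\<^sup>2) \<partial>M) \<le>
      (\<integral>\<^sup>+ \<omega>. 3 * (ennreal ((norm (I' \<omega> - J' n \<omega>))\<^sup>2) + ennreal ((norm (I \<omega> - J n \<omega>))\<^sup>2)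
         + ennreal ((norm (J' n \<omega> - J n \<omega> - G n \<omega>))\<^sup>2)) \<partial>M)"
    proof (intro nn_integral_mono)
      fix \<omega>
      show "ennreal ((norm (I' \<omega> - I \<omega> - G n \<omega>))\<^sup>2) \<le>
         3 * (ennreal ((norm (I' \<omega> - J' n \<omega>))\<^sup>2) + ennreal ((norm (I \<omega> - J n \<omega>))\<^sup>2)
         + ennreal ((norm (J' n \<omega> - J n \<omega> - G n \<omega>))\<^sup>2))"
        using ennreal_norm_add3_square[of "I' \<omega> - J' n \<omega>" "- (I \<omega> - J n \<omega>)" "J' n \<omega> - J n \<omega> - G n \<omega>"]
        unfolding norm_minus_cancel by (simp add: algebra_simps)
    qed
    also have "\<dots> = 3 * (\<beta>' n + \<beta> n + (\<integral>\<^sup>+ \<omega>. ennreal ((norm (J' n \<omega> - J n \<omega> - G n \<omega>))\<^sup>2) \<partial>M))"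
      unfolding \<beta>_def \<beta>'_def
      by (subst nn_integral_cmult, measurable, subst nn_integral_add, measurable, subst nn_integral_add, measurable)
    also have "\<dots> \<le> 3 * (\<beta>' n + \<beta> n + 3 * (\<alpha>' n + \<alpha> n + ennreal (\<epsilon> n)))"
      by (intro mult_left_mono add_left_mono E n) auto
    finally show ?thesis .
  qed
  have lim0: "(\<lambda>n. 3 * (\<beta>' n + \<beta> n + 3 * (\<alpha>' n + \<alpha> n + ennreal (\<epsilon> n)))) \<longlonglongrightarrow> 3 * (0 + 0 + 3 * (0 + 0 + 0))"
    by (intro tendsto_add ennreal_tendsto_cmult lims \<epsilon>) auto
  show ?thesis
  proof (rule tendsto_sandwich[OF _ _ tendsto_const])
    show "eventually (\<lambda>n. (0::ennreal) \<le> (\<integral>\<^sup>+ \<omega>. ennreal ((norm (I' \<omega> - I \<omega> - G n \<omega>))\<^sup>2) \<partial>M)) sequentially" by simp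
    show "eventually (\<lambda>n. (\<integral>\<^sup>+ \<omega>. ennreal ((norm (I' \<omega> - I \<omega> - G n \<omega>))\<^sup>2) \<partial>M) \<le>
       3 * (\<beta>' n + \<beta> n + 3 * (\<alpha>' n + \<alpha> n + ennreal (\<epsilon> n)))) sequentially"
      using eventually_gt_at_top[of 0] by eventually_elim (rule le)
    show "(\<lambda>n. 3 * (\<beta>' n + \<beta> n + 3 * (\<alpha>' n + \<alpha> n + ennreal (\<epsilon> n)))) \<longlonglongrightarrow> 0" using lim0 by simp
  qed
qed

text \<open>Each property holds for grid sums and passes to the mean square limit. Freezing g at t
  leaves coefficients of size L (s - t), which improves the order from 1/2 to 3/2.\<close>

lemma
  fixes g :: "real \<Rightarrow> real ^ 'm ^ 'd"
  assumes It: "has_wiener_integral M W t0 t g I" and Is: "has_wiener_integral M W t0 s g I'"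
    and ts: "t0 \<le> t" "t < s" and lip: "\<And>x y. norm (g x - g y) \<le> L * \<bar>x - y\<bar>" and L: "0 < L"
  shows wiener_integral_increment_orthogonal: "past_orthogonal t (\<lambda>\<omega>. I' \<omega> - I \<omega>)"
    and wiener_integral_increment_moment:
      "(\<And>x. norm (g x) \<le> C) \<Longrightarrow> 0 < C \<Longrightarrow> 1 \<le> q \<Longrightarrow>
       (\<integral>\<^sup>+ \<omega>. ennreal (norm (I' \<omega> - I \<omega>) ^ q) \<partial>M) \<le> ennreal (gauss_const CARD('d) q * (C * sqrt (s - t)) ^ q)"
    and wiener_integral_frozen_moment:
      "1 \<le> q \<Longrightarrow> (\<integral>\<^sup>+ \<omega>. ennreal (norm (I' \<omega> - I \<omega> - g t *v (W s \<omega> - W t \<omega>)) ^ q) \<partial>M) \<le>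
         ennreal (gauss_const CARD('d) q * (L * (s - t) * sqrt (s - t)) ^ q)"
proof -
  have [measurable]: "I \<in> borel_measurable M" "I' \<in> borel_measurable M"
    using It Is by (auto simp: has_wiener_integral_def)
  define G where "G n = grid_integral t s n (\<lambda>i. g (t + real i * ((s - t) / real n)))" for n
  have lim: "(\<lambda>n. \<integral>\<^sup>+ \<omega>. ennreal ((norm (I' \<omega> - I \<omega> - G n \<omega>))\<^sup>2) \<partial>M) \<longlonglongrightarrow> 0"
    unfolding G_def using wiener_integral_increment[OF It Is ts lip] L by simp
  have Gm: "G n \<in> borel_measurable M" for n unfolding G_def by (rule grid_integral_measurable[OF ts(2)])
  show "past_orthogonal t (\<lambda>\<omega>. I' \<omega> - I \<omega>)"
    by (rule past_orthogonal_L2_limit[OF _ _ lim]) (auto simp: G_def intro!: past_orthogonal_grid ts)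
  show "(\<integral>\<^sup>+ \<omega>. ennreal (norm (I' \<omega> - I \<omega>) ^ q) \<partial>M) \<le> ennreal (gauss_const CARD('d) q * (C * sqrt (s - t)) ^ q)"
    if "\<And>x. norm (g x) \<le> C" "0 < C" "1 \<le> q" for C q
    by (rule L2_limit_moment[OF Gm _ lim]) (auto simp: G_def intro!: grid_integral_moment ts that)
  \<comment> \<open>Subtracting \<open>g t\<close> in every cell changes the grid sum by
    \<open>g t\<close> applied to the whole increment, by telescoping. \<open>Suc n\<close> excludes
    the empty grid, where this fails.\<close>
  define H where "H n = grid_integral t s (Suc n) (\<lambda>i. g (t + real i * ((s - t) / real (Suc n))) - g t)" for n
  have Hm: "H n \<in> borel_measurable M" for n unfolding H_def by (rule grid_integral_measurable[OF ts(2)])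
  have HG: "I' \<omega> - I \<omega> - g t *v (W s \<omega> - W t \<omega>) - H n \<omega> = I' \<omega> - I \<omega> - G (Suc n) \<omega>" for n \<omega>
  proof -
    let ?u = "\<lambda>i. t + real i * ((s - t) / real (Suc n))"
    have "(\<Sum>i<Suc n. g t *v (W (?u (Suc i)) \<omega> - W (?u i) \<omega>)) = g t *v (\<Sum>i<Suc n. W (?u (Suc i)) \<omega> - W (?u i) \<omega>)"
      by (rule vec.sum[symmetric])
    also have "(\<Sum>i<Suc n. W (?u (Suc i)) \<omega> - W (?u i) \<omega>) = W (?u (Suc n)) \<omega> - W (?u 0) \<omega>"
      by (rule sum_lessThan_telescope)
    also have "?u (Suc n) = s" by (simp del: of_nat_Suc)
    finally have "(\<Sum>i<Suc n. g t *v (W (?u (Suc i)) \<omega> - W (?u i) \<omega>)) = g t *v (W s \<omega> - W t \<omega>)" by simp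
    moreover have "H n \<omega> = G (Suc n) \<omega> - (\<Sum>i<Suc n. g t *v (W (?u (Suc i)) \<omega> - W (?u i) \<omega>))"
      unfolding H_def G_def grid_integral_eq sum_subtractf[symmetric]
      by (intro sum.cong refl) (rule matrix_vector_mult_diff_rdistrib)
    ultimately show ?thesis by simp
  qed
  have limH: "(\<lambda>n. \<integral>\<^sup>+ \<omega>. ennreal ((norm (I' \<omega> - I \<omega> - g t *v (W s \<omega> - W t \<omega>) - H n \<omega>))\<^sup>2) \<partial>M) \<longlonglongrightarrow> 0"
    unfolding HG using LIMSEQ_Suc[OF lim] by simp
  show "(\<integral>\<^sup>+ \<omega>. ennreal (norm (I' \<omega> - I \<omega> - g t *v (W s \<omega> - W t \<omega>)) ^ q) \<partial>M) \<le>
         ennreal (gauss_const CARD('d) q * (L * (s - t) * sqrt (s - t)) ^ q)" if "1 \<le> q" for q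
  proof (rule L2_limit_moment[OF Hm _ limH])
    show "(\<lambda>\<omega>. I' \<omega> - I \<omega> - g t *v (W s \<omega> - W t \<omega>)) \<in> borel_measurable M" by measurable
    show "(\<integral>\<^sup>+ \<omega>. ennreal (norm (H n \<omega>) ^ q) \<partial>M) \<le> ennreal (gauss_const CARD('d) q * (L * (s - t) * sqrt (s - t)) ^ q)" for n
      unfolding H_def
    proof (intro grid_integral_moment ts that)
      show "0 < L * (s - t)" using L ts by simp
      fix i assume "i < Suc n"
      then have "t + real i * ((s - t) / real (Suc n)) \<in> {t..s}" by (intro uniform_point_in') (use ts in auto)
      then have "L * \<bar>t + real i * ((s - t) / real (Suc n)) - t\<bar> \<le> L * (s - t)"
        using L by (intro mult_left_mono) auto
      with lip[of "t + real i * ((s - t) / real (Suc n))" t]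
      show "norm (g (t + real i * ((s - t) / real (Suc n))) - g t) \<le> L * (s - t)" by linarith
    qed
  qed
qed

end

section \<open>Moment bounds for the solution\<close>

text \<open>The difference y = x - n has derivative A x + f(r, x), so comparing x with n by
  dissipativity gives (|y|^2)' <= -2 a |y|^2 + 2 |y| |A n + f(r, n)|. Young's inequality gives back
  half of the decay and leaves the rate a.\<close>

lemma dissipative_path_bound:
  fixes x n :: "real \<Rightarrow> real ^ 'd" and A :: "real ^ 'd ^ 'd"
  assumes a: "0 < a" and ts: "t \<le> s"
    and F: "continuous_on UNIV (\<lambda>(t, x). f t x)"
    and dissip: "\<And>r x y. (x - y) \<bullet> (A *v (x - y) + f r x - f r y) \<le> - a * (norm (x - y))\<^sup>2"
    and x: "continuous_on {t..s} x"
    and n: "\<And>r. r \<in> {t..s} \<Longrightarrow> n r = x r - x t - integral {t..r} (\<lambda>u. A *v x u + f u (x u))"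
  shows "(norm (x s - n s))\<^sup>2 \<le> exp (- a * (s - t)) * (norm (x t))\<^sup>2
     + (1 / a) * integral {t..s} (\<lambda>r. (norm (A *v n r + f r (n r)))\<^sup>2)"
proof -
  define drift where "drift u = A *v x u + f u (x u)" for u
  have fc: "continuous_on {t..s} (\<lambda>u. f u (z u))" if "continuous_on {t..s} z" for z
    using continuous_on_compose2[OF F continuous_on_Pair[OF continuous_on_id that]] by simp
  have Ac: "continuous_on {t..s} (\<lambda>u. A *v z u)" if "continuous_on {t..s} z" for z
    by (rule continuous_on_compose2[OF _ that, of UNIV "\<lambda>x. A *v x"]) (auto intro!: continuous_intros)
  have dc: "continuous_on {t..s} drift" unfolding drift_def by (intro continuous_intros fc Ac x)
  define y where "y r = x t + integral {t..r} drift" for r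
  have ny: "n r = x r - y r" if "r \<in> {t..s}" for r
    using n[OF that] by (simp add: y_def drift_def[abs_def])
  have yd: "(y has_vector_derivative drift r) (at r within {t..s})" if "r \<in> {t..s}" for r
    unfolding y_def using integral_has_vector_derivative[OF dc that]
    by (auto intro!: derivative_eq_intros)
  have yc: "continuous_on {t..s} y"
    by (rule continuous_on_vector_derivative[OF yd])
  have nc: "continuous_on {t..s} n"
    by (rule continuous_on_cong[THEN iffD2, OF refl ny]) (auto intro!: continuous_intros x yc)
  define b where "b r = (norm (A *v n r + f r (n r)))\<^sup>2" for r
  have bc: "continuous_on {t..s} b" unfolding b_def by (intro continuous_intros fc Ac nc)
  \<comment> \<open>Integrating factor for the remaining rate a.\<close>
  define \<psi> where "\<psi> r = exp (a * (r - t)) * (y r \<bullet> y r)" for r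
  define \<psi>' where "\<psi>' r = exp (a * (r - t)) * (a * (y r \<bullet> y r) + 2 * (y r \<bullet> drift r))" for r
  have "(\<psi> has_vector_derivative \<psi>' r) (at r within {t..s})" if "r \<in> {t..s}" for r
  proof -
    have "((\<lambda>r. y r \<bullet> y r) has_derivative (\<lambda>h. y r \<bullet> (h *\<^sub>R drift r) + (h *\<^sub>R drift r) \<bullet> y r)) (at r within {t..s})"
      using yd[OF that] unfolding has_vector_derivative_def by (intro has_derivative_inner)
    then have "((\<lambda>r. y r \<bullet> y r) has_real_derivative 2 * (y r \<bullet> drift r)) (at r within {t..s})"
      unfolding has_field_derivative_def
      by (rule has_derivative_eq_rhs) (auto simp: inner_commute algebra_simps)
    then have "(\<psi> has_real_derivative \<psi>' r) (at r within {t..s})"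
      unfolding \<psi>_def \<psi>'_def by (auto intro!: derivative_eq_intros simp: algebra_simps)
    then show ?thesis by (simp add: has_real_derivative_iff_has_vector_derivative)
  qed
  from fundamental_theorem_of_calculus[OF ts this]
  have hi: "(\<psi>' has_integral \<psi> s - \<psi> t) {t..s}" by simp
  have le: "\<psi>' r \<le> exp (a * (s - t)) / a * b r" if r: "r \<in> {t..s}" for r
  proof -
    have xr: "x r = y r + n r" using ny[OF r] by simp
    have "y r \<bullet> drift r = (x r - n r) \<bullet> (A *v (x r - n r) + f r (x r) - f r (n r)) + y r \<bullet> (A *v n r + f r (n r))"
      by (simp add: drift_def xr matrix_vector_right_distrib matrix_vector_mult_diff_distrib inner_add_right inner_diff_right)
    also have "\<dots> \<le> - a * (norm (y r))\<^sup>2 + norm (y r) * norm (A *v n r + f r (n r))"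
      using dissip[of "x r" "n r" r] norm_cauchy_schwarz[of "y r" "A *v n r + f r (n r)"] by (simp add: xr)
    finally have 1: "y r \<bullet> drift r \<le> - a * (norm (y r))\<^sup>2 + norm (y r) * sqrt (b r)" by (simp add: b_def)
    have "0 \<le> (a * norm (y r) - sqrt (b r))\<^sup>2 / a" using a by simp
    also have "\<dots> = a * (norm (y r))\<^sup>2 - 2 * (norm (y r) * sqrt (b r)) + b r / a"
      using a by (simp add: power2_diff power_mult_distrib b_def field_simps power2_eq_square)
    finally have "2 * (norm (y r) * sqrt (b r)) \<le> a * (norm (y r))\<^sup>2 + b r / a" by simp
    with 1 have "a * (y r \<bullet> y r) + 2 * (y r \<bullet> drift r) \<le> b r / a"
      by (simp add: power2_norm_eq_inner[symmetric])
    then have "\<psi>' r \<le> exp (a * (r - t)) * (b r / a)" unfolding \<psi>'_def by (intro mult_left_mono) auto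
    \<comment> \<open>Replacing r by the endpoint s is harmless, because moments will be estimated
      on intervals of length at most one.\<close>
    also have "\<dots> \<le> exp (a * (s - t)) * (b r / a)"
      using r a by (intro mult_right_mono) (auto simp: b_def)
    finally show ?thesis by simp
  qed
  have "((\<lambda>r. exp (a * (s - t)) / a * b r) has_integral exp (a * (s - t)) / a * integral {t..s} b) {t..s}"
    by (intro has_integral_mult_right integrable_integral integrable_continuous_real bc)
  from has_integral_le[OF hi this le]
  have "\<psi> s \<le> \<psi> t + exp (a * (s - t)) / a * integral {t..s} b" by simp
  then have "exp (- a * (s - t)) * \<psi> s \<le> exp (- a * (s - t)) * (\<psi> t + exp (a * (s - t)) / a * integral {t..s} b)"
    by (intro mult_left_mono) auto
  also have "\<dots> = exp (- a * (s - t)) * \<psi> t + (exp (- a * (s - t)) * exp (a * (s - t))) * (integral {t..s} b / a)"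
    by (simp add: algebra_simps)
  also have "exp (- a * (s - t)) * exp (a * (s - t)) = 1" by (simp flip: exp_add)
  finally have "exp (- a * (s - t)) * \<psi> s \<le> exp (- a * (s - t)) * \<psi> t + integral {t..s} b / a" by simp
  moreover have "exp (- a * (s - t)) * \<psi> s = (norm (x s - n s))\<^sup>2"
    using ny[of s] ts by (simp add: \<psi>_def power2_norm_eq_inner mult.assoc[symmetric] flip: exp_add)
  moreover have "\<psi> t = (norm (x t))\<^sup>2" by (simp add: \<psi>_def y_def power2_norm_eq_inner)
  ultimately show ?thesis by (simp add: b_def[abs_def])
qed

text \<open>The hypotheses are stated for all times, not for one period, with one growth constant
  \<open>K\<close> and one natural exponent \<open>m\<close>, so that error bounds become
  polynomials in norms. The index k with start time \<open>T k\<close> keeps the constants uniform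
  over all starting points.\<close>

locale additive_sde = wiener M W for M :: "'w measure" and W :: "real \<Rightarrow> 'w \<Rightarrow> real ^ 'm::finite" +
  fixes A :: "real ^ 'd::finite ^ 'd" and f :: "real \<Rightarrow> real ^ 'd \<Rightarrow> real ^ 'd" and g :: "real \<Rightarrow> real ^ 'm ^ 'd"
    and Df :: "real \<Rightarrow> real ^ 'd \<Rightarrow> real ^ 'd \<Rightarrow> real ^ 'd"
    and a K :: real and m :: nat
    and T :: "'k \<Rightarrow> real" and \<xi> :: "'k \<Rightarrow> 'w \<Rightarrow> real ^ 'd" and X :: "'k \<Rightarrow> real \<Rightarrow> 'w \<Rightarrow> real ^ 'd"
  assumes complete: "complete_measure M"
    and a_pos: "0 < a" and K_pos: "0 < K"
    and f_cont: "continuous_on UNIV (\<lambda>(t, x). f t x)"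
    and dissip: "(x - y) \<bullet> (A *v (x - y) + f t x - f t y) \<le> - a * (norm (x - y))\<^sup>2"
    and f_lip: "norm (f t x - f t y) \<le> K * (1 + norm x + norm y) ^ m * norm (x - y)"
    and f_time: "norm (f t x - f s x) \<le> K * (1 + norm x) ^ m * \<bar>t - s\<bar>"
    and f_growth: "norm (f t x) \<le> K * (1 + norm x) ^ m"
    and Df_linear: "linear (Df t x)"
    and Df_bound: "norm (Df t x z) \<le> K * (1 + norm x) ^ m * norm z"
    and Df_cont: "continuous_on UNIV (\<lambda>x. Df t x z)"
    and Df_taylor: "norm (f t (x + z) - f t x - Df t x z) \<le> K * (1 + norm x + norm z) ^ m * (norm z)\<^sup>2"
    and A_bound: "norm (A *v x) \<le> K * norm x"
    and g_bound: "norm (g t) \<le> K" and g_lip: "norm (g t - g s) \<le> K * \<bar>t - s\<bar>"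
    and solution: "sde_solution M W A f g (T k) (\<xi> k) (X k)"
    and init_moments: "bdd_moments M UNIV \<xi>"
begin

definition drift :: "'k \<Rightarrow> real \<Rightarrow> 'w \<Rightarrow> real ^ 'd" where
  "drift k s \<omega> = A *v X k s \<omega> + f s (X k s \<omega>)"

text \<open>At fixed times this is almost surely an increment of the Wiener integral, by
  \<open>noise_wiener_integral\<close>. The pathwise formula makes it additive and continuous in s
  off one null set, which versions of the integral chosen separately for each time need not
  be.\<close>

definition noise :: "'k \<Rightarrow> real \<Rightarrow> real \<Rightarrow> 'w \<Rightarrow> real ^ 'd" where
  "noise k t s \<omega> = X k s \<omega> - X k t \<omega> - integral {t..s} (\<lambda>r. drift k r \<omega>)"

section \<open>Measurability of the solution and moments of its noise\<close>

lemma prob: "prob_space M"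
  by (rule prob_space_axioms)

lemma X_past_version:
  assumes "T k \<le> t"
  obtains Y where "Y \<in> borel_measurable (past t)" "AE \<omega> in M. X k t \<omega> = Y \<omega>"
  using solution[of k] assms unfolding sde_solution_def by blast

lemma X_measurable: "T k \<le> t \<Longrightarrow> X k t \<in> borel_measurable M"
  using X_past_version complete_measure.borel_measurable_AE_eq[OF complete] past_measurable by metis

lemma X_continuous: "AE \<omega> in M. continuous_on {T k..} (\<lambda>t. X k t \<omega>)"
  using solution[of k] unfolding sde_solution_def by blast

lemma f_cont_compose: "continuous_on S z \<Longrightarrow> continuous_on S (\<lambda>s. f s (z s))"
  using continuous_on_compose2[OF f_cont continuous_on_Pair[OF continuous_on_id]] by simp

lemma f_cont_state: "continuous_on UNIV (f t)"
  using continuous_on_compose2[OF f_cont continuous_on_Pair[OF continuous_on_const continuous_on_id]] by simp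

lemma A_cont_compose: "continuous_on S z \<Longrightarrow> continuous_on S (\<lambda>s. A *v z s)"
  by (rule continuous_on_compose2[of UNIV "\<lambda>x. A *v x"]) (auto intro!: continuous_intros)

lemma f_measurable: "Y \<in> borel_measurable N \<Longrightarrow> (\<lambda>\<omega>. f t (Y \<omega>)) \<in> borel_measurable N"
  by (rule borel_measurable_continuous_on[OF f_cont_state])

lemma A_measurable: "Y \<in> borel_measurable N \<Longrightarrow> (\<lambda>\<omega>. A *v Y \<omega>) \<in> borel_measurable N"
  by (rule borel_measurable_continuous_on[of "\<lambda>x. A *v x"]) (auto intro!: continuous_intros)

lemma drift_continuous: "AE \<omega> in M. continuous_on {T k..} (\<lambda>t. drift k t \<omega>)"
  using X_continuous[of k]
  by eventually_elim (auto simp: drift_def intro!: continuous_intros f_cont_compose A_cont_compose)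

lemma drift_measurable: "T k \<le> t \<Longrightarrow> drift k t \<in> borel_measurable M"
  unfolding drift_def[abs_def] by (intro borel_measurable_add f_measurable A_measurable X_measurable)

lemma drift_integral_measurable:
  assumes "T k \<le> t" "t \<le> s"
  shows "(\<lambda>\<omega>. integral {t..s} (\<lambda>r. drift k r \<omega>)) \<in> borel_measurable M"
proof (rule measurable_time_integral[OF complete assms(2)])
  show "AE \<omega> in M. continuous_on {t..s} (\<lambda>s. drift k s \<omega>)"
    using drift_continuous[of k] by eventually_elim (use assms in \<open>auto elim: continuous_on_subset\<close>)
qed (use assms in \<open>auto intro: drift_measurable\<close>)

lemma noise_measurable: "T k \<le> t \<Longrightarrow> t \<le> s \<Longrightarrow> noise k t s \<in> borel_measurable M"
  unfolding noise_def[abs_def] by (intro borel_measurable_diff X_measurable drift_integral_measurable) auto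

lemma noise_diff:
  assumes "T k \<le> t" "t \<le> u" "u \<le> s" "continuous_on {T k..} (\<lambda>r. drift k r \<omega>)"
  shows "noise k t s \<omega> - noise k t u \<omega> = noise k u s \<omega>"
proof -
  have "(\<lambda>r. drift k r \<omega>) integrable_on {t..s}"
    by (intro integrable_continuous_real continuous_on_subset[OF assms(4)]) (use assms in auto)
  from Henstock_Kurzweil_Integration.integral_combine[OF assms(2,3) this]
  show ?thesis by (simp add: noise_def algebra_simps)
qed

lemma noise_continuous:
  assumes "T k \<le> t" "continuous_on {T k..} (\<lambda>r. X k r \<omega>)"
  shows "continuous_on {t..s} (\<lambda>r. noise k t r \<omega>)"
proof -
  have "continuous_on {T k..} (\<lambda>r. drift k r \<omega>)"
    unfolding drift_def by (intro continuous_intros f_cont_compose A_cont_compose assms)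
  then have "(\<lambda>r. drift k r \<omega>) integrable_on {t..s}"
    by (intro integrable_continuous_real, elim continuous_on_subset) (use assms in auto)
  then have "continuous_on {t..s} (\<lambda>r. integral {t..r} (\<lambda>r. drift k r \<omega>))"
    by (rule indefinite_integral_continuous_1)
  moreover have "continuous_on {t..s} (\<lambda>r. X k r \<omega>)" by (rule continuous_on_subset[OF assms(2)]) (use assms in auto)
  ultimately show ?thesis unfolding noise_def by (intro continuous_intros)
qed

lemma noise_wiener_integral:
  assumes "T k \<le> t" "t \<le> s"
  obtains I I' where "has_wiener_integral M W (T k) t g I" "has_wiener_integral M W (T k) s g I'"
    "AE \<omega> in M. noise k t s \<omega> = I' \<omega> - I \<omega>"
proof -
  obtain I where I: "has_wiener_integral M W (T k) t g I" "AE \<omega> in M. X k t \<omega> =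
           \<xi> k \<omega> + integral {T k..t} (\<lambda>s. A *v X k s \<omega> + f s (X k s \<omega>)) + I \<omega>"
    using solution[of k] assms unfolding sde_solution_def by blast
  obtain I' where I': "has_wiener_integral M W (T k) s g I'" "AE \<omega> in M. X k s \<omega> =
           \<xi> k \<omega> + integral {T k..s} (\<lambda>s. A *v X k s \<omega> + f s (X k s \<omega>)) + I' \<omega>"
    using solution[of k] assms unfolding sde_solution_def by (meson order.trans)
  have "AE \<omega> in M. noise k t s \<omega> = I' \<omega> - I \<omega>"
    using I(2) I'(2) drift_continuous[of k]
  proof eventually_elim
    case (elim \<omega>)
    have "(\<lambda>r. drift k r \<omega>) integrable_on {T k..s}"
      by (intro integrable_continuous_real continuous_on_subset[OF elim(3)]) auto
    from Henstock_Kurzweil_Integration.integral_combine[OF assms this] elim(1,2)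
    show ?case by (simp add: noise_def drift_def algebra_simps)
  qed
  then show ?thesis using that I(1) I'(1) by blast
qed

lemma past_orthogonal_AE_cong:
  fixes Y Z :: "'w \<Rightarrow> real ^ 'n"
  assumes "past_orthogonal t Y" "AE \<omega> in M. Z \<omega> = Y \<omega>"
  shows "past_orthogonal t Z"
proof -
  have Z: "Z \<in> borel_measurable M"
    using assms by (auto simp: past_orthogonal_def intro: complete_measure.borel_measurable_AE_eq[OF complete])
  have Y: "Y \<in> borel_measurable M" using assms by (simp add: past_orthogonal_def)
  show ?thesis
    unfolding past_orthogonal_def
  proof (intro conjI impI allI Z)
    have "integrable M (\<lambda>\<omega>. (norm (Y \<omega>))\<^sup>2)" using assms by (simp add: past_orthogonal_def)
    then show "integrable M (\<lambda>\<omega>. (norm (Z \<omega>))\<^sup>2)"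
      by (rule integrable_cong_AE_imp) (use Z assms(2) in \<open>auto elim!: eventually_mono\<close>)
    fix U :: "'w \<Rightarrow> real" and i assume U: "U \<in> borel_measurable (past t)" "integrable M (\<lambda>\<omega>. (U \<omega>)\<^sup>2)"
    have [measurable]: "U \<in> borel_measurable M" by (rule past_measurable[OF U(1)])
    have [measurable]: "(\<lambda>\<omega>. Z \<omega> $ i) \<in> borel_measurable M" "(\<lambda>\<omega>. Y \<omega> $ i) \<in> borel_measurable M"
      using measurable_compose[OF Z borel_measurable_vec_nth] measurable_compose[OF Y borel_measurable_vec_nth] by auto
    have "(\<integral>\<omega>. U \<omega> * Z \<omega> $ i \<partial>M) = (\<integral>\<omega>. U \<omega> * Y \<omega> $ i \<partial>M)"
      by (rule Bochner_Integration.integral_cong_AE) (use assms(2) in \<open>auto elim!: eventually_mono\<close>)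
    then show "(\<integral>\<omega>. U \<omega> * Z \<omega> $ i \<partial>M) = 0" using assms(1) U by (simp add: past_orthogonal_def)
  qed
qed

lemma noise_orthogonal:
  assumes "T k \<le> t" "t \<le> s"
  shows "past_orthogonal t (noise k t s)"
proof (cases "t = s")
  case True
  then show ?thesis using past_orthogonal_zero by (simp add: noise_def[abs_def] past_orthogonal_def)
next
  case False
  obtain I I' where I: "has_wiener_integral M W (T k) t g I" "has_wiener_integral M W (T k) s g I'"
    "AE \<omega> in M. noise k t s \<omega> = I' \<omega> - I \<omega>" using noise_wiener_integral[OF assms] .
  show ?thesis
    by (rule past_orthogonal_AE_cong[OF wiener_integral_increment_orthogonal[OF I(1,2) _ _ g_lip K_pos] I(3)])
       (use assms False in auto)
qed

lemma noise_moment: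
  assumes "T k \<le> t" "t \<le> s" and q: "1 \<le> q"
  shows "(\<integral>\<^sup>+ \<omega>. ennreal (norm (noise k t s \<omega>) ^ q) \<partial>M) \<le> ennreal (gauss_const CARD('d) q * (K * sqrt (s - t)) ^ q)"
proof (cases "t = s")
  case True
  then show ?thesis using q by (simp add: noise_def power_0_left)
next
  case False
  obtain I I' where I: "has_wiener_integral M W (T k) t g I" "has_wiener_integral M W (T k) s g I'"
    "AE \<omega> in M. noise k t s \<omega> = I' \<omega> - I \<omega>" using noise_wiener_integral[OF assms(1,2)] .
  have "(\<integral>\<^sup>+ \<omega>. ennreal (norm (noise k t s \<omega>) ^ q) \<partial>M) = (\<integral>\<^sup>+ \<omega>. ennreal (norm (I' \<omega> - I \<omega>) ^ q) \<partial>M)"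
    by (rule nn_integral_cong_AE) (use I(3) in \<open>auto elim!: eventually_mono\<close>)
  also have "\<dots> \<le> ennreal (gauss_const CARD('d) q * (K * sqrt (s - t)) ^ q)"
    by (rule wiener_integral_increment_moment[OF I(1,2) _ _ g_lip K_pos g_bound K_pos q]) (use assms False in auto)
  finally show ?thesis .
qed

lemma frozen_noise_moment:
  assumes "T k \<le> t" "t < s" and q: "1 \<le> q"
  shows "(\<integral>\<^sup>+ \<omega>. ennreal (norm (noise k t s \<omega> - g t *v (W s \<omega> - W t \<omega>)) ^ q) \<partial>M)
    \<le> ennreal (gauss_const CARD('d) q * (K * (s - t) * sqrt (s - t)) ^ q)"
proof -
  obtain I I' where I: "has_wiener_integral M W (T k) t g I" "has_wiener_integral M W (T k) s g I'"
    "AE \<omega> in M. noise k t s \<omega> = I' \<omega> - I \<omega>" using noise_wiener_integral[of k t s] assms by auto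
  have "(\<integral>\<^sup>+ \<omega>. ennreal (norm (noise k t s \<omega> - g t *v (W s \<omega> - W t \<omega>)) ^ q) \<partial>M)
     = (\<integral>\<^sup>+ \<omega>. ennreal (norm (I' \<omega> - I \<omega> - g t *v (W s \<omega> - W t \<omega>)) ^ q) \<partial>M)"
    by (rule nn_integral_cong_AE) (use I(3) in \<open>auto elim!: eventually_mono\<close>)
  also have "\<dots> \<le> ennreal (gauss_const CARD('d) q * (K * (s - t) * sqrt (s - t)) ^ q)"
    by (rule wiener_integral_frozen_moment[OF I(1,2) assms(1,2) g_lip K_pos q])
  finally show ?thesis .
qed

text \<open>Length at most one keeps the noise and the forcing term of the path estimate uniformly
  bounded in moments; longer times are reached by iteration.\<close>

definition unit_steps :: "('k \<times> real \<times> real) set" where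
  "unit_steps = {(k, t, s). T k \<le> t \<and> t \<le> s \<and> s \<le> t + 1}"

lemma noise_bdd: "bdd_moments M unit_steps (\<lambda>(k, t, s). noise k t s)"
  unfolding bdd_moments_def
proof (intro conjI ballI allI impI)
  fix i assume "i \<in> unit_steps"
  then show "(case i of (k, t, s) \<Rightarrow> noise k t s) \<in> borel_measurable M"
    by (auto simp: unit_steps_def intro: noise_measurable)
next
  fix p :: nat assume p: "1 \<le> p"
  show "\<exists>L\<ge>0. \<forall>i\<in>unit_steps. (\<integral>\<^sup>+ \<omega>. ennreal (norm ((case i of (k, t, s) \<Rightarrow> noise k t s) \<omega>) ^ p) \<partial>M) \<le> ennreal L"
  proof (intro exI[of _ "gauss_const CARD('d) p * K ^ p"] conjI ballI)
    fix i assume "i \<in> unit_steps"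
    then obtain k t s where i: "i = (k, t, s)" "T k \<le> t" "t \<le> s" "s \<le> t + 1" by (auto simp: unit_steps_def)
    have "(\<integral>\<^sup>+ \<omega>. ennreal (norm (noise k t s \<omega>) ^ p) \<partial>M) \<le> ennreal (gauss_const CARD('d) p * (K * sqrt (s - t)) ^ p)"
      by (rule noise_moment[OF i(2,3) p])
    also have "\<dots> \<le> ennreal (gauss_const CARD('d) p * (K * 1) ^ p)"
      using i K_pos by (intro ennreal_leI mult_left_mono power_mono gauss_const_nonneg) auto
    finally show "(\<integral>\<^sup>+ \<omega>. ennreal (norm ((case i of (k, t, s) \<Rightarrow> noise k t s) \<omega>) ^ p) \<partial>M) \<le> ennreal (gauss_const CARD('d) p * K ^ p)"
      by (simp add: i)
  qed (use gauss_const_nonneg K_pos in auto)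
qed

lemma f_norm_bdd:
  assumes Z: "bdd_moments M S Z"
  shows "bdd_moments M S (\<lambda>i \<omega>. A *v Z i \<omega> + f (\<tau> i) (Z i \<omega>))"
proof (rule bdd_moments_dominated)
  show "bdd_moments M S (\<lambda>i \<omega>. K * norm (Z i \<omega>) + K * (1 + norm (Z i \<omega>)) ^ m)"
    by (intro bdd_moments_add bdd_moments_mult bdd_moments_const bdd_moments_power bdd_moments_norm Z prob)
  show "AE \<omega> in M. norm (A *v Z i \<omega> + f (\<tau> i) (Z i \<omega>)) \<le> norm (K * norm (Z i \<omega>) + K * (1 + norm (Z i \<omega>)) ^ m)" for i
    using A_bound f_growth K_pos by (intro AE_I2) (auto intro!: order.trans[OF norm_triangle_ineq] add_mono)
qed (intro borel_measurable_add f_measurable A_measurable bdd_momentsD[OF Z])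

definition forcing :: "'k \<Rightarrow> real \<Rightarrow> real \<Rightarrow> 'w \<Rightarrow> real" where
  "forcing k t s \<omega> = (1 / a) * integral {t..s} (\<lambda>r. (norm (A *v noise k t r \<omega> + f r (noise k t r \<omega>)))\<^sup>2)"

lemma forcing_nonneg: "0 \<le> forcing k t s \<omega>"
proof -
  let ?b = "\<lambda>r. (norm (A *v noise k t r \<omega> + f r (noise k t r \<omega>)))\<^sup>2"
  \<comment> \<open>Where the integrand fails to be integrable the integral is 0 by
    convention.\<close>
  have "0 \<le> integral {t..s} ?b"
    by (cases "?b integrable_on {t..s}")
       (auto intro: Henstock_Kurzweil_Integration.integral_nonneg simp: not_integrable_integral)
  then show ?thesis using a_pos by (simp add: forcing_def)
qed

lemma forcing_bdd: "bdd_moments M unit_steps (\<lambda>(k, t, s). forcing k t s)"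
proof -
  define \<Phi> where "\<Phi> i r \<omega> = (case i of (k, t, s) \<Rightarrow> (norm (A *v noise k t r \<omega> + f r (noise k t r \<omega>)))\<^sup>2)"
    for i :: "'k \<times> real \<times> real" and r \<omega>
  let ?a = "\<lambda>i :: 'k \<times> real \<times> real. fst (snd i)" and ?b = "\<lambda>i :: 'k \<times> real \<times> real. snd (snd i)"
  have avg: "bdd_moments M unit_steps (\<lambda>i \<omega>. (1 / 1) *\<^sub>R integral {?a i..?b i} (\<lambda>r. \<Phi> i r \<omega>))"
  proof (rule bdd_moments_time_average[OF complete])
    fix i :: "'k \<times> real \<times> real" assume i: "i \<in> unit_steps"
    obtain k t s where i': "i = (k, t, s)" "T k \<le> t" "t \<le> s" "s \<le> t + 1" using i by (auto simp: unit_steps_def)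
    show "?a i \<le> ?b i \<and> ?b i - ?a i \<le> 1" using i' by simp
    show "AE \<omega> in M. continuous_on {?a i..?b i} (\<lambda>r. \<Phi> i r \<omega>)"
      using X_continuous[of k]
    proof eventually_elim
      case (elim \<omega>)
      have "continuous_on {t..s} (\<lambda>r. noise k t r \<omega>)" by (rule noise_continuous[OF i'(2) elim])
      then show ?case unfolding \<Phi>_def i' by (auto intro!: continuous_intros A_cont_compose f_cont_compose)
    qed
  next
    let ?S = "SIGMA i:unit_steps. {?a i..?b i}"
    have nb: "bdd_moments M ?S (\<lambda>j. noise (fst (fst j)) (fst (snd (fst j))) (snd j))"
      using bdd_moments_reindex[OF noise_bdd, of ?S "\<lambda>j. (fst (fst j), fst (snd (fst j)), snd j)"]
      by (force simp: unit_steps_def)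
    have eq: "(\<lambda>(i, r). \<Phi> i r) = (\<lambda>j \<omega>. (norm (A *v noise (fst (fst j)) (fst (snd (fst j))) (snd j) \<omega> +
        f (snd j) (noise (fst (fst j)) (fst (snd (fst j))) (snd j) \<omega>)))\<^sup>2)"
      by (auto simp: \<Phi>_def fun_eq_iff split: prod.splits)
    show "bdd_moments M ?S (\<lambda>(i, r). \<Phi> i r)"
      unfolding eq by (intro bdd_moments_power prob bdd_moments_norm f_norm_bdd nb)
  qed simp
  have "bdd_moments M unit_steps (\<lambda>i \<omega>. (1 / a) * ((1 / 1) *\<^sub>R integral {?a i..?b i} (\<lambda>r. \<Phi> i r \<omega>)))"
    by (intro bdd_moments_mult bdd_moments_const prob avg)
  moreover have "(\<lambda>i \<omega>. (1 / a) * ((1 / 1) *\<^sub>R integral {?a i..?b i} (\<lambda>r. \<Phi> i r \<omega>))) = (\<lambda>(k, t, s). forcing k t s)"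
    by (auto simp: fun_eq_iff \<Phi>_def forcing_def)
  ultimately show ?thesis by simp
qed

lemma path_bound:
  assumes "T k \<le> t" "t \<le> s"
  shows "AE \<omega> in M. (norm (X k s \<omega> - noise k t s \<omega>))\<^sup>2 \<le> exp (- a * (s - t)) * (norm (X k t \<omega>))\<^sup>2 + forcing k t s \<omega>"
  using X_continuous[of k]
proof eventually_elim
  case (elim \<omega>)
  show ?case
    unfolding forcing_def
    by (rule dissipative_path_bound[OF a_pos assms(2) f_cont dissip])
       (use assms elim in \<open>auto simp: noise_def drift_def intro: continuous_on_subset\<close>)
qed

lemma weighted_square_sum:
  fixes x y :: "'e::real_normed_vector"
  assumes "0 < \<epsilon>"
  shows "(norm x)\<^sup>2 \<le> (1 + \<epsilon>) * (norm (x - y))\<^sup>2 + (1 + 1 / \<epsilon>) * (norm y)\<^sup>2"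
proof -
  have "norm x \<le> norm (x - y) + norm y" using norm_triangle_ineq[of "x - y" y] by simp
  then have "(norm x)\<^sup>2 \<le> (norm (x - y) + norm y)\<^sup>2" by (intro power_mono) auto
  also have "\<dots> \<le> (1 + \<epsilon>) * (norm (x - y))\<^sup>2 + (1 + 1 / \<epsilon>) * (norm y)\<^sup>2"
  proof -
    have "0 \<le> (\<epsilon> * norm (x - y) - norm y)\<^sup>2 / \<epsilon>" using assms by simp
    also have "\<dots> = \<epsilon> * (norm (x - y))\<^sup>2 - 2 * (norm (x - y) * norm y) + (norm y)\<^sup>2 / \<epsilon>"
      using assms by (simp add: power2_diff power_mult_distrib field_simps power2_eq_square)
    finally show ?thesis by (simp add: power2_sum algebra_simps)
  qed
  finally show ?thesis .
qed

text \<open>Over a unit of time the path estimate multiplies |X|^2 by a factor below one and adds a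
  term with bounded moments. The moments of order 2p, taken at unit distance, then satisfy e_(n+1)
  <= \<theta> e_n + K2, a recursion with bounded solutions. A general time is a fractional first
  step followed by whole units.\<close>

lemma X_bdd: "bdd_moments M {(k, t). T k \<le> t} (\<lambda>(k, t). X k t)"
proof (rule bdd_moments_even[OF _ prob])
  fix i assume "i \<in> {(k, t). T k \<le> t}"
  then show "(case i of (k, t) \<Rightarrow> X k t) \<in> borel_measurable M" by (auto intro: X_measurable)
next
  fix p :: nat assume p: "1 \<le> p"
  \<comment> \<open>Passing from X - N to X costs the factor 1 + \<epsilon>, chosen to use up half
    of the decay: (1 + \<epsilon>) e^(-a) = e^(-a/2) = \<theta>.\<close>
  define \<epsilon> where "\<epsilon> = exp (a / 2) - 1"
  have \<epsilon>: "0 < \<epsilon>" using a_pos by (simp add: \<epsilon>_def)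
  define \<theta> where "\<theta> = exp (- a / 2)"
  have \<theta>: "0 < \<theta>" "\<theta> < 1" using a_pos by (auto simp: \<theta>_def)
  have \<theta>\<epsilon>: "(1 + \<epsilon>) * exp (- a) = \<theta>" by (simp add: \<epsilon>_def \<theta>_def flip: exp_add)
  define B where "B = (\<lambda>(k, t, s) \<omega>. (1 + \<epsilon>) * forcing k t s \<omega> + (1 + 1 / \<epsilon>) * (norm (noise k t s \<omega>))\<^sup>2)"
  have "bdd_moments M unit_steps (\<lambda>i \<omega>. (1 + \<epsilon>) * (case i of (k, t, s) \<Rightarrow> forcing k t s) \<omega>
      + (1 + 1 / \<epsilon>) * (norm ((case i of (k, t, s) \<Rightarrow> noise k t s) \<omega>))\<^sup>2)"
    by (intro bdd_moments_add bdd_moments_mult bdd_moments_const prob bdd_moments_power bdd_moments_norm forcing_bdd noise_bdd)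
  then have Bb: "bdd_moments M unit_steps B" by (simp add: B_def split_def)
  have B0: "0 \<le> B (k, t, s) \<omega>" for k t s \<omega>
    using \<epsilon> forcing_nonneg unfolding B_def by (auto intro!: add_nonneg_nonneg)
  have step: "AE \<omega> in M. (norm (X k s \<omega>))\<^sup>2 \<le> (1 + \<epsilon>) * exp (- a * (s - t)) * (norm (X k t \<omega>))\<^sup>2 + B (k, t, s) \<omega>"
    if "T k \<le> t" "t \<le> s" for k t s
    using path_bound[OF that]
  proof eventually_elim
    case (elim \<omega>)
    have "(norm (X k s \<omega>))\<^sup>2 \<le> (1 + \<epsilon>) * (norm (X k s \<omega> - noise k t s \<omega>))\<^sup>2 + (1 + 1 / \<epsilon>) * (norm (noise k t s \<omega>))\<^sup>2"
      by (rule weighted_square_sum[OF \<epsilon>])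
    also have "(1 + \<epsilon>) * (norm (X k s \<omega> - noise k t s \<omega>))\<^sup>2 \<le>
        (1 + \<epsilon>) * (exp (- a * (s - t)) * (norm (X k t \<omega>))\<^sup>2 + forcing k t s \<omega>)"
      using \<epsilon> elim by (intro mult_left_mono) auto
    finally show ?case by (simp add: B_def algebra_simps)
  qed
  obtain KB where KB: "0 \<le> KB" "\<And>i. i \<in> unit_steps \<Longrightarrow> (\<integral>\<^sup>+ \<omega>. ennreal (norm (B i \<omega>) ^ p) \<partial>M) \<le> ennreal KB"
    using bdd_momentsE[OF Bb p] by metis
  obtain K\<xi> where K\<xi>: "0 \<le> K\<xi>" "\<And>k. (\<integral>\<^sup>+ \<omega>. ennreal (norm (\<xi> k \<omega>) ^ (2 * p)) \<partial>M) \<le> ennreal K\<xi>"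
    using bdd_momentsE[OF init_moments, of "2 * p"] p by (metis UNIV_I mult_le_mono nat_mult_1 one_le_numeral)
  \<comment> \<open>\<theta>' is the convexity weight and c the remaining factor. Whole units take
    \<theta> and c = 1; the fractional step, where no decay is available, takes 1/2 and c = 2 (1 +
    \<epsilon>).\<close>
  have power_step: "(\<integral>\<^sup>+ \<omega>. ennreal (norm (X k s \<omega>) ^ (2 * p)) \<partial>M) \<le>
      ennreal (\<theta>' * c ^ p) * (\<integral>\<^sup>+ \<omega>. ennreal (norm (X k t \<omega>) ^ (2 * p)) \<partial>M) + ennreal (KB / (1 - \<theta>') ^ (p - 1))"
    if ks: "T k \<le> t" "t \<le> s" "s \<le> t + 1" and c: "(1 + \<epsilon>) * exp (- a * (s - t)) \<le> \<theta>' * c" "0 \<le> c" and \<theta>': "0 < \<theta>'" "\<theta>' < 1"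
    for k t s c \<theta>'
  proof -
    have us: "(k, t, s) \<in> unit_steps" using ks by (simp add: unit_steps_def)
    have [measurable]: "X k t \<in> borel_measurable M" "B (k, t, s) \<in> borel_measurable M"
      using X_measurable[OF ks(1)] bdd_momentsD[OF Bb us] by auto
    have "(\<integral>\<^sup>+ \<omega>. ennreal (norm (X k s \<omega>) ^ (2 * p)) \<partial>M) \<le>
      (\<integral>\<^sup>+ \<omega>. ennreal (\<theta>' * c ^ p) * ennreal (norm (X k t \<omega>) ^ (2 * p)) + ennreal (1 / (1 - \<theta>') ^ (p - 1)) * ennreal (norm (B (k, t, s) \<omega>) ^ p) \<partial>M)"
    proof (rule nn_integral_mono_AE)
      show "AE \<omega> in M. ennreal (norm (X k s \<omega>) ^ (2 * p)) \<le>
        ennreal (\<theta>' * c ^ p) * ennreal (norm (X k t \<omega>) ^ (2 * p)) + ennreal (1 / (1 - \<theta>') ^ (p - 1)) * ennreal (norm (B (k, t, s) \<omega>) ^ p)"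
        using step[OF ks(1,2)]
      proof eventually_elim
        case (elim \<omega>)
        have "(1 + \<epsilon>) * exp (- a * (s - t)) * (norm (X k t \<omega>))\<^sup>2 \<le> \<theta>' * c * (norm (X k t \<omega>))\<^sup>2"
          by (intro mult_right_mono c) auto
        then have le: "(norm (X k s \<omega>))\<^sup>2 \<le> \<theta>' * (c * (norm (X k t \<omega>))\<^sup>2) + B (k, t, s) \<omega>"
          using elim by simp
        have "norm (X k s \<omega>) ^ (2 * p) = ((norm (X k s \<omega>))\<^sup>2) ^ p" by (simp add: power_mult)
        also have "\<dots> \<le> (\<theta>' * (c * (norm (X k t \<omega>))\<^sup>2) + B (k, t, s) \<omega>) ^ p"
          using le by (intro power_mono) auto
        also have "\<dots> \<le> \<theta>' * (c * (norm (X k t \<omega>))\<^sup>2) ^ p + B (k, t, s) \<omega> ^ p / (1 - \<theta>') ^ (p - 1)"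
          using c \<theta>' p B0 by (intro power_add_weighted) auto
        also have "\<dots> = \<theta>' * c ^ p * norm (X k t \<omega>) ^ (2 * p) + 1 / (1 - \<theta>') ^ (p - 1) * norm (B (k, t, s) \<omega>) ^ p"
          using B0 by (simp add: power_mult_distrib power_mult)
        finally have "ennreal (norm (X k s \<omega>) ^ (2 * p)) \<le>
            ennreal (\<theta>' * c ^ p * norm (X k t \<omega>) ^ (2 * p) + 1 / (1 - \<theta>') ^ (p - 1) * norm (B (k, t, s) \<omega>) ^ p)"
          by (rule ennreal_leI)
        also have "\<dots> = ennreal (\<theta>' * c ^ p) * ennreal (norm (X k t \<omega>) ^ (2 * p)) + ennreal (1 / (1 - \<theta>') ^ (p - 1)) * ennreal (norm (B (k, t, s) \<omega>) ^ p)"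
          using \<theta>' c by (subst ennreal_plus) (auto simp: ennreal_mult[symmetric])
        finally show ?case .
      qed
    qed
    also have "\<dots> = ennreal (\<theta>' * c ^ p) * (\<integral>\<^sup>+ \<omega>. ennreal (norm (X k t \<omega>) ^ (2 * p)) \<partial>M)
        + ennreal (1 / (1 - \<theta>') ^ (p - 1)) * (\<integral>\<^sup>+ \<omega>. ennreal (norm (B (k, t, s) \<omega>) ^ p) \<partial>M)"
      by (subst nn_integral_add, measurable, subst nn_integral_cmult, measurable, subst nn_integral_cmult, measurable)
    also have "\<dots> \<le> ennreal (\<theta>' * c ^ p) * (\<integral>\<^sup>+ \<omega>. ennreal (norm (X k t \<omega>) ^ (2 * p)) \<partial>M)
        + ennreal (1 / (1 - \<theta>') ^ (p - 1)) * ennreal KB"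
      by (intro add_left_mono mult_left_mono KB us) auto
    also have "ennreal (1 / (1 - \<theta>') ^ (p - 1)) * ennreal KB = ennreal (KB / (1 - \<theta>') ^ (p - 1))"
      using \<theta>' KB(1) by (simp flip: ennreal_mult)
    finally show ?thesis .
  qed
  define K1 where "K1 = (1/2) * (2 * (1 + \<epsilon>)) ^ p * K\<xi> + KB / (1 - 1/2) ^ (p - 1)"
  define K2 where "K2 = KB / (1 - \<theta>) ^ (p - 1)"
  \<comment> \<open>K2 / (1 - \<theta>) is the fixed point of u -> \<theta> u + K2; adding the
    initial bound K1 keeps the recursion below \<open>KK\<close> from the start on.\<close>
  define KK where "KK = K1 + K2 / (1 - \<theta>)"
  have K12: "0 \<le> K1" "0 \<le> K2" using KB K\<xi> \<epsilon> \<theta> by (auto simp: K1_def K2_def)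
  have KK: "K1 \<le> KK" "\<theta> * KK + K2 \<le> KK" "0 \<le> KK"
  proof -
    have "0 \<le> K2 / (1 - \<theta>)" using K12 \<theta> by simp
    then show "K1 \<le> KK" "0 \<le> KK" using K12 by (auto simp: KK_def)
    have "K2 = (1 - \<theta>) * (K2 / (1 - \<theta>))" using \<theta> by simp
    also have "\<dots> \<le> (1 - \<theta>) * KK" using \<theta> K12 by (intro mult_left_mono) (auto simp: KK_def)
    finally show "\<theta> * KK + K2 \<le> KK" by (simp add: algebra_simps)
  qed
  have initial: "(\<integral>\<^sup>+ \<omega>. ennreal (norm (X k (T k + r) \<omega>) ^ (2 * p)) \<partial>M) \<le> ennreal K1" if "0 \<le> r" "r \<le> 1" for k r
  proof -
    have "exp (- a * (T k + r - T k)) \<le> 1" using that a_pos by simp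
    then have "(1 + \<epsilon>) * exp (- a * (T k + r - T k)) \<le> (1 + \<epsilon>) * 1" using \<epsilon> by (intro mult_left_mono) auto
    then have le: "(1 + \<epsilon>) * exp (- a * (T k + r - T k)) \<le> 1/2 * (2 * (1 + \<epsilon>))" by simp
    have X0: "AE \<omega> in M. X k (T k) \<omega> = \<xi> k \<omega>" using solution[of k] unfolding sde_solution_def by blast
    have "(\<integral>\<^sup>+ \<omega>. ennreal (norm (X k (T k) \<omega>) ^ (2 * p)) \<partial>M) = (\<integral>\<^sup>+ \<omega>. ennreal (norm (\<xi> k \<omega>) ^ (2 * p)) \<partial>M)"
      by (rule nn_integral_cong_AE) (use X0 in \<open>auto elim!: eventually_mono\<close>)
    then have X0m: "(\<integral>\<^sup>+ \<omega>. ennreal (norm (X k (T k) \<omega>) ^ (2 * p)) \<partial>M) \<le> ennreal K\<xi>" using K\<xi>(2) by simp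
    have "(\<integral>\<^sup>+ \<omega>. ennreal (norm (X k (T k + r) \<omega>) ^ (2 * p)) \<partial>M) \<le>
       ennreal (1/2 * (2 * (1 + \<epsilon>)) ^ p) * (\<integral>\<^sup>+ \<omega>. ennreal (norm (X k (T k) \<omega>) ^ (2 * p)) \<partial>M) + ennreal (KB / (1 - 1/2) ^ (p - 1))"
      by (rule power_step[OF _ _ _ le]) (use that \<epsilon> in auto)
    also have "\<dots> \<le> ennreal (1/2 * (2 * (1 + \<epsilon>)) ^ p) * ennreal K\<xi> + ennreal (KB / (1 - 1/2) ^ (p - 1))"
      by (intro add_right_mono mult_left_mono X0m) auto
    also have "\<dots> = ennreal K1"
      unfolding K1_def using KB K\<xi> \<epsilon> by (subst ennreal_plus) (auto simp: ennreal_mult[symmetric])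
    finally show ?thesis .
  qed
  have main: "(\<integral>\<^sup>+ \<omega>. ennreal (norm (X k (T k + r + real n) \<omega>) ^ (2 * p)) \<partial>M) \<le> ennreal KK" if "0 \<le> r" "r \<le> 1" for k r n
  proof (induction n)
    case 0
    show ?case using order.trans[OF initial[OF that] ennreal_leI[OF KK(1)]] by simp
  next
    case (Suc n)
    have le: "(1 + \<epsilon>) * exp (- a * (T k + r + real (Suc n) - (T k + r + real n))) \<le> \<theta> * 1" using \<theta>\<epsilon> by simp
    have "(\<integral>\<^sup>+ \<omega>. ennreal (norm (X k (T k + r + real (Suc n)) \<omega>) ^ (2 * p)) \<partial>M) \<le>
      ennreal (\<theta> * 1 ^ p) * (\<integral>\<^sup>+ \<omega>. ennreal (norm (X k (T k + r + real n) \<omega>) ^ (2 * p)) \<partial>M) + ennreal (KB / (1 - \<theta>) ^ (p - 1))"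
      by (rule power_step[OF _ _ _ le]) (use that \<theta> in auto)
    also have "\<dots> \<le> ennreal (\<theta> * 1 ^ p) * ennreal KK + ennreal (KB / (1 - \<theta>) ^ (p - 1))"
      by (intro add_right_mono mult_left_mono Suc) auto
    also have "\<dots> = ennreal (\<theta> * KK + K2)"
      unfolding K2_def[symmetric] using \<theta> KK(3) K12 by (subst ennreal_plus) (auto simp: ennreal_mult)
    also have "\<dots> \<le> ennreal KK" by (intro ennreal_leI KK)
    finally show ?case .
  qed
  show "\<exists>L\<ge>0. \<forall>i\<in>{(k, t). T k \<le> t}. (\<integral>\<^sup>+ \<omega>. ennreal (norm ((case i of (k, t) \<Rightarrow> X k t) \<omega>) ^ (2 * p)) \<partial>M) \<le> ennreal L"
  proof (intro exI[of _ KK] conjI ballI KK)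
    fix i assume "i \<in> {(k, t). T k \<le> t}"
    then obtain k t where i: "i = (k, t)" "T k \<le> t" by auto
    define n where "n = nat \<lfloor>t - T k\<rfloor>"
    have n: "real n = of_int \<lfloor>t - T k\<rfloor>" using i by (simp add: n_def)
    define r where "r = t - T k - real n"
    have r: "0 \<le> r" "r \<le> 1" "T k + r + real n = t" unfolding r_def n by linarith+
    show "(\<integral>\<^sup>+ \<omega>. ennreal (norm ((case i of (k, t) \<Rightarrow> X k t) \<omega>) ^ (2 * p)) \<partial>M) \<le> ennreal KK"
      using main[OF r(1,2), of k n] r(3) by (simp add: i)
  qed
qed

end

section \<open>The local error\<close>

lemma norm_proj_le: "norm (proj \<gamma> h x) \<le> norm x"
proof -
  have "0 \<le> min 1 (h powr (- (1 / (2 * \<gamma>))) * inverse (norm x))" by simp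
  then show ?thesis by (auto simp: proj_def min_le_iff_disj intro!: mult_left_le_one_le)
qed

lemma norm_proj_bound: "norm (proj \<gamma> h x) \<le> h powr (- (1 / (2 * \<gamma>)))"
proof (cases "x = 0")
  case False
  then have "norm (proj \<gamma> h x) = min 1 (h powr (- (1 / (2 * \<gamma>))) * inverse (norm x)) * norm x"
    by (simp add: proj_def)
  also have "\<dots> \<le> (h powr (- (1 / (2 * \<gamma>))) * inverse (norm x)) * norm x"
    by (intro mult_right_mono) auto
  also have "\<dots> = h powr (- (1 / (2 * \<gamma>)))" using False by (simp only: mult.assoc) simp
  finally show ?thesis .
qed (simp add: proj_def)

text \<open>A point is moved only if its norm exceeds h^(-1/(2 \<gamma>)); then its n-th power is at
  least h^(-n/(2 \<gamma>)) >= h^(-2) once n >= 4 \<gamma>. Extra powers of the norm thus buy h^2,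
  and the moments of the solution pay for them.\<close>

lemma proj_error:
  assumes \<gamma>: "1 \<le> \<gamma>" and h: "0 < h" "h < 1" and n: "4 * \<gamma> \<le> real n"
  shows "norm (x - proj \<gamma> h x) \<le> norm x ^ Suc n * h\<^sup>2"
proof (cases "x = 0 \<or> norm x \<le> h powr (- (1 / (2 * \<gamma>)))")
  case True
  then have "x = proj \<gamma> h x"
    by (auto simp: proj_def min_def field_simps)
  then show ?thesis by simp
next
  case False
  define c where "c = min 1 (h powr (- (1 / (2 * \<gamma>))) * inverse (norm x))"
  have c: "0 \<le> c" "c \<le> 1" by (auto simp: c_def)
  have "x - proj \<gamma> h x = (1 - c) *\<^sub>R x" using False by (simp add: proj_def c_def algebra_simps)
  then have "norm (x - proj \<gamma> h x) \<le> 1 * norm x" using c mult_right_mono[of "1 - c" 1 "norm x"] by simp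
  moreover have "1 \<le> norm x ^ n * h\<^sup>2"
  proof -
    have "h powr (- 2) \<le> h powr (- (1 / (2 * \<gamma>)) * real n)"
    proof (rule powr_mono')
      show "- (1 / (2 * \<gamma>)) * real n \<le> - 2" using \<gamma> n by (simp add: field_simps)
    qed (use h in auto)
    also have "\<dots> = (h powr (- (1 / (2 * \<gamma>)))) ^ n"
      using h by (subst powr_realpow[symmetric]) (simp_all add: powr_powr)
    also have "\<dots> \<le> norm x ^ n" using False by (intro power_mono) auto
    finally have "h powr (- 2) * h\<^sup>2 \<le> norm x ^ n * h\<^sup>2" by (intro mult_right_mono) auto
    moreover have "h powr (- 2) * h\<^sup>2 = 1"
      using h by (simp add: powr_minus powr_realpow[symmetric, of h 2] flip: powr_numeral)
    ultimately show ?thesis by simp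
  qed
  then have "1 * norm x \<le> (norm x ^ n * h\<^sup>2) * norm x" by (intro mult_right_mono) auto
  ultimately show ?thesis by (simp add: mult_ac)
qed

lemma proj_measurable:
  assumes [measurable]: "Y \<in> borel_measurable N"
  shows "(\<lambda>\<omega>. proj \<gamma> h (Y \<omega> :: real ^ 'd)) \<in> borel_measurable N"
  unfolding proj_def by measurable

section \<open>The one-step decomposition\<close>

context additive_sde
begin

lemma Df_bounded_linear: "bounded_linear (Df t x)"
  using Df_linear linear_conv_bounded_linear by blast

text \<open>Separates direction from state: the coefficients \<open>Df t x (axis i 1)\<close> depend
  on the state alone. This yields joint measurability and, for a state known at time t, scalar test
  variables for the components of the noise.\<close>

lemma Df_expand: "Df t x z = (\<Sum>i\<in>UNIV. z $ i *\<^sub>R Df t x (axis i 1))"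
proof -
  have "Df t x z = Df t x (\<Sum>i\<in>UNIV. z $ i *\<^sub>R axis i 1)"
    by (simp add: basis_expansion flip: scalar_mult_eq_scaleR)
  also have "\<dots> = (\<Sum>i\<in>UNIV. z $ i *\<^sub>R Df t x (axis i 1))"
    by (simp add: linear_sum[OF Df_linear] linear_scale[OF Df_linear])
  finally show ?thesis .
qed

lemma A_expand: "A *v z = (\<Sum>i\<in>UNIV. z $ i *\<^sub>R (A *v axis i 1))"
proof -
  have "A *v z = A *v (\<Sum>i\<in>UNIV. z $ i *\<^sub>R axis i 1)"
    by (simp add: basis_expansion flip: scalar_mult_eq_scaleR)
  also have "\<dots> = (\<Sum>i\<in>UNIV. z $ i *\<^sub>R (A *v axis i 1))"
    by (simp add: linear_sum[OF matrix_vector_mul_linear] linear_scale[OF matrix_vector_mul_linear])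
  finally show ?thesis .
qed

lemma Df_measurable:
  assumes "Y \<in> borel_measurable N"
  shows "(\<lambda>\<omega>. Df t (Y \<omega>) z) \<in> borel_measurable N"
  by (rule borel_measurable_continuous_on[OF Df_cont assms])

lemma Df_measurable2:
  assumes Y: "Y \<in> borel_measurable N" and Z: "Z \<in> borel_measurable N"
  shows "(\<lambda>\<omega>. Df t (Y \<omega>) (Z \<omega>)) \<in> borel_measurable N"
  by (subst Df_expand)
     (intro borel_measurable_sum borel_measurable_scaleR Df_measurable Y measurable_compose[OF Z borel_measurable_vec_nth])

definition euler_map :: "real \<Rightarrow> real \<Rightarrow> real \<Rightarrow> real ^ 'd \<Rightarrow> real ^ 'd" where
  "euler_map \<gamma> h t x = proj \<gamma> h x + h *\<^sub>R (A *v proj \<gamma> h x) + h *\<^sub>R f t (proj \<gamma> h x)"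

definition proj_defect :: "real \<Rightarrow> real \<Rightarrow> real \<Rightarrow> real ^ 'd \<Rightarrow> real ^ 'd" where
  "proj_defect \<gamma> h t x = x + h *\<^sub>R (A *v x) + h *\<^sub>R f t x - euler_map \<gamma> h t x"

text \<open>Only the noise part of the displacement X_s - X_t is linearised. Its first order
  response has size h^(1/2), too large for the remainder, and is left to the martingale part; what
  stays is of size h.\<close>

definition smooth_defect :: "'k \<Rightarrow> real \<Rightarrow> real \<Rightarrow> 'w \<Rightarrow> real ^ 'd" where
  "smooth_defect k t s \<omega> = A *v integral {t..s} (\<lambda>r. drift k r \<omega>) + (f s (X k s \<omega>) - f t (X k s \<omega>))
     + (f t (X k s \<omega>) - f t (X k t \<omega>) - Df t (X k t \<omega>) (noise k t s \<omega>))"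

definition noise_area :: "'k \<Rightarrow> real \<Rightarrow> real \<Rightarrow> 'w \<Rightarrow> real ^ 'd" where
  "noise_area k t h \<omega> = integral {t..t + h} (\<lambda>s. noise k t s \<omega>)"

definition frozen_defect :: "'k \<Rightarrow> real \<Rightarrow> real \<Rightarrow> 'w \<Rightarrow> real ^ 'd" where
  "frozen_defect k t h \<omega> = noise k t (t + h) \<omega> - g t *v (W (t + h) \<omega> - W t \<omega>)"

text \<open>Both terms have size h^2: the projection defect by high moments, the integral because
  its integrand has size h on an interval of length h.\<close>

definition remainder :: "real \<Rightarrow> 'k \<Rightarrow> real \<Rightarrow> real \<Rightarrow> 'w \<Rightarrow> real ^ 'd" where
  "remainder \<gamma> k t h \<omega> = proj_defect \<gamma> h t (X k t \<omega>) + integral {t..t + h} (\<lambda>s. smooth_defect k t s \<omega>)"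

text \<open>\<open>A\<close> and the derivative at time t do not vary over the step, so they come
  out of the time integral of the noise and can later be moved into the test vector.\<close>

definition martingale_part :: "'k \<Rightarrow> real \<Rightarrow> real \<Rightarrow> 'w \<Rightarrow> real ^ 'd" where
  "martingale_part k t h \<omega> = A *v noise_area k t h \<omega> + Df t (X k t \<omega>) (noise_area k t h \<omega>) + frozen_defect k t h \<omega>"

lemma smooth_defect_continuous:
  assumes "T k \<le> t" "continuous_on {T k..} (\<lambda>r. X k r \<omega>)"
  shows "continuous_on {t..s} (\<lambda>r. smooth_defect k t r \<omega>)"
proof -
  have Xc: "continuous_on {t..s} (\<lambda>r. X k r \<omega>)" by (rule continuous_on_subset[OF assms(2)]) (use assms in auto)
  have dc: "continuous_on {t..s} (\<lambda>r. drift k r \<omega>)"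
    unfolding drift_def by (intro continuous_intros f_cont_compose A_cont_compose Xc)
  have 1: "continuous_on {t..s} (\<lambda>r. integral {t..r} (\<lambda>r. drift k r \<omega>))"
    by (rule indefinite_integral_continuous_1[OF integrable_continuous_real[OF dc]])
  have 2: "continuous_on {t..s} (\<lambda>r. f t (X k r \<omega>))"
    by (rule continuous_on_compose2[OF f_cont_state Xc]) auto
  have 3: "continuous_on {t..s} (\<lambda>r. Df t (X k t \<omega>) (noise k t r \<omega>))"
    by (rule bounded_linear.continuous_on[OF Df_bounded_linear noise_continuous[OF assms]])
  show ?thesis
    unfolding smooth_defect_def by (intro continuous_intros A_cont_compose f_cont_compose 1 2 3 Xc)
qed

lemma one_step_decomposition:
  assumes T: "T k \<le> t" and h: "0 < h"
  shows "AE \<omega> in M. X k (t + h) \<omega> = euler_map \<gamma> h t (X k t \<omega>) + g t *v (W (t + h) \<omega> - W t \<omega>)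
    + remainder \<gamma> k t h \<omega> + martingale_part k t h \<omega>"
  using X_continuous[of k]
proof eventually_elim
  case (elim \<omega>)
  have Nc: "continuous_on {t..t + h} (\<lambda>s. noise k t s \<omega>)" by (rule noise_continuous[OF T elim])
  have Sc: "continuous_on {t..t + h} (\<lambda>s. smooth_defect k t s \<omega>)" by (rule smooth_defect_continuous[OF T elim])
  let ?D = "Df t (X k t \<omega>)"
  \<comment> \<open>The drift is expanded about time t, with the displacement split into noise and
    accumulated drift.\<close>
  have split: "drift k s \<omega> = (A *v X k t \<omega> + f t (X k t \<omega>)) + A *v noise k t s \<omega> + ?D (noise k t s \<omega>) + smooth_defect k t s \<omega>" for s
  proof -
    have "X k s \<omega> = X k t \<omega> + noise k t s \<omega> + integral {t..s} (\<lambda>r. drift k r \<omega>)" by (simp add: noise_def)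
    then have "A *v X k s \<omega> = A *v X k t \<omega> + A *v noise k t s \<omega> + A *v integral {t..s} (\<lambda>r. drift k r \<omega>)"
      by (metis matrix_vector_right_distrib)
    then show ?thesis unfolding drift_def[of k s \<omega>] smooth_defect_def by simp
  qed
  have i0: "((\<lambda>s. noise k t s \<omega>) has_integral noise_area k t h \<omega>) {t..t + h}"
    unfolding noise_area_def by (rule integrable_integral[OF integrable_continuous_real[OF Nc]])
  have i1: "((\<lambda>s. A *v noise k t s \<omega>) has_integral A *v noise_area k t h \<omega>) {t..t + h}"
    using has_integral_linear[OF i0 matrix_vector_mul_bounded_linear[of A]] by (simp add: comp_def)
  have i2: "((\<lambda>s. ?D (noise k t s \<omega>)) has_integral ?D (noise_area k t h \<omega>)) {t..t + h}"
    using has_integral_linear[OF i0 Df_bounded_linear] by (simp add: comp_def)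
  have i3: "((\<lambda>s. smooth_defect k t s \<omega>) has_integral integral {t..t + h} (\<lambda>s. smooth_defect k t s \<omega>)) {t..t + h}"
    by (rule integrable_integral[OF integrable_continuous_real[OF Sc]])
  have i4: "((\<lambda>s. A *v X k t \<omega> + f t (X k t \<omega>)) has_integral h *\<^sub>R (A *v X k t \<omega> + f t (X k t \<omega>))) {t..t + h}"
    using has_integral_const_real[of "A *v X k t \<omega> + f t (X k t \<omega>)" t "t + h"] h by simp
  have "((\<lambda>s. drift k s \<omega>) has_integral (h *\<^sub>R (A *v X k t \<omega> + f t (X k t \<omega>)) + A *v noise_area k t h \<omega>
      + ?D (noise_area k t h \<omega>) + integral {t..t + h} (\<lambda>s. smooth_defect k t s \<omega>))) {t..t + h}"
    unfolding split by (intro has_integral_add i1 i2 i3 i4)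
  then have "integral {t..t + h} (\<lambda>s. drift k s \<omega>) = h *\<^sub>R (A *v X k t \<omega> + f t (X k t \<omega>)) + A *v noise_area k t h \<omega>
      + ?D (noise_area k t h \<omega>) + integral {t..t + h} (\<lambda>s. smooth_defect k t s \<omega>)"
    by (rule integral_unique)
  then show ?case
    using noise_def[of k t "t + h" \<omega>]
    unfolding remainder_def martingale_part_def proj_defect_def frozen_defect_def
    by (simp add: algebra_simps)
qed

text \<open>A point \<open>(k, t, h, s)\<close> is a time \<open>s\<close> inside the step \<open>[t, t + h]\<close> of the path started at \<open>T k\<close>.\<close>

definition points :: "('k \<times> real \<times> real \<times> real) set" where
  "points = {(k, t, h, s). T k \<le> t \<and> t \<le> s \<and> s \<le> t + h \<and> 0 < h \<and> h < 1}"

definition steps :: "('k \<times> real \<times> real) set" where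
  "steps = {(k, t, h). T k \<le> t \<and> 0 < h \<and> h < 1}"

abbreviation (input) "pk \<equiv> \<lambda>j :: 'k \<times> real \<times> real \<times> real. fst j"
abbreviation (input) "pt \<equiv> \<lambda>j :: 'k \<times> real \<times> real \<times> real. fst (snd j)"
abbreviation (input) "ph \<equiv> \<lambda>j :: 'k \<times> real \<times> real \<times> real. fst (snd (snd j))"
abbreviation (input) "ps \<equiv> \<lambda>j :: 'k \<times> real \<times> real \<times> real. snd (snd (snd j))"
abbreviation (input) "sk \<equiv> \<lambda>i :: 'k \<times> real \<times> real. fst i"
abbreviation (input) "st \<equiv> \<lambda>i :: 'k \<times> real \<times> real. fst (snd i)"
abbreviation (input) "sh \<equiv> \<lambda>i :: 'k \<times> real \<times> real. snd (snd i)"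

lemma pointsD:
  "j \<in> points \<Longrightarrow> T (pk j) \<le> pt j \<and> pt j \<le> ps j \<and> ps j \<le> pt j + ph j \<and> 0 < ph j \<and> ph j < 1"
  by (auto simp: points_def)

lemma stepsD: "i \<in> steps \<Longrightarrow> T (sk i) \<le> st i \<and> 0 < sh i \<and> sh i < 1"
  by (auto simp: steps_def)

section \<open>Orders of magnitude of the local error terms\<close>

lemma X_bdd_compose:
  assumes "\<And>j. j \<in> S \<Longrightarrow> T (\<kappa> j) \<le> \<tau> j"
  shows "bdd_moments M S (\<lambda>j. X (\<kappa> j) (\<tau> j))"
  using bdd_moments_reindex[OF X_bdd, of S "\<lambda>j. (\<kappa> j, \<tau> j)"] assms by simp

lemma drift_bdd_compose:
  assumes "\<And>j. j \<in> S \<Longrightarrow> T (\<kappa> j) \<le> \<tau> j"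
  shows "bdd_moments M S (\<lambda>j. drift (\<kappa> j) (\<tau> j))"
  unfolding drift_def[abs_def] by (intro f_norm_bdd X_bdd_compose assms)

text \<open>Scaling by the whole step instead of the elapsed time makes one normalisation serve all
  s in the step.\<close>

lemma scaled_noise_bdd: "bdd_moments M points (\<lambda>j \<omega>. (1 / sqrt (ph j)) *\<^sub>R noise (pk j) (pt j) (ps j) \<omega>)"
  unfolding bdd_moments_def
proof (intro conjI ballI allI impI)
  fix j assume "j \<in> points"
  then show "(\<lambda>\<omega>. (1 / sqrt (ph j)) *\<^sub>R noise (pk j) (pt j) (ps j) \<omega>) \<in> borel_measurable M"
    using pointsD[of j] by (intro borel_measurable_scaleR borel_measurable_const noise_measurable) auto
next
  fix p :: nat assume p: "1 \<le> p"
  show "\<exists>L\<ge>0. \<forall>j\<in>points. (\<integral>\<^sup>+ \<omega>. ennreal (norm ((1 / sqrt (ph j)) *\<^sub>R noise (pk j) (pt j) (ps j) \<omega>) ^ p) \<partial>M) \<le> ennreal L"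
  proof (intro exI[of _ "gauss_const CARD('d) p * K ^ p"] conjI ballI)
    fix j assume "j \<in> points"
    then have j: "T (pk j) \<le> pt j" "pt j \<le> ps j" "ps j - pt j \<le> ph j" "0 < ph j" using pointsD[of j] by auto
    have [measurable]: "noise (pk j) (pt j) (ps j) \<in> borel_measurable M" by (rule noise_measurable[OF j(1,2)])
    have "(\<integral>\<^sup>+ \<omega>. ennreal (norm ((1 / sqrt (ph j)) *\<^sub>R noise (pk j) (pt j) (ps j) \<omega>) ^ p) \<partial>M)
       = (\<integral>\<^sup>+ \<omega>. ennreal ((1 / sqrt (ph j)) ^ p) * ennreal (norm (noise (pk j) (pt j) (ps j) \<omega>) ^ p) \<partial>M)"
      using j by (intro nn_integral_cong) (simp add: power_divide flip: ennreal_mult)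
    also have "\<dots> = ennreal ((1 / sqrt (ph j)) ^ p) * (\<integral>\<^sup>+ \<omega>. ennreal (norm (noise (pk j) (pt j) (ps j) \<omega>) ^ p) \<partial>M)"
      by (rule nn_integral_cmult) measurable
    also have "\<dots> \<le> ennreal ((1 / sqrt (ph j)) ^ p) * ennreal (gauss_const CARD('d) p * (K * sqrt (ps j - pt j)) ^ p)"
      by (intro mult_left_mono noise_moment j p) auto
    also have "\<dots> \<le> ennreal ((1 / sqrt (ph j)) ^ p) * ennreal (gauss_const CARD('d) p * (K * sqrt (ph j)) ^ p)"
      using j K_pos by (intro mult_left_mono ennreal_leI power_mono gauss_const_nonneg) auto
    also have "\<dots> = ennreal (gauss_const CARD('d) p * K ^ p)"
      using j K_pos gauss_const_nonneg[of "CARD('d)" p] by (simp add: power_mult_distrib power_divide flip: ennreal_mult)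
    finally show "(\<integral>\<^sup>+ \<omega>. ennreal (norm ((1 / sqrt (ph j)) *\<^sub>R noise (pk j) (pt j) (ps j) \<omega>) ^ p) \<partial>M)
       \<le> ennreal (gauss_const CARD('d) p * K ^ p)" .
  qed (use gauss_const_nonneg K_pos in auto)
qed

lemma scaled_drift_bdd:
  "bdd_moments M points (\<lambda>j \<omega>. (1 / ph j) *\<^sub>R integral {pt j..ps j} (\<lambda>r. drift (pk j) r \<omega>))"
proof (rule bdd_moments_time_average[OF complete])
  fix j assume j: "j \<in> points"
  show "pt j \<le> ps j \<and> ps j - pt j \<le> ph j" "0 < ph j" using pointsD[OF j] by auto
  show "AE \<omega> in M. continuous_on {pt j..ps j} (\<lambda>s. drift (pk j) s \<omega>)"
    using drift_continuous[of "pk j"]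
    by eventually_elim (use pointsD[OF j] in \<open>auto elim: continuous_on_subset\<close>)
next
  show "bdd_moments M (SIGMA j:points. {pt j..ps j}) (\<lambda>(j, s). drift (pk j) s)"
    unfolding split_def by (rule drift_bdd_compose) (auto dest: pointsD)
qed

lemma noise_bdd_points: "bdd_moments M points (\<lambda>j. noise (pk j) (pt j) (ps j))"
proof -
  have "(pk j, pt j, ps j) \<in> unit_steps" if "j \<in> points" for j
    using pointsD[OF that] by (simp add: unit_steps_def)
  from bdd_moments_reindex[OF noise_bdd this] show ?thesis by simp
qed

lemma smooth_defect_measurable:
  assumes "T k \<le> t" "t \<le> s"
  shows "smooth_defect k t s \<in> borel_measurable M"
  unfolding smooth_defect_def[abs_def] using assms
  by (intro borel_measurable_add borel_measurable_diff A_measurable f_measurable Df_measurable2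
      drift_integral_measurable X_measurable noise_measurable) auto

lemma norm_add4_le:
  "norm u \<le> \<alpha> \<Longrightarrow> norm v \<le> \<beta> \<Longrightarrow> norm w \<le> \<gamma> \<Longrightarrow> norm z \<le> \<delta> \<Longrightarrow>
    norm ((u + v) + (w + z)) \<le> (\<alpha> + \<beta>) + (\<gamma> + \<delta>)" for u v w z :: "'e::real_normed_vector"
  using norm_triangle_ineq[of "u + v" "w + z"] norm_triangle_ineq[of u v] norm_triangle_ineq[of w z] by linarith

lemma factor_common4: "(h * \<alpha> + h * \<beta>) + (h * \<gamma> + h * \<delta>) = (\<alpha> + \<beta> + (\<gamma> + \<delta>)) * h" for h :: real
  by (simp add: algebra_simps)

text \<open>The increment of f is split at the intermediate point X_t + N. From there to X_s the
  displacement is the integrated drift, of size h, and the Lipschitz bound suffices; from X_t to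
  there it is the noise, of size h^(1/2), and the Taylor bound leaves its square.\<close>

lemma smooth_defect_bdd: "bdd_moments M points (\<lambda>j \<omega>. (1 / ph j) *\<^sub>R smooth_defect (pk j) (pt j) (ps j) \<omega>)"
proof (rule bdd_moments_dominated)
  define D where "D j \<omega> = norm ((1 / ph j) *\<^sub>R integral {pt j..ps j} (\<lambda>r. drift (pk j) r \<omega>))" for j \<omega>
  define N where "N j \<omega> = norm ((1 / sqrt (ph j)) *\<^sub>R noise (pk j) (pt j) (ps j) \<omega>)" for j \<omega>
  \<comment> \<open>A single weight that dominates every polynomial growth factor below.\<close>
  define Q where "Q j \<omega> = (1 + norm (X (pk j) (ps j) \<omega>) + norm (X (pk j) (pt j) \<omega>) + norm (noise (pk j) (pt j) (ps j) \<omega>)) ^ m" for j \<omega>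
  have D: "bdd_moments M points D" unfolding D_def[abs_def] by (intro bdd_moments_norm scaled_drift_bdd)
  have N: "bdd_moments M points N" unfolding N_def[abs_def] by (intro bdd_moments_norm scaled_noise_bdd)
  have Q: "bdd_moments M points Q" unfolding Q_def[abs_def]
    by (intro bdd_moments_power bdd_moments_add bdd_moments_const bdd_moments_norm prob X_bdd_compose noise_bdd_points)
       (auto dest: pointsD)
  show "bdd_moments M points (\<lambda>j \<omega>. K * D j \<omega> + K * Q j \<omega> + (K * (Q j \<omega> * D j \<omega>) + K * (Q j \<omega> * (N j \<omega>)\<^sup>2)))"
    by (intro bdd_moments_add bdd_moments_mult bdd_moments_const bdd_moments_power prob D N Q)
  fix j assume "j \<in> points"
  then have j: "T (pk j) \<le> pt j" "pt j \<le> ps j" "ps j - pt j \<le> ph j" "0 < ph j" using pointsD[of j] by auto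
  show "(\<lambda>\<omega>. (1 / ph j) *\<^sub>R smooth_defect (pk j) (pt j) (ps j) \<omega>) \<in> borel_measurable M"
    using smooth_defect_measurable[OF j(1,2)] by simp
  show "AE \<omega> in M. norm ((1 / ph j) *\<^sub>R smooth_defect (pk j) (pt j) (ps j) \<omega>) \<le>
     norm (K * D j \<omega> + K * Q j \<omega> + (K * (Q j \<omega> * D j \<omega>) + K * (Q j \<omega> * (N j \<omega>)\<^sup>2)))"
  proof (rule AE_I2)
    fix \<omega>
    let ?h = "ph j" and ?x = "X (pk j) (pt j) \<omega>" and ?y = "X (pk j) (ps j) \<omega>" and ?n = "noise (pk j) (pt j) (ps j) \<omega>"
    let ?d = "integral {pt j..ps j} (\<lambda>r. drift (pk j) r \<omega>)"
    have y: "?y = ?x + ?n + ?d" by (simp add: noise_def)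
    have d: "norm ?d = ?h * D j \<omega>" and n: "(norm ?n)\<^sup>2 = ?h * (N j \<omega>)\<^sup>2"
      using j by (auto simp: D_def N_def power_mult_distrib power_divide)
    have Q0: "0 \<le> Q j \<omega>" "0 \<le> D j \<omega>" by (auto simp: Q_def D_def)
    have qle: "u ^ m \<le> Q j \<omega>" if "0 \<le> u" "u \<le> 1 + norm ?y + norm ?x + norm ?n" for u
      unfolding Q_def using that by (intro power_mono) auto
    have 1: "norm (A *v ?d) \<le> ?h * (K * D j \<omega>)" using A_bound[of ?d] by (simp add: d mult_ac)
    have 2: "norm (f (ps j) ?y - f (pt j) ?y) \<le> ?h * (K * Q j \<omega>)"
    proof -
      have "norm (f (ps j) ?y - f (pt j) ?y) \<le> K * (1 + norm ?y) ^ m * \<bar>ps j - pt j\<bar>" by (rule f_time)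
      also have "\<dots> \<le> K * Q j \<omega> * ?h"
        using j K_pos Q0 by (intro mult_mono mult_left_mono qle) auto
      finally show ?thesis by (simp add: mult_ac)
    qed
    have 3: "norm (f (pt j) ?y - f (pt j) (?x + ?n)) \<le> ?h * (K * (Q j \<omega> * D j \<omega>))"
    proof -
      have "norm (f (pt j) ?y - f (pt j) (?x + ?n)) \<le> K * (1 + norm ?y + norm (?x + ?n)) ^ m * norm (?y - (?x + ?n))"
        by (rule f_lip)
      also have "\<dots> \<le> K * Q j \<omega> * norm (?y - (?x + ?n))"
        using K_pos norm_triangle_ineq[of ?x ?n] by (intro mult_right_mono mult_left_mono qle) auto
      also have "?y - (?x + ?n) = ?d" by (simp add: y)
      finally show ?thesis by (simp add: d mult_ac)
    qed
    have 4: "norm (f (pt j) (?x + ?n) - f (pt j) ?x - Df (pt j) ?x ?n) \<le> ?h * (K * (Q j \<omega> * (N j \<omega>)\<^sup>2))"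
    proof -
      have "norm (f (pt j) (?x + ?n) - f (pt j) ?x - Df (pt j) ?x ?n) \<le> K * (1 + norm ?x + norm ?n) ^ m * (norm ?n)\<^sup>2"
        by (rule Df_taylor)
      also have "\<dots> \<le> K * Q j \<omega> * (norm ?n)\<^sup>2"
        using K_pos by (intro mult_right_mono mult_left_mono qle) auto
      finally show ?thesis by (simp add: n mult_ac)
    qed
    have eq: "smooth_defect (pk j) (pt j) (ps j) \<omega> = (A *v ?d + (f (ps j) ?y - f (pt j) ?y))
        + ((f (pt j) ?y - f (pt j) (?x + ?n)) + (f (pt j) (?x + ?n) - f (pt j) ?x - Df (pt j) ?x ?n))"
      by (simp add: smooth_defect_def)
    have "norm (smooth_defect (pk j) (pt j) (ps j) \<omega>) \<le> (?h * (K * D j \<omega>) + ?h * (K * Q j \<omega>)) + (?h * (K * (Q j \<omega> * D j \<omega>)) + ?h * (K * (Q j \<omega> * (N j \<omega>)\<^sup>2)))"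
      unfolding eq by (rule norm_add4_le[OF 1 2 3 4])
    also have "\<dots> = (K * D j \<omega> + K * Q j \<omega> + (K * (Q j \<omega> * D j \<omega>) + K * (Q j \<omega> * (N j \<omega>)\<^sup>2))) * ?h"
      by (rule factor_common4)
    finally have "norm (smooth_defect (pk j) (pt j) (ps j) \<omega>) / ?h \<le>
       K * D j \<omega> + K * Q j \<omega> + (K * (Q j \<omega> * D j \<omega>) + K * (Q j \<omega> * (N j \<omega>)\<^sup>2))"
      unfolding pos_divide_le_eq[OF j(4)] .
    then show "norm ((1 / ph j) *\<^sub>R smooth_defect (pk j) (pt j) (ps j) \<omega>) \<le>
     norm (K * D j \<omega> + K * Q j \<omega> + (K * (Q j \<omega> * D j \<omega>) + K * (Q j \<omega> * (N j \<omega>)\<^sup>2)))"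
      using j by simp
  qed
qed

lemma step_point:
  "j \<in> (SIGMA i:steps. {st i..st i + sh i}) \<Longrightarrow> (fst (fst j), fst (snd (fst j)), snd (snd (fst j)), snd j) \<in> points"
  unfolding steps_def points_def by auto

text \<open>Of the two factors 1/h, the inner one scales the integrand and the outer one forms the
  average; together they normalise the integral by h^2.\<close>

lemma smooth_defect_integral_bdd:
  "bdd_moments M steps (\<lambda>i \<omega>. (1 / sh i) *\<^sub>R integral {st i..st i + sh i} (\<lambda>s. (1 / sh i) *\<^sub>R smooth_defect (sk i) (st i) s \<omega>))"
proof (rule bdd_moments_time_average[OF complete])
  fix i assume i: "i \<in> steps"
  show "st i \<le> st i + sh i \<and> st i + sh i - st i \<le> sh i" "0 < sh i" using stepsD[OF i] by auto
  show "AE \<omega> in M. continuous_on {st i..st i + sh i} (\<lambda>s. (1 / sh i) *\<^sub>R smooth_defect (sk i) (st i) s \<omega>)"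
    using X_continuous[of "sk i"]
    by eventually_elim (use stepsD[OF i] in \<open>auto intro!: continuous_intros smooth_defect_continuous\<close>)
next
  show "bdd_moments M (SIGMA i:steps. {st i..st i + sh i}) (\<lambda>(i, s) \<omega>. (1 / sh i) *\<^sub>R smooth_defect (sk i) (st i) s \<omega>)"
    unfolding split_def
    using bdd_moments_reindex[OF smooth_defect_bdd step_point] by simp
qed

lemma noise_area_bdd: "bdd_moments M steps (\<lambda>i \<omega>. (1 / (sh i * sqrt (sh i))) *\<^sub>R noise_area (sk i) (st i) (sh i) \<omega>)"
proof -
  have "bdd_moments M steps (\<lambda>i \<omega>. (1 / sh i) *\<^sub>R integral {st i..st i + sh i} (\<lambda>s. (1 / sqrt (sh i)) *\<^sub>R noise (sk i) (st i) s \<omega>))"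
  proof (rule bdd_moments_time_average[OF complete])
    fix i assume i: "i \<in> steps"
    show "st i \<le> st i + sh i \<and> st i + sh i - st i \<le> sh i" "0 < sh i" using stepsD[OF i] by auto
    show "AE \<omega> in M. continuous_on {st i..st i + sh i} (\<lambda>s. (1 / sqrt (sh i)) *\<^sub>R noise (sk i) (st i) s \<omega>)"
      using X_continuous[of "sk i"]
      by eventually_elim (use stepsD[OF i] in \<open>auto intro!: continuous_intros noise_continuous\<close>)
  next
    show "bdd_moments M (SIGMA i:steps. {st i..st i + sh i}) (\<lambda>(i, s) \<omega>. (1 / sqrt (sh i)) *\<^sub>R noise (sk i) (st i) s \<omega>)"
      unfolding split_def
      using bdd_moments_reindex[OF scaled_noise_bdd step_point] by simp
  qed
  then show ?thesis by (simp add: noise_area_def)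
qed

lemma frozen_defect_measurable: "T k \<le> t \<Longrightarrow> 0 \<le> h \<Longrightarrow> frozen_defect k t h \<in> borel_measurable M"
  unfolding frozen_defect_def[abs_def]
  by (intro borel_measurable_diff noise_measurable matrix_vector_measurable W_measurable) auto

lemma noise_area_measurable:
  assumes "T k \<le> t" "0 \<le> h" shows "noise_area k t h \<in> borel_measurable M"
  unfolding noise_area_def[abs_def]
proof (rule measurable_time_integral[OF complete])
  show "AE \<omega> in M. continuous_on {t..t + h} (\<lambda>s. noise k t s \<omega>)"
    using X_continuous[of k] by eventually_elim (rule noise_continuous[OF assms(1)])
qed (use assms in \<open>auto intro: noise_measurable\<close>)

lemma smooth_integral_measurable:
  assumes "T k \<le> t" "0 \<le> h" shows "(\<lambda>\<omega>. integral {t..t + h} (\<lambda>s. smooth_defect k t s \<omega>)) \<in> borel_measurable M"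
proof (rule measurable_time_integral[OF complete])
  show "AE \<omega> in M. continuous_on {t..t + h} (\<lambda>s. smooth_defect k t s \<omega>)"
    using X_continuous[of k] by eventually_elim (rule smooth_defect_continuous[OF assms(1)])
qed (use assms in \<open>auto intro: smooth_defect_measurable\<close>)

lemma frozen_defect_bdd: "bdd_moments M steps (\<lambda>i \<omega>. (1 / (sh i * sqrt (sh i))) *\<^sub>R frozen_defect (sk i) (st i) (sh i) \<omega>)"
  unfolding bdd_moments_def
proof (intro conjI ballI allI impI)
  fix i assume "i \<in> steps"
  then show "(\<lambda>\<omega>. (1 / (sh i * sqrt (sh i))) *\<^sub>R frozen_defect (sk i) (st i) (sh i) \<omega>) \<in> borel_measurable M"
    using stepsD[of i] by (intro borel_measurable_scaleR borel_measurable_const frozen_defect_measurable) auto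
next
  fix p :: nat assume p: "1 \<le> p"
  show "\<exists>L\<ge>0. \<forall>i\<in>steps. (\<integral>\<^sup>+ \<omega>. ennreal (norm ((1 / (sh i * sqrt (sh i))) *\<^sub>R frozen_defect (sk i) (st i) (sh i) \<omega>) ^ p) \<partial>M) \<le> ennreal L"
  proof (intro exI[of _ "gauss_const CARD('d) p * K ^ p"] conjI ballI)
    fix i assume "i \<in> steps"
    then have i: "T (sk i) \<le> st i" "0 < sh i" "0 \<le> sh i" using stepsD[of i] by auto
    let ?c = "1 / (sh i * sqrt (sh i))"
    have [measurable]: "frozen_defect (sk i) (st i) (sh i) \<in> borel_measurable M" by (rule frozen_defect_measurable[OF i(1,3)])
    have "(\<integral>\<^sup>+ \<omega>. ennreal (norm (?c *\<^sub>R frozen_defect (sk i) (st i) (sh i) \<omega>) ^ p) \<partial>M)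
       = (\<integral>\<^sup>+ \<omega>. ennreal (?c ^ p) * ennreal (norm (frozen_defect (sk i) (st i) (sh i) \<omega>) ^ p) \<partial>M)"
      using i by (intro nn_integral_cong) (simp add: power_divide flip: ennreal_mult)
    also have "\<dots> = ennreal (?c ^ p) * (\<integral>\<^sup>+ \<omega>. ennreal (norm (frozen_defect (sk i) (st i) (sh i) \<omega>) ^ p) \<partial>M)"
      by (rule nn_integral_cmult) measurable
    also have "\<dots> \<le> ennreal (?c ^ p) * ennreal (gauss_const CARD('d) p * (K * (st i + sh i - st i) * sqrt (st i + sh i - st i)) ^ p)"
      unfolding frozen_defect_def using i p by (intro mult_left_mono frozen_noise_moment) auto
    also have "\<dots> = ennreal (gauss_const CARD('d) p * K ^ p)"
      using i K_pos gauss_const_nonneg[of "CARD('d)" p] by (simp add: power_mult_distrib power_divide flip: ennreal_mult)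
    finally show "(\<integral>\<^sup>+ \<omega>. ennreal (norm (?c *\<^sub>R frozen_defect (sk i) (st i) (sh i) \<omega>) ^ p) \<partial>M)
       \<le> ennreal (gauss_const CARD('d) p * K ^ p)" .
  qed (use gauss_const_nonneg K_pos in auto)
qed

lemma euler_map_measurable: "Y \<in> borel_measurable N \<Longrightarrow> (\<lambda>\<omega>. euler_map \<gamma> h t (Y \<omega>)) \<in> borel_measurable N"
  unfolding euler_map_def
  by (intro borel_measurable_add borel_measurable_scaleR borel_measurable_const f_measurable A_measurable proj_measurable)

lemma remainder_measurable:
  assumes "T k \<le> t" "0 \<le> h" shows "remainder \<gamma> k t h \<in> borel_measurable M"
  unfolding remainder_def[abs_def] proj_defect_def
  by (intro borel_measurable_add borel_measurable_diff borel_measurable_scaleR borel_measurable_const f_measurable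
      A_measurable euler_map_measurable X_measurable smooth_integral_measurable assms)

lemma martingale_part_measurable:
  assumes "T k \<le> t" "0 \<le> h" shows "martingale_part k t h \<in> borel_measurable M"
  unfolding martingale_part_def[abs_def]
  by (intro borel_measurable_add A_measurable Df_measurable2 X_measurable noise_area_measurable frozen_defect_measurable assms)

lemma norm_proj_defect:
  assumes \<gamma>: "1 \<le> \<gamma>" and h: "0 < h" "h < 1" and n: "4 * \<gamma> \<le> real n"
  shows "norm (proj_defect \<gamma> h t x) \<le> h\<^sup>2 * (norm x ^ Suc n * (1 + K + K * (1 + norm x + norm x) ^ m))"
proof -
  let ?y = "proj \<gamma> h x"
  have "proj_defect \<gamma> h t x = (x - ?y) + h *\<^sub>R (A *v (x - ?y)) + h *\<^sub>R (f t x - f t ?y)"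
    by (simp add: proj_defect_def euler_map_def matrix_vector_mult_diff_distrib algebra_simps)
  also have "norm \<dots> \<le> norm (x - ?y) + h * (K * norm (x - ?y)) + h * (K * (1 + norm x + norm ?y) ^ m * norm (x - ?y))"
  proof (intro order.trans[OF norm_triangle_ineq] add_mono order.refl)
    show "norm (h *\<^sub>R (A *v (x - ?y))) \<le> h * (K * norm (x - ?y))"
      using h A_bound[of "x - ?y"] by simp
    show "norm (h *\<^sub>R (f t x - f t ?y)) \<le> h * (K * (1 + norm x + norm ?y) ^ m * norm (x - ?y))"
      using h f_lip[of t x ?y] by (simp add: mult_left_mono)
  qed
  also have "\<dots> \<le> norm (x - ?y) + 1 * (K * norm (x - ?y)) + 1 * (K * (1 + norm x + norm x) ^ m * norm (x - ?y))"
    using h K_pos norm_proj_le[of \<gamma> h x]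
    by (intro add_mono mult_mono order.refl power_mono) (auto intro!: mult_nonneg_nonneg)
  also have "\<dots> = norm (x - ?y) * (1 + K + K * (1 + norm x + norm x) ^ m)" by (simp add: algebra_simps)
  also have "\<dots> \<le> (norm x ^ Suc n * h\<^sup>2) * (1 + K + K * (1 + norm x + norm x) ^ m)"
    using K_pos by (intro mult_right_mono proj_error assms) (auto intro!: add_nonneg_nonneg)
  finally show ?thesis by (simp add: mult_ac)
qed

lemma remainder_bdd:
  assumes \<gamma>: "1 \<le> \<gamma>"
  shows "bdd_moments M steps (\<lambda>i \<omega>. (1 / (sh i)\<^sup>2) *\<^sub>R remainder \<gamma> (sk i) (st i) (sh i) \<omega>)"
proof (rule bdd_moments_dominated)
  \<comment> \<open>Rounds 4 \<gamma> up, as \<open>proj_error\<close> demands.\<close>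
  define n where "n = nat \<lceil>4 * \<gamma>\<rceil>"
  have n: "4 * \<gamma> \<le> real n" by (simp add: n_def real_nat_ceiling_ge)
  define P where "P i \<omega> = norm (X (sk i) (st i) \<omega>) ^ Suc n * (1 + K + K * (1 + norm (X (sk i) (st i) \<omega>) + norm (X (sk i) (st i) \<omega>)) ^ m)" for i \<omega>
  define S where "S i \<omega> = norm ((1 / sh i) *\<^sub>R integral {st i..st i + sh i} (\<lambda>s. (1 / sh i) *\<^sub>R smooth_defect (sk i) (st i) s \<omega>))" for i \<omega>
  have "bdd_moments M steps P" unfolding P_def[abs_def]
    by (intro bdd_moments_mult bdd_moments_power bdd_moments_add bdd_moments_const bdd_moments_norm prob X_bdd_compose)
       (auto dest: stepsD)
  moreover have "bdd_moments M steps S" unfolding S_def[abs_def] by (intro bdd_moments_norm smooth_defect_integral_bdd)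
  ultimately show "bdd_moments M steps (\<lambda>i \<omega>. P i \<omega> + S i \<omega>)" by (rule bdd_moments_add)
  fix i assume "i \<in> steps"
  then have i: "T (sk i) \<le> st i" "0 < sh i" "sh i < 1" using stepsD[of i] by auto
  show "(\<lambda>\<omega>. (1 / (sh i)\<^sup>2) *\<^sub>R remainder \<gamma> (sk i) (st i) (sh i) \<omega>) \<in> borel_measurable M"
    using i by (intro borel_measurable_scaleR borel_measurable_const remainder_measurable) auto
  show "AE \<omega> in M. norm ((1 / (sh i)\<^sup>2) *\<^sub>R remainder \<gamma> (sk i) (st i) (sh i) \<omega>) \<le> norm (P i \<omega> + S i \<omega>)"
  proof (rule AE_I2)
    fix \<omega>
    let ?s = "integral {st i..st i + sh i} (\<lambda>s. smooth_defect (sk i) (st i) s \<omega>)"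
    have "norm (remainder \<gamma> (sk i) (st i) (sh i) \<omega>) \<le> norm (proj_defect \<gamma> (sh i) (st i) (X (sk i) (st i) \<omega>)) + norm ?s"
      unfolding remainder_def by (rule norm_triangle_ineq)
    also have "\<dots> \<le> (sh i)\<^sup>2 * P i \<omega> + norm ?s"
      unfolding P_def by (intro add_right_mono norm_proj_defect \<gamma> i n)
    also have "norm ?s = (sh i)\<^sup>2 * S i \<omega>"
      using i by (simp add: S_def power2_eq_square)
    finally have "norm (remainder \<gamma> (sk i) (st i) (sh i) \<omega>) / (sh i)\<^sup>2 \<le> P i \<omega> + S i \<omega>"
      using i by (simp add: pos_divide_le_eq distrib_right mult.commute)
    then show "norm ((1 / (sh i)\<^sup>2) *\<^sub>R remainder \<gamma> (sk i) (st i) (sh i) \<omega>) \<le> norm (P i \<omega> + S i \<omega>)" by simp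
  qed
qed

lemma martingale_part_bdd:
  "bdd_moments M steps (\<lambda>i \<omega>. (1 / (sh i * sqrt (sh i))) *\<^sub>R martingale_part (sk i) (st i) (sh i) \<omega>)"
proof (rule bdd_moments_dominated)
  define Z where "Z i \<omega> = norm ((1 / (sh i * sqrt (sh i))) *\<^sub>R noise_area (sk i) (st i) (sh i) \<omega>)" for i \<omega>
  define G where "G i \<omega> = norm ((1 / (sh i * sqrt (sh i))) *\<^sub>R frozen_defect (sk i) (st i) (sh i) \<omega>)" for i \<omega>
  define Q where "Q i \<omega> = K + K * (1 + norm (X (sk i) (st i) \<omega>)) ^ m" for i \<omega>
  have "bdd_moments M steps Q" unfolding Q_def[abs_def]
    by (intro bdd_moments_mult bdd_moments_power bdd_moments_add bdd_moments_const bdd_moments_norm prob X_bdd_compose)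
       (auto dest: stepsD)
  moreover have "bdd_moments M steps Z" "bdd_moments M steps G"
    unfolding Z_def[abs_def] G_def[abs_def] by (intro bdd_moments_norm noise_area_bdd frozen_defect_bdd)+
  ultimately show "bdd_moments M steps (\<lambda>i \<omega>. Q i \<omega> * Z i \<omega> + G i \<omega>)"
    by (intro bdd_moments_add bdd_moments_mult)
  fix i assume "i \<in> steps"
  then have i: "T (sk i) \<le> st i" "0 < sh i" "sh i < 1" using stepsD[of i] by auto
  show "(\<lambda>\<omega>. (1 / (sh i * sqrt (sh i))) *\<^sub>R martingale_part (sk i) (st i) (sh i) \<omega>) \<in> borel_measurable M"
    using i by (intro borel_measurable_scaleR borel_measurable_const martingale_part_measurable) auto
  show "AE \<omega> in M. norm ((1 / (sh i * sqrt (sh i))) *\<^sub>R martingale_part (sk i) (st i) (sh i) \<omega>) \<le> norm (Q i \<omega> * Z i \<omega> + G i \<omega>)"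
  proof (rule AE_I2)
    fix \<omega>
    let ?z = "noise_area (sk i) (st i) (sh i) \<omega>" and ?g = "frozen_defect (sk i) (st i) (sh i) \<omega>" and ?c = "sh i * sqrt (sh i)"
    have c: "0 < ?c" using i by simp
    have "norm (martingale_part (sk i) (st i) (sh i) \<omega>) \<le> norm (A *v ?z) + norm (Df (st i) (X (sk i) (st i) \<omega>) ?z) + norm ?g"
      unfolding martingale_part_def
      by (meson norm_triangle_ineq add_mono order.refl order.trans)
    also have "\<dots> \<le> K * norm ?z + K * (1 + norm (X (sk i) (st i) \<omega>)) ^ m * norm ?z + norm ?g"
      by (intro add_mono A_bound Df_bound order.refl)
    also have "\<dots> = Q i \<omega> * norm ?z + norm ?g" by (simp add: Q_def algebra_simps)
    also have "\<dots> = ?c * (Q i \<omega> * Z i \<omega> + G i \<omega>)"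
      using c i by (simp add: Z_def G_def distrib_left del: real_sqrt_mult_self)
    finally have "norm (martingale_part (sk i) (st i) (sh i) \<omega>) / ?c \<le> Q i \<omega> * Z i \<omega> + G i \<omega>"
      using c by (simp add: pos_divide_le_eq mult.commute)
    then show "norm ((1 / ?c) *\<^sub>R martingale_part (sk i) (st i) (sh i) \<omega>) \<le> norm (Q i \<omega> * Z i \<omega> + G i \<omega>)"
      using c by (simp add: abs_of_pos)
  qed
qed

section \<open>Orthogonality of the martingale part\<close>

text \<open>On each cell the error is the integral of the noise restarted at the left endpoint, with
  second moment of order \<delta>^3; the power mean inequality over n cells gives n^2 \<delta>^3 =
  h^3 / n. The rate serves to carry orthogonality from fixed times to the time integral.\<close>

lemma riemann_noise_error:
  assumes T: "T k \<le> t" and h: "0 < h" and n: "0 < n"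
  shows "(\<integral>\<^sup>+ \<omega>. ennreal ((norm (noise_area k t h \<omega> - riemann t (t + h) (\<lambda>s. noise k t s \<omega>) n))\<^sup>2) \<partial>M)
    \<le> ennreal (h ^ 3 * (gauss_const CARD('d) 2 * K\<^sup>2) / real n)"
proof -
  define \<delta> where "\<delta> = h / real n"
  have \<delta>: "0 < \<delta>" using h n by (simp add: \<delta>_def)
  define u where "u i = t + real i * \<delta>" for i
  have u: "t \<le> u i" "u i \<le> u (Suc i)" "u (Suc i) - u i = \<delta>" for i
    using \<delta> by (auto simp: u_def algebra_simps)
  let ?c = "gauss_const CARD('d) 2 * K\<^sup>2"
  have c: "0 \<le> ?c" using gauss_const_nonneg by simp
  define \<Psi> where "\<Psi> i \<omega> = integral {u i..u (Suc i)} (\<lambda>s. noise k (u i) s \<omega>)" for i \<omega>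
  have Tu: "T k \<le> u i" for i using T u(1)[of i] by simp
  have Nc: "AE \<omega> in M. continuous_on {u i..u (Suc i)} (\<lambda>s. noise k (u i) s \<omega>)" for i
    using X_continuous[of k] by eventually_elim (rule noise_continuous[OF Tu])
  have [measurable]: "\<Psi> i \<in> borel_measurable M" for i
    unfolding \<Psi>_def[abs_def]
    by (rule measurable_time_integral[OF complete u(2) _ Nc]) (use Tu in \<open>auto intro: noise_measurable\<close>)
  have piece: "(\<integral>\<^sup>+ \<omega>. ennreal (norm (\<Psi> i \<omega>) ^ 2) \<partial>M) \<le> ennreal (\<delta>\<^sup>2 * (?c * \<delta>))" for i
  proof -
    have "(\<integral>\<^sup>+ \<omega>. ennreal (norm (noise k (u i) s \<omega>) ^ 2) \<partial>M) \<le> ennreal (?c * \<delta>)" if s: "s \<in> {u i..u (Suc i)}" for s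
    proof -
      have "(\<integral>\<^sup>+ \<omega>. ennreal (norm (noise k (u i) s \<omega>) ^ 2) \<partial>M) \<le> ennreal (gauss_const CARD('d) 2 * (K * sqrt (s - u i)) ^ 2)"
        by (rule noise_moment) (use Tu s in auto)
      also have "\<dots> \<le> ennreal (?c * \<delta>)"
        using s u(3)[of i] c by (intro ennreal_leI) (auto simp: power_mult_distrib mult.assoc[symmetric] intro!: mult_left_mono)
      finally show ?thesis .
    qed
    then have "(\<integral>\<^sup>+ \<omega>. ennreal (norm (\<Psi> i \<omega>) ^ 2) \<partial>M) \<le> ennreal ((u (Suc i) - u i) ^ 2 * (?c * \<delta>))"
      unfolding \<Psi>_def
      by (intro nn_integral_time_integral_power[OF u(2) _ Nc]) (use Tu c \<delta> in \<open>auto intro: noise_measurable\<close>)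
    then show ?thesis by (simp add: u(3))
  qed
  have "(\<integral>\<^sup>+ \<omega>. ennreal ((norm (noise_area k t h \<omega> - riemann t (t + h) (\<lambda>s. noise k t s \<omega>) n))\<^sup>2) \<partial>M)
     \<le> (\<integral>\<^sup>+ \<omega>. ennreal (real n) * (\<Sum>i<n. ennreal (norm (\<Psi> i \<omega>) ^ 2)) \<partial>M)"
  proof (rule nn_integral_mono_AE)
    show "AE \<omega> in M. ennreal ((norm (noise_area k t h \<omega> - riemann t (t + h) (\<lambda>s. noise k t s \<omega>) n))\<^sup>2) \<le>
        ennreal (real n) * (\<Sum>i<n. ennreal (norm (\<Psi> i \<omega>) ^ 2))"
      using X_continuous[of k] drift_continuous[of k]
    proof eventually_elim
      case (elim \<omega>)
      have io: "(\<lambda>s. noise k t s \<omega>) integrable_on {t..t + h}"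
        by (rule integrable_continuous_real[OF noise_continuous[OF T elim(1)]])
      have "noise_area k t h \<omega> = (\<Sum>i<n. integral {u i..u (Suc i)} (\<lambda>s. noise k t s \<omega>))"
        using integral_uniform_partition[OF _ n io] h
        unfolding noise_area_def u_def \<delta>_def by (simp del: of_nat_Suc)
      moreover have "riemann t (t + h) (\<lambda>s. noise k t s \<omega>) n = (\<Sum>i<n. \<delta> *\<^sub>R noise k t (u i) \<omega>)"
        by (simp add: riemann_def u_def \<delta>_def)
      moreover have "integral {u i..u (Suc i)} (\<lambda>s. noise k t s \<omega>) - \<delta> *\<^sub>R noise k t (u i) \<omega> = \<Psi> i \<omega>" for i
      proof -
        have c: "continuous_on {u i..u (Suc i)} (\<lambda>s. noise k t s \<omega>)"
          by (rule continuous_on_subset[OF noise_continuous[OF T elim(1), of "u (Suc i)"]]) (use u(1)[of i] in auto)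
        have "\<Psi> i \<omega> = integral {u i..u (Suc i)} (\<lambda>s. noise k t s \<omega> - noise k t (u i) \<omega>)"
          unfolding \<Psi>_def
          by (intro Henstock_Kurzweil_Integration.integral_cong) (simp add: noise_diff[OF T u(1) _ elim(2)])
        also have "\<dots> = integral {u i..u (Suc i)} (\<lambda>s. noise k t s \<omega>) - (u (Suc i) - u i) *\<^sub>R noise k t (u i) \<omega>"
          using u(2)[of i] integrable_continuous_real[OF c]
          by (subst Henstock_Kurzweil_Integration.integral_diff) auto
        finally show ?thesis by (simp add: u(3))
      qed
      ultimately have eq: "noise_area k t h \<omega> - riemann t (t + h) (\<lambda>s. noise k t s \<omega>) n = (\<Sum>i<n. \<Psi> i \<omega>)"
        by (simp flip: sum_subtractf)
      have "(norm (\<Sum>i<n. \<Psi> i \<omega>))\<^sup>2 \<le> (\<Sum>i<n. norm (\<Psi> i \<omega>))\<^sup>2" by (intro power_mono norm_sum) auto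
      also have "\<dots> \<le> real n * (\<Sum>i<n. norm (\<Psi> i \<omega>) ^ 2)"
        using power_sum_mean[of "{..<n}" "\<lambda>i. norm (\<Psi> i \<omega>)" 2] by simp
      finally have "ennreal ((norm (\<Sum>i<n. \<Psi> i \<omega>))\<^sup>2) \<le> ennreal (real n * (\<Sum>i<n. norm (\<Psi> i \<omega>) ^ 2))" by (rule ennreal_leI)
      also have "\<dots> = ennreal (real n) * (\<Sum>i<n. ennreal (norm (\<Psi> i \<omega>) ^ 2))"
        by (simp add: ennreal_mult sum_nonneg)
      finally show ?case unfolding eq .
    qed
  qed
  also have "\<dots> = ennreal (real n) * (\<Sum>i<n. \<integral>\<^sup>+ \<omega>. ennreal (norm (\<Psi> i \<omega>) ^ 2) \<partial>M)"
    by (subst nn_integral_cmult, measurable, subst nn_integral_sum, measurable)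
  also have "\<dots> \<le> ennreal (real n) * (\<Sum>i<n. ennreal (\<delta>\<^sup>2 * (?c * \<delta>)))"
    by (intro mult_left_mono sum_mono piece) auto
  also have "\<dots> = ennreal (real n * (real n * (\<delta>\<^sup>2 * (?c * \<delta>))))"
    using c \<delta> by (simp add: ennreal_mult ennreal_of_nat_eq_real_of_nat)
  also have "real n * (real n * (\<delta>\<^sup>2 * (?c * \<delta>))) = h ^ 3 * ?c / real n"
    using n by (simp add: \<delta>_def power2_eq_square power3_eq_cube field_simps)
  finally show ?thesis .
qed

lemma noise_area_orthogonal:
  assumes T: "T k \<le> t" and h: "0 < h"
  shows "past_orthogonal t (noise_area k t h)"
proof (rule past_orthogonal_L2_limit)
  let ?c = "h ^ 3 * (gauss_const CARD('d) 2 * K\<^sup>2)"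
  show "past_orthogonal t (\<lambda>\<omega>. riemann t (t + h) (\<lambda>s. noise k t s \<omega>) (Suc n))" for n
    unfolding riemann_def
  proof (intro past_orthogonal_sum past_orthogonal_scaleR noise_orthogonal T)
    fix i
    have "0 \<le> real i * ((t + h - t) / real (Suc n))" using h by simp
    then show "t \<le> t + real i * ((t + h - t) / real (Suc n))" by linarith
  qed
  show "noise_area k t h \<in> borel_measurable M" using T h by (intro noise_area_measurable) auto
  have "(\<lambda>n. ?c / real (Suc n)) \<longlonglongrightarrow> 0"
    by (rule LIMSEQ_Suc[OF lim_const_over_n])
  then have lim: "(\<lambda>n. ennreal (?c / real (Suc n))) \<longlonglongrightarrow> 0" using tendsto_ennrealI[of _ 0] by simp
  show "(\<lambda>n. \<integral>\<^sup>+ \<omega>. ennreal ((norm (noise_area k t h \<omega> - riemann t (t + h) (\<lambda>s. noise k t s \<omega>) (Suc n)))\<^sup>2) \<partial>M) \<longlonglongrightarrow> 0"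
    by (rule tendsto_sandwich[OF _ _ tendsto_const lim]) (use riemann_noise_error[OF T h, of "Suc _"] in auto)
qed

lemma frozen_defect_orthogonal:
  assumes T: "T k \<le> t" and h: "0 < h"
  shows "past_orthogonal t (frozen_defect k t h)"
proof -
  have "past_orthogonal t (\<lambda>\<omega>. noise k t (t + h) \<omega> + (- 1) *\<^sub>R (g t *v (W (t + h) \<omega> - W t \<omega>)))"
    using h by (intro past_orthogonal_add past_orthogonal_scaleR past_orthogonal_increment_integral noise_orthogonal T) auto
  then show ?thesis by (simp add: frozen_defect_def[abs_def])
qed

lemma past_orthogonal_inner:
  fixes Z :: "'w \<Rightarrow> real ^ 'n"
  assumes Z: "past_orthogonal t Z" and U: "\<And>i. U i \<in> borel_measurable (past t)" "\<And>i. integrable M (\<lambda>\<omega>. (U i \<omega>)\<^sup>2)"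
  shows "integrable M (\<lambda>\<omega>. \<Sum>i\<in>UNIV. U i \<omega> * Z \<omega> $ i) \<and> (\<integral>\<omega>. (\<Sum>i\<in>UNIV. U i \<omega> * Z \<omega> $ i) \<partial>M) = 0"
proof -
  have int: "integrable M (\<lambda>\<omega>. U i \<omega> * Z \<omega> $ i)" for i
    by (rule integrable_mult_component[OF past_measurable[OF U(1)] U(2)]) (use Z in \<open>auto simp: past_orthogonal_def\<close>)
  then show ?thesis
    using Z U by (subst Bochner_Integration.integral_sum) (auto simp: past_orthogonal_def)
qed

lemma integrable_of_nn_bound:
  assumes "Z \<in> borel_measurable M" "(\<integral>\<^sup>+ \<omega>. ennreal ((norm (Z \<omega>))\<^sup>2) \<partial>M) \<le> ennreal c"
  shows "integrable M (\<lambda>\<omega>. (norm (Z \<omega> :: 'e::real_normed_vector))\<^sup>2)"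
  by (rule integrableI_bounded) (use assms in \<open>auto intro: le_less_trans\<close>)

text \<open>Moving the linear map in front of the noise area into the test vector V gives scalar
  coefficients \<open>U i\<close>. They are measurable with respect to the past once X_t is replaced
  by its adapted version Y, and square integrable because V is bounded and X_t has all moments. The
  components of the noise area are then tested one by one.\<close>

lemma martingale_part_inner:
  assumes T: "T k \<le> t" and h: "0 < h" and V: "V \<in> borel_measurable (past t)" and b: "\<And>\<omega>. norm (V \<omega>) \<le> b"
  shows "(\<integral>\<omega>. V \<omega> \<bullet> martingale_part k t h \<omega> \<partial>M) = 0"
proof -
  obtain Y where Y: "Y \<in> borel_measurable (past t)" "AE \<omega> in M. X k t \<omega> = Y \<omega>" using X_past_version[OF T] .
  have VM[measurable]: "V \<in> borel_measurable M" by (rule past_measurable[OF V])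
  have YM[measurable]: "Y \<in> borel_measurable M" by (rule past_measurable[OF Y(1)])
  have b0: "0 \<le> b" using b[of undefined] norm_ge_zero order.trans by blast
  define U where "U i \<omega> = V \<omega> \<bullet> (A *v axis i 1 + Df t (Y \<omega>) (axis i 1))" for i \<omega>
  have U: "U i \<in> borel_measurable (past t)" for i
    unfolding U_def[abs_def]
    by (intro borel_measurable_inner V borel_measurable_add borel_measurable_const Df_measurable Y)
  have "bdd_moments M {()} (\<lambda>_ \<omega>. b * (K + K * (1 + norm (X k t \<omega>)) ^ m))"
    by (intro bdd_moments_mult bdd_moments_power bdd_moments_add bdd_moments_const bdd_moments_norm prob X_bdd_compose)
       (use T in auto)
  then obtain c where "(\<integral>\<^sup>+ \<omega>. ennreal (norm (b * (K + K * (1 + norm (X k t \<omega>)) ^ m)) ^ 2) \<partial>M) \<le> ennreal c"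
    using bdd_momentsE[of M "{()}" _ 2] by (metis insertI1 one_le_numeral)
  then have int: "integrable M (\<lambda>\<omega>. (norm (b * (K + K * (1 + norm (X k t \<omega>)) ^ m)))\<^sup>2)"
    using X_measurable[OF T] by (intro integrable_of_nn_bound) auto
  have Ui: "integrable M (\<lambda>\<omega>. (U i \<omega>)\<^sup>2)" for i
  proof (rule Bochner_Integration.integrable_bound[OF int])
    show "(\<lambda>\<omega>. (U i \<omega>)\<^sup>2) \<in> borel_measurable M" using past_measurable[OF U[of i]] by simp
    show "AE \<omega> in M. norm ((U i \<omega>)\<^sup>2) \<le> norm ((norm (b * (K + K * (1 + norm (X k t \<omega>)) ^ m)))\<^sup>2)"
      using Y(2)
    proof eventually_elim
      case (elim \<omega>)
      have "\<bar>U i \<omega>\<bar> \<le> norm (V \<omega>) * norm (A *v axis i 1 + Df t (Y \<omega>) (axis i 1))"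
        unfolding U_def by (rule Cauchy_Schwarz_ineq2)
      also have "\<dots> \<le> b * (K + K * (1 + norm (X k t \<omega>)) ^ m)"
      proof (intro mult_mono b b0)
        have "norm (A *v axis i 1 + Df t (Y \<omega>) (axis i 1)) \<le> norm (A *v axis i 1) + norm (Df t (Y \<omega>) (axis i 1))"
          by (rule norm_triangle_ineq)
        also have "\<dots> \<le> K + K * (1 + norm (X k t \<omega>)) ^ m"
          using A_bound[of "axis i 1"] Df_bound[of t "Y \<omega>" "axis i 1"] elim by (simp add: norm_axis_1)
        finally show "norm (A *v axis i 1 + Df t (Y \<omega>) (axis i 1)) \<le> K + K * (1 + norm (X k t \<omega>)) ^ m" .
      qed auto
      finally have "\<bar>U i \<omega>\<bar> \<le> norm (b * (K + K * (1 + norm (X k t \<omega>)) ^ m))" by simp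
      then have "\<bar>U i \<omega>\<bar>\<^sup>2 \<le> (norm (b * (K + K * (1 + norm (X k t \<omega>)) ^ m)))\<^sup>2" by (intro power_mono) auto
      then show ?case by simp
    qed
  qed
  have Vc: "(\<lambda>\<omega>. V \<omega> $ i) \<in> borel_measurable (past t)" for i
    by (rule measurable_compose[OF V borel_measurable_vec_nth])
  have Vi: "integrable M (\<lambda>\<omega>. (V \<omega> $ i)\<^sup>2)" for i
  proof (rule integrable_const_bound[where B = "b\<^sup>2"])
    show "AE \<omega> in M. norm ((V \<omega> $ i)\<^sup>2) \<le> b\<^sup>2"
    proof (intro AE_I2)
      fix \<omega>
      have "\<bar>V \<omega> $ i\<bar>\<^sup>2 \<le> b\<^sup>2"
        using component_le_norm_cart[of "V \<omega>" i] b[of \<omega>] by (intro power_mono) auto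
      then show "norm ((V \<omega> $ i)\<^sup>2) \<le> b\<^sup>2" by simp
    qed
    show "(\<lambda>\<omega>. (V \<omega> $ i)\<^sup>2) \<in> borel_measurable M" using past_measurable[OF Vc[of i]] by simp
  qed
  note o1 = past_orthogonal_inner[where U = U, OF noise_area_orthogonal[OF T h] U Ui]
  note o2 = past_orthogonal_inner[where U = "\<lambda>i \<omega>. V \<omega> $ i", OF frozen_defect_orthogonal[OF T h] Vc Vi]
  have m: "martingale_part k t h \<in> borel_measurable M" using T h by (intro martingale_part_measurable) auto
  have "(\<integral>\<omega>. V \<omega> \<bullet> martingale_part k t h \<omega> \<partial>M) =
     (\<integral>\<omega>. (\<Sum>i\<in>UNIV. U i \<omega> * noise_area k t h \<omega> $ i) + (\<Sum>i\<in>UNIV. V \<omega> $ i * frozen_defect k t h \<omega> $ i) \<partial>M)"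
  proof (rule Bochner_Integration.integral_cong_AE)
    show "(\<lambda>\<omega>. V \<omega> \<bullet> martingale_part k t h \<omega>) \<in> borel_measurable M" using VM m by (rule borel_measurable_inner)
    show "(\<lambda>\<omega>. (\<Sum>i\<in>UNIV. U i \<omega> * noise_area k t h \<omega> $ i) + (\<Sum>i\<in>UNIV. V \<omega> $ i * frozen_defect k t h \<omega> $ i)) \<in> borel_measurable M"
      using o1 o2 by (intro borel_measurable_add) auto
    show "AE \<omega> in M. V \<omega> \<bullet> martingale_part k t h \<omega> =
      (\<Sum>i\<in>UNIV. U i \<omega> * noise_area k t h \<omega> $ i) + (\<Sum>i\<in>UNIV. V \<omega> $ i * frozen_defect k t h \<omega> $ i)"
      using Y(2)
    proof eventually_elim
      case (elim \<omega>)
      let ?z = "noise_area k t h \<omega>"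
      have "A *v ?z + Df t (Y \<omega>) ?z = (\<Sum>i\<in>UNIV. ?z $ i *\<^sub>R (A *v axis i 1 + Df t (Y \<omega>) (axis i 1)))"
        by (subst A_expand, subst Df_expand) (simp add: scaleR_add_right sum.distrib)
      then have "V \<omega> \<bullet> (A *v ?z + Df t (Y \<omega>) ?z) = (\<Sum>i\<in>UNIV. U i \<omega> * ?z $ i)"
        by (simp add: inner_sum_right U_def mult.commute)
      moreover have "V \<omega> \<bullet> frozen_defect k t h \<omega> = (\<Sum>i\<in>UNIV. V \<omega> $ i * frozen_defect k t h \<omega> $ i)"
        by (simp add: inner_vec_def)
      ultimately show ?case by (simp add: martingale_part_def elim inner_add_right)
    qed
  qed
  also have "\<dots> = 0" using o1 o2 by simp
  finally show ?thesis .
qed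

lemma nn_integral_scaled_square:
  assumes c: "0 < c" and Z[measurable]: "Z \<in> borel_measurable M"
    and le: "(\<integral>\<^sup>+ \<omega>. ennreal (norm ((1 / c) *\<^sub>R Z \<omega>) ^ 2) \<partial>M) \<le> ennreal L" and L: "0 \<le> L"
  shows "(\<integral>\<^sup>+ \<omega>. ennreal ((norm (Z \<omega> :: 'e::{real_normed_vector, second_countable_topology}))\<^sup>2) \<partial>M) \<le> ennreal (L * c\<^sup>2)"
proof -
  have "(\<integral>\<^sup>+ \<omega>. ennreal ((norm (Z \<omega>))\<^sup>2) \<partial>M) = (\<integral>\<^sup>+ \<omega>. ennreal (c\<^sup>2) * ennreal (norm ((1 / c) *\<^sub>R Z \<omega>) ^ 2) \<partial>M)"
    using c by (intro nn_integral_cong) (simp add: power_divide flip: ennreal_mult)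
  also have "\<dots> = ennreal (c\<^sup>2) * (\<integral>\<^sup>+ \<omega>. ennreal (norm ((1 / c) *\<^sub>R Z \<omega>) ^ 2) \<partial>M)"
    by (rule nn_integral_cmult) measurable
  also have "\<dots> \<le> ennreal (c\<^sup>2) * ennreal L" by (intro mult_left_mono le) auto
  also have "\<dots> = ennreal (L * c\<^sup>2)" using L by (simp add: mult.commute flip: ennreal_mult)
  finally show ?thesis .
qed

lemma local_error:
  assumes \<gamma>: "1 \<le> \<gamma>"
  obtains C where "0 \<le> C"
    "\<And>k t h. T k \<le> t \<Longrightarrow> 0 < h \<Longrightarrow> h < 1 \<Longrightarrow> (\<integral>\<^sup>+ \<omega>. ennreal ((norm (remainder \<gamma> k t h \<omega>))\<^sup>2) \<partial>M) \<le> ennreal (C * h ^ 4)"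
    "\<And>k t h. T k \<le> t \<Longrightarrow> 0 < h \<Longrightarrow> h < 1 \<Longrightarrow> (\<integral>\<^sup>+ \<omega>. ennreal ((norm (martingale_part k t h \<omega>))\<^sup>2) \<partial>M) \<le> ennreal (C * h ^ 3)"
proof -
  have 2: "(1::nat) \<le> 2" by simp
  obtain L where L: "0 \<le> L" "\<And>i. i \<in> steps \<Longrightarrow> (\<integral>\<^sup>+ \<omega>. ennreal (norm ((1 / (sh i)\<^sup>2) *\<^sub>R remainder \<gamma> (sk i) (st i) (sh i) \<omega>) ^ 2) \<partial>M) \<le> ennreal L"
    using bdd_momentsE[OF remainder_bdd[OF \<gamma>] 2] by metis
  obtain L' where L': "0 \<le> L'" "\<And>i. i \<in> steps \<Longrightarrow> (\<integral>\<^sup>+ \<omega>. ennreal (norm ((1 / (sh i * sqrt (sh i))) *\<^sub>R martingale_part (sk i) (st i) (sh i) \<omega>) ^ 2) \<partial>M) \<le> ennreal L'"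
    using bdd_momentsE[OF martingale_part_bdd 2] by metis
  show ?thesis
  proof (rule that[of "max L L'"])
    show "0 \<le> max L L'" using L by simp
    fix k t and h :: real assume h: "T k \<le> t" "0 < h" "h < 1"
    then have i: "(k, t, h) \<in> steps" by (simp add: steps_def)
    have "(\<integral>\<^sup>+ \<omega>. ennreal ((norm (remainder \<gamma> k t h \<omega>))\<^sup>2) \<partial>M) \<le> ennreal (L * (h\<^sup>2)\<^sup>2)"
      using L(2)[OF i] h by (intro nn_integral_scaled_square L remainder_measurable) auto
    also have "\<dots> \<le> ennreal (max L L' * h ^ 4)"
      using h by (intro ennreal_leI) (auto simp flip: power_mult intro!: mult_right_mono)
    finally show "(\<integral>\<^sup>+ \<omega>. ennreal ((norm (remainder \<gamma> k t h \<omega>))\<^sup>2) \<partial>M) \<le> ennreal (max L L' * h ^ 4)" .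
    have "(\<integral>\<^sup>+ \<omega>. ennreal ((norm (martingale_part k t h \<omega>))\<^sup>2) \<partial>M) \<le> ennreal (L' * (h * sqrt h)\<^sup>2)"
      using L'(2)[OF i] h by (intro nn_integral_scaled_square L' martingale_part_measurable) auto
    also have "(h * sqrt h)\<^sup>2 = h ^ 3" using h by (simp add: power_mult_distrib power2_eq_square power3_eq_cube)
    also have "ennreal (L' * h ^ 3) \<le> ennreal (max L L' * h ^ 3)"
      using h by (intro ennreal_leI) (auto intro!: mult_right_mono)
    finally show "(\<integral>\<^sup>+ \<omega>. ennreal ((norm (martingale_part k t h \<omega>))\<^sup>2) \<partial>M) \<le> ennreal (max L L' * h ^ 3)" .
  qed
qed

end

section \<open>The global error\<close>

text \<open>The product of v and r is absorbed by Young's inequality with weight c. The product of v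
  and s is kept as it stands because its expectation will vanish.\<close>

lemma norm_square_expand:
  "(norm (v + r + s))\<^sup>2 \<le> (1 + c) * (norm v)\<^sup>2 + 2 * (v \<bullet> s) + (2 + 1 / c) * (norm r)\<^sup>2 + 2 * (norm s)\<^sup>2"
  if "0 < c" for v r s :: "'e::real_inner"
proof -
  have "(norm (v + r + s))\<^sup>2 = (norm v)\<^sup>2 + 2 * (v \<bullet> r) + 2 * (v \<bullet> s) + (norm (r + s))\<^sup>2"
    by (simp add: power2_norm_eq_inner inner_add_left inner_add_right inner_commute)
  moreover have "2 * (v \<bullet> r) \<le> c * (norm v)\<^sup>2 + (1 / c) * (norm r)\<^sup>2"
  proof -
    have "0 \<le> (c * norm v - norm r)\<^sup>2 / c" using that by simp
    also have "\<dots> = c * (norm v)\<^sup>2 - 2 * (norm v * norm r) + (1 / c) * (norm r)\<^sup>2"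
      using that by (simp add: power2_diff power_mult_distrib field_simps power2_eq_square)
    finally show ?thesis using norm_cauchy_schwarz[of v r] by linarith
  qed
  moreover have "(norm (r + s))\<^sup>2 \<le> 2 * (norm r)\<^sup>2 + 2 * (norm s)\<^sup>2"
  proof -
    have "(norm (r + s))\<^sup>2 \<le> (norm r + norm s)\<^sup>2" by (intro power_mono norm_triangle_ineq) auto
    also have "\<dots> \<le> 2 * (norm r)\<^sup>2 + 2 * (norm s)\<^sup>2" by (rule power2_sum_le)
    finally show ?thesis .
  qed
  ultimately show ?thesis by (simp add: algebra_simps)
qed

context additive_sde
begin

text \<open>The bound blows up as h tends to 0; it only certifies, for each fixed h, that test
  vectors built from the scheme are bounded.\<close>

lemma norm_euler_map_bound:
  assumes "0 \<le> h"
  shows "norm (euler_map \<gamma> h t x) \<le> (1 + h * K) * h powr (- (1 / (2 * \<gamma>))) + h * (K * (1 + h powr (- (1 / (2 * \<gamma>)))) ^ m)"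
proof -
  let ?y = "proj \<gamma> h x" and ?\<rho> = "h powr (- (1 / (2 * \<gamma>)))"
  have y: "norm ?y \<le> ?\<rho>" by (rule norm_proj_bound)
  have "norm (euler_map \<gamma> h t x) \<le> norm ?y + h * norm (A *v ?y) + h * norm (f t ?y)"
    unfolding euler_map_def using assms
    by (smt (verit) norm_triangle_ineq norm_scaleR abs_of_nonneg)
  also have "\<dots> \<le> ?\<rho> + h * (K * ?\<rho>) + h * (K * (1 + ?\<rho>) ^ m)"
  proof (intro add_mono y mult_left_mono assms)
    show "norm (A *v ?y) \<le> K * ?\<rho>" using A_bound[of ?y] K_pos y by (smt (verit) mult_left_mono)
    have "K * (1 + norm ?y) ^ m \<le> K * (1 + ?\<rho>) ^ m"
      using y K_pos by (intro mult_left_mono power_mono) auto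
    then show "norm (f t ?y) \<le> K * (1 + ?\<rho>) ^ m" using f_growth[of t ?y] by linarith
  qed
  finally show ?thesis by (simp add: algebra_simps)
qed

text \<open>Coefficients are evaluated at the true time T k + j h. For T k = -k \<tau> periodicity
  identifies this with the scheme evaluated at j h.\<close>

definition euler_scheme :: "real \<Rightarrow> real \<Rightarrow> 'k \<Rightarrow> (nat \<Rightarrow> 'w \<Rightarrow> real ^ 'd) \<Rightarrow> bool" where
  "euler_scheme \<gamma> h k Y \<longleftrightarrow> Y 0 = \<xi> k \<and> (\<forall>j \<omega>. Y (Suc j) \<omega> = euler_map \<gamma> h (T k + real j * h) (Y j \<omega>)
     + g (T k + real j * h) *v (W (T k + real (Suc j) * h) \<omega> - W (T k + real j * h) \<omega>))"

lemma euler_scheme_past_measurable: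
  assumes Y: "euler_scheme \<gamma> h k Y" and h: "0 < h" and init: "\<xi> k \<in> borel_measurable (past (T k))"
  shows "Y j \<in> borel_measurable (past (T k + real j * h))"
proof (induction j)
  case 0
  then show ?case using Y init by (simp add: euler_scheme_def)
next
  case (Suc j)
  let ?t = "T k + real j * h" and ?s = "T k + real (Suc j) * h"
  have ts: "?t \<le> ?s" using h by (simp add: algebra_simps)
  have "(\<lambda>\<omega>. euler_map \<gamma> h ?t (Y j \<omega>) + g ?t *v (W ?s \<omega> - W ?t \<omega>)) \<in> borel_measurable (past ?s)"
    by (intro borel_measurable_add euler_map_measurable past_measurable_mono[OF Suc ts]
        matrix_vector_measurable increment_past_measurable ts order.refl)
  moreover have "Y (Suc j) = (\<lambda>\<omega>. euler_map \<gamma> h ?t (Y j \<omega>) + g ?t *v (W ?s \<omega> - W ?t \<omega>))"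
    using Y by (auto simp: euler_scheme_def)
  ultimately show ?case by simp
qed

lemma error_step:
  assumes h: "0 < h" "h < 1" and tk: "T k \<le> t"
    and contr: "\<And>x y. (norm (euler_map \<gamma> h t x - euler_map \<gamma> h t y))\<^sup>2 \<le> (1 - a * h) * (norm (x - y))\<^sup>2"
    and Y: "Y \<in> borel_measurable (past t)" and int: "integrable M (\<lambda>\<omega>. (norm (X k t \<omega> - Y \<omega>))\<^sup>2)"
    and C0: "0 \<le> C0"
    and rem: "(\<integral>\<^sup>+ \<omega>. ennreal ((norm (remainder \<gamma> k t h \<omega>))\<^sup>2) \<partial>M) \<le> ennreal (C0 * h ^ 4)"
    and mart: "(\<integral>\<^sup>+ \<omega>. ennreal ((norm (martingale_part k t h \<omega>))\<^sup>2) \<partial>M) \<le> ennreal (C0 * h ^ 3)"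
  defines "E' \<equiv> \<lambda>\<omega>. X k (t + h) \<omega> - (euler_map \<gamma> h t (Y \<omega>) + g t *v (W (t + h) \<omega> - W t \<omega>))"
  shows "integrable M (\<lambda>\<omega>. (norm (E' \<omega>))\<^sup>2) \<and> (\<integral>\<omega>. (norm (E' \<omega>))\<^sup>2 \<partial>M) \<le>
    (1 - a * h / 2) * (\<integral>\<omega>. (norm (X k t \<omega> - Y \<omega>))\<^sup>2 \<partial>M) + C0 * (4 + 2 / a) * h ^ 3"
proof -
  \<comment> \<open>Half of the contraction rate pays for the cross term: (1 + c) (1 - a h) <= 1 - a
    h / 2, while 1/c times h^4 is 2 h^3 / a.\<close>
  define c where "c = a * h / 2"
  have c: "0 < c" using a_pos h by (simp add: c_def)
  have h0: "0 \<le> h" using h by simp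
  obtain Z where Z: "Z \<in> borel_measurable (past t)" "AE \<omega> in M. X k t \<omega> = Z \<omega>" using X_past_version[OF tk] .
  have YM[measurable]: "Y \<in> borel_measurable M" and ZM[measurable]: "Z \<in> borel_measurable M"
    using past_measurable Y Z by auto
  \<comment> \<open>Built from the adapted version Z of X_t, so that V is measurable with respect to
    the past itself, not just up to null sets.\<close>
  define V where "V \<omega> = euler_map \<gamma> h t (Z \<omega>) - euler_map \<gamma> h t (Y \<omega>)" for \<omega>
  have Vp: "V \<in> borel_measurable (past t)"
    unfolding V_def[abs_def] by (intro borel_measurable_diff euler_map_measurable Y Z)
  have VM[measurable]: "V \<in> borel_measurable M" by (rule past_measurable[OF Vp])
  define b where "b = 2 * ((1 + h * K) * h powr (- (1 / (2 * \<gamma>))) + h * (K * (1 + h powr (- (1 / (2 * \<gamma>)))) ^ m))"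
  have Vb: "norm (V \<omega>) \<le> b" for \<omega>
    using norm_triangle_ineq4[of "euler_map \<gamma> h t (Z \<omega>)" "euler_map \<gamma> h t (Y \<omega>)"]
      norm_euler_map_bound[OF h0, of \<gamma> t "Z \<omega>"] norm_euler_map_bound[OF h0, of \<gamma> t "Y \<omega>"]
    by (simp add: V_def b_def)
  have iV: "integrable M (\<lambda>\<omega>. (norm (V \<omega>))\<^sup>2)"
  proof (rule integrable_const_bound[where B = "b\<^sup>2"])
    show "AE \<omega> in M. norm ((norm (V \<omega>))\<^sup>2) \<le> b\<^sup>2"
      using power_mono[OF Vb, of _ 2] by (intro AE_I2) auto
  qed measurable
  let ?R = "remainder \<gamma> k t h" and ?S = "martingale_part k t h"
  have [measurable]: "?R \<in> borel_measurable M" "?S \<in> borel_measurable M"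
    using remainder_measurable[OF tk h0] martingale_part_measurable[OF tk h0] by auto
  have iR: "integrable M (\<lambda>\<omega>. (norm (?R \<omega>))\<^sup>2)" and iS: "integrable M (\<lambda>\<omega>. (norm (?S \<omega>))\<^sup>2)"
    using rem mart by (auto intro!: integrable_of_nn_bound)
  have R: "(\<integral>\<omega>. (norm (?R \<omega>))\<^sup>2 \<partial>M) \<le> C0 * h ^ 4"
  proof -
    have "ennreal (\<integral>\<omega>. (norm (?R \<omega>))\<^sup>2 \<partial>M) \<le> ennreal (C0 * h ^ 4)"
      using rem nn_integral_eq_integral[OF iR] by simp
    then show ?thesis using C0 by (simp add: ennreal_le_iff)
  qed
  have S: "(\<integral>\<omega>. (norm (?S \<omega>))\<^sup>2 \<partial>M) \<le> C0 * h ^ 3"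
  proof -
    have "ennreal (\<integral>\<omega>. (norm (?S \<omega>))\<^sup>2 \<partial>M) \<le> ennreal (C0 * h ^ 3)"
      using mart nn_integral_eq_integral[OF iS] by simp
    then show ?thesis using C0 h by (simp add: ennreal_le_iff)
  qed
  have iVS: "integrable M (\<lambda>\<omega>. V \<omega> \<bullet> ?S \<omega>)"
  proof (rule Bochner_Integration.integrable_bound[OF integrable_mult_square[of "\<lambda>\<omega>. norm (V \<omega>)" M "\<lambda>\<omega>. norm (?S \<omega>)"]])
    show "AE \<omega> in M. norm (V \<omega> \<bullet> ?S \<omega>) \<le> norm (norm (V \<omega>) * norm (?S \<omega>))"
      by (intro AE_I2) (simp add: Cauchy_Schwarz_ineq2)
  qed (use iV iS in auto)
  have VS: "(\<integral>\<omega>. V \<omega> \<bullet> ?S \<omega> \<partial>M) = 0"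
    by (rule martingale_part_inner[OF tk h(1) Vp Vb])
  have E': "AE \<omega> in M. E' \<omega> = V \<omega> + ?R \<omega> + ?S \<omega>"
    using one_step_decomposition[OF tk h(1), of \<gamma>] Z(2)
    by eventually_elim (simp add: E'_def V_def)
  have E'M[measurable]: "E' \<in> borel_measurable M"
    by (rule complete_measure.borel_measurable_AE_eq[OF complete _ E']) measurable
  let ?B = "\<lambda>\<omega>. (1 + c) * (norm (V \<omega>))\<^sup>2 + 2 * (V \<omega> \<bullet> ?S \<omega>) + (2 + 1 / c) * (norm (?R \<omega>))\<^sup>2 + 2 * (norm (?S \<omega>))\<^sup>2"
  have iB: "integrable M ?B"
    by (intro Bochner_Integration.integrable_add integrable_mult_right iV iVS iR iS)
  have le: "AE \<omega> in M. (norm (E' \<omega>))\<^sup>2 \<le> ?B \<omega>"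
    using E' by eventually_elim (simp only: norm_square_expand[OF c])
  have iE: "integrable M (\<lambda>\<omega>. (norm (E' \<omega>))\<^sup>2)"
    by (rule Bochner_Integration.integrable_bound[OF iB]) (use le in \<open>auto elim!: eventually_mono\<close>)
  have contrV: "(\<integral>\<omega>. (norm (V \<omega>))\<^sup>2 \<partial>M) \<le> (1 - a * h) * (\<integral>\<omega>. (norm (X k t \<omega> - Y \<omega>))\<^sup>2 \<partial>M)"
  proof -
    have "(\<integral>\<omega>. (norm (V \<omega>))\<^sup>2 \<partial>M) \<le> (\<integral>\<omega>. (1 - a * h) * (norm (X k t \<omega> - Y \<omega>))\<^sup>2 \<partial>M)"
    proof (rule integral_mono_AE[OF iV integrable_mult_right[OF int]])
      show "AE \<omega> in M. (norm (V \<omega>))\<^sup>2 \<le> (1 - a * h) * (norm (X k t \<omega> - Y \<omega>))\<^sup>2"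
        using Z(2) by eventually_elim (simp add: V_def contr)
    qed
    then show ?thesis by simp
  qed
  let ?e = "\<integral>\<omega>. (norm (X k t \<omega> - Y \<omega>))\<^sup>2 \<partial>M"
  have e0: "0 \<le> ?e" by simp
  have "(\<integral>\<omega>. (norm (E' \<omega>))\<^sup>2 \<partial>M) \<le> (\<integral>\<omega>. ?B \<omega> \<partial>M)"
    by (rule integral_mono_AE[OF iE iB le])
  also have "\<dots> = (1 + c) * (\<integral>\<omega>. (norm (V \<omega>))\<^sup>2 \<partial>M) + (2 + 1 / c) * (\<integral>\<omega>. (norm (?R \<omega>))\<^sup>2 \<partial>M)
      + 2 * (\<integral>\<omega>. (norm (?S \<omega>))\<^sup>2 \<partial>M)"
    using iV iVS iR iS VS by simp
  also have "\<dots> \<le> (1 + c) * ((1 - a * h) * ?e) + (2 + 1 / c) * (C0 * h ^ 4) + 2 * (C0 * h ^ 3)"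
    using c contrV R S by (intro add_mono mult_left_mono) auto
  \<comment> \<open>The constant collects 2 from the martingale part and 2 + 2/a from the remainder,
    using h^4 <= h^3.\<close>
  also have "\<dots> \<le> (1 - a * h / 2) * ?e + C0 * (4 + 2 / a) * h ^ 3"
  proof -
    have "(1 + c) * (1 - a * h) \<le> 1 - a * h / 2"
      using zero_le_power2[of "a * h"] by (simp add: c_def power2_eq_square algebra_simps)
    then have 1: "(1 + c) * ((1 - a * h) * ?e) \<le> (1 - a * h / 2) * ?e"
      unfolding mult.assoc[symmetric] by (rule mult_right_mono) (rule e0)
    have "1 / c * h = 2 / a" using h a_pos by (simp add: c_def)
    moreover have "h ^ 4 = h * h ^ 3" by (simp add: power4_eq_xxxx power3_eq_cube)
    ultimately have "1 / c * h ^ 4 = (2 / a) * h ^ 3" by (simp only: mult.assoc[symmetric])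
    then have "(2 + 1 / c) * (C0 * h ^ 4) = C0 * (2 * h ^ 4 + (2 / a) * h ^ 3)"
      by (simp only: distrib_right distrib_left mult.left_commute[of _ C0])
    also have "\<dots> \<le> C0 * (2 * h ^ 3 + (2 / a) * h ^ 3)"
      using h C0 by (intro mult_left_mono add_right_mono power_decreasing) auto
    finally show ?thesis using 1 by (simp add: algebra_simps)
  qed
  finally show ?thesis using iE by blast
qed

text \<open>The step size restriction enters only as the contraction hypothesis, so that the
  constant is fixed before h, k, j and the scheme are chosen.\<close>

lemma global_error:
  assumes \<gamma>: "1 \<le> \<gamma>" and init: "\<And>k. \<xi> k \<in> borel_measurable (past (T k))"
  obtains C where "0 \<le> C"
    "\<And>k j h Y. 0 < h \<Longrightarrow> h < 1 \<Longrightarrow>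
       (\<And>t x y. (norm (euler_map \<gamma> h t x - euler_map \<gamma> h t y))\<^sup>2 \<le> (1 - a * h) * (norm (x - y))\<^sup>2) \<Longrightarrow>
       euler_scheme \<gamma> h k Y \<Longrightarrow>
       (\<integral>\<^sup>+ \<omega>. ennreal ((norm (X k (T k + real j * h) \<omega> - Y j \<omega>))\<^sup>2) \<partial>M) \<le> ennreal (C * h\<^sup>2)"
proof -
  obtain C0 where C0: "0 \<le> C0"
    "\<And>k t h. T k \<le> t \<Longrightarrow> 0 < h \<Longrightarrow> h < 1 \<Longrightarrow> (\<integral>\<^sup>+ \<omega>. ennreal ((norm (remainder \<gamma> k t h \<omega>))\<^sup>2) \<partial>M) \<le> ennreal (C0 * h ^ 4)"
    "\<And>k t h. T k \<le> t \<Longrightarrow> 0 < h \<Longrightarrow> h < 1 \<Longrightarrow> (\<integral>\<^sup>+ \<omega>. ennreal ((norm (martingale_part k t h \<omega>))\<^sup>2) \<partial>M) \<le> ennreal (C0 * h ^ 3)"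
    using local_error[OF \<gamma>] by blast
  define D where "D = C0 * (4 + 2 / a)"
  \<comment> \<open>C h^2 is the fixed point of u -> (1 - a h / 2) u + D h^3, hence an invariant
    bound for the recursion, which starts at 0.\<close>
  define C where "C = 2 * D / a"
  have C: "0 \<le> C" using C0(1) a_pos by (simp add: C_def D_def)
  show ?thesis
  proof (rule that[OF C])
    fix k j h Y
    assume h: "0 < h" "h < 1"
      and contr: "\<And>t x y. (norm (euler_map \<gamma> h t x - euler_map \<gamma> h t y))\<^sup>2 \<le> (1 - a * h) * (norm (x - y))\<^sup>2"
      and Y: "euler_scheme \<gamma> h k Y"
    \<comment> \<open>The contraction hypothesis itself forces this: its left side is nonnegative
      for two points at distance one.\<close>
    have ah: "a * h \<le> 1"
    proof -
      have "0 \<le> (1 - a * h) * (norm (axis undefined 1 - 0 :: real ^ 'd))\<^sup>2"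
        using contr[of 0 "axis undefined 1" 0] by (meson order.trans zero_le_power2)
      then show ?thesis by (simp add: norm_axis_1)
    qed
    define e where "e i \<omega> = X k (T k + real i * h) \<omega> - Y i \<omega>" for i \<omega>
    have "integrable M (\<lambda>\<omega>. (norm (e i \<omega>))\<^sup>2) \<and> (\<integral>\<omega>. (norm (e i \<omega>))\<^sup>2 \<partial>M) \<le> C * h\<^sup>2" for i
    proof (induction i)
      case 0
      have "AE \<omega> in M. X k (T k) \<omega> = \<xi> k \<omega>" using solution[of k] unfolding sde_solution_def by blast
      then have z: "AE \<omega> in M. (norm (e 0 \<omega>))\<^sup>2 = 0"
        by eventually_elim (use Y in \<open>simp add: e_def euler_scheme_def\<close>)
      have m: "e 0 \<in> borel_measurable M"
        unfolding e_def[abs_def]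
        by (intro borel_measurable_diff X_measurable past_measurable[OF euler_scheme_past_measurable[OF Y h(1) init]]) auto
      have "integrable M (\<lambda>\<omega>. (norm (e 0 \<omega>))\<^sup>2)"
        by (rule integrable_cong_AE_imp[of M "\<lambda>_. 0"]) (use z m in \<open>auto elim!: eventually_mono\<close>)
      moreover have "(\<integral>\<omega>. (norm (e 0 \<omega>))\<^sup>2 \<partial>M) = 0"
        by (rule integral_eq_zero_AE[OF z])
      ultimately show ?case using C by simp
    next
      case (Suc i)
      let ?t = "T k + real i * h"
      have t: "T k \<le> ?t" using h by simp
      have t': "?t + h = T k + real (Suc i) * h" by (simp add: algebra_simps)
      have step: "integrable M (\<lambda>\<omega>. (norm (e (Suc i) \<omega>))\<^sup>2) \<and> (\<integral>\<omega>. (norm (e (Suc i) \<omega>))\<^sup>2 \<partial>M) \<le>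
          (1 - a * h / 2) * (\<integral>\<omega>. (norm (e i \<omega>))\<^sup>2 \<partial>M) + C0 * (4 + 2 / a) * h ^ 3"
        using error_step[OF h t contr euler_scheme_past_measurable[OF Y h(1) init, of i] _ C0(1) C0(2)[OF t h] C0(3)[OF t h]]
          Suc Y unfolding t' e_def euler_scheme_def by simp
      moreover have "(1 - a * h / 2) * (\<integral>\<omega>. (norm (e i \<omega>))\<^sup>2 \<partial>M) \<le> (1 - a * h / 2) * (C * h\<^sup>2)"
        using ah a_pos h Suc by (intro mult_left_mono) auto
      moreover have "(1 - a * h / 2) * (C * h\<^sup>2) + D * h ^ 3 = C * h\<^sup>2"
      proof -
        have "(1 - a * h / 2) * (C * h\<^sup>2) = C * h\<^sup>2 - a * C * h ^ 3 / 2"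
          by (simp add: left_diff_distrib power2_eq_square power3_eq_cube)
        moreover have "a * C = 2 * D" using a_pos by (simp add: C_def)
        ultimately show ?thesis by simp
      qed
      ultimately show ?case unfolding D_def[symmetric] by linarith
    qed
    from this[of j] have i: "integrable M (\<lambda>\<omega>. (norm (e j \<omega>))\<^sup>2)" and le: "(\<integral>\<omega>. (norm (e j \<omega>))\<^sup>2 \<partial>M) \<le> C * h\<^sup>2" by auto
    show "(\<integral>\<^sup>+ \<omega>. ennreal ((norm (X k (T k + real j * h) \<omega> - Y j \<omega>))\<^sup>2) \<partial>M) \<le> ennreal (C * h\<^sup>2)"
      using nn_integral_eq_integral[OF i] le by (simp add: e_def ennreal_leI)
  qed
qed

end

section \<open>Contraction of the projected Euler map\<close>

text \<open>The cut-off is the metric projection onto a closed ball, from which it inherits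
  nonexpansiveness.\<close>

lemma proj_eq_closest_point:
  fixes x :: "real ^ 'd"
  assumes "0 < h"
  shows "proj \<gamma> h x = closest_point (cball 0 (h powr (- (1 / (2 * \<gamma>))))) x"
proof (rule closest_point_unique)
  let ?\<rho> = "h powr (- (1 / (2 * \<gamma>)))"
  have \<rho>: "0 < ?\<rho>" using assms by simp
  show "proj \<gamma> h x \<in> cball 0 ?\<rho>" by (simp add: norm_proj_bound)
  show "\<forall>z\<in>cball 0 ?\<rho>. dist x (proj \<gamma> h x) \<le> dist x z"
  proof
    fix z :: "real ^ 'd" assume z: "z \<in> cball 0 ?\<rho>"
    show "dist x (proj \<gamma> h x) \<le> dist x z"
    proof (cases "norm x \<le> ?\<rho>")
      case True
      then have "proj \<gamma> h x = x" by (auto simp: proj_def min_def field_simps)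
      then show ?thesis by simp
    next
      case False
      then have x: "?\<rho> < norm x" "0 < norm x" using \<rho> by linarith+
      then have "?\<rho> * inverse (norm x) < 1" by (simp add: field_simps)
      then have "x - proj \<gamma> h x = (1 - ?\<rho> * inverse (norm x)) *\<^sub>R x"
        using x by (simp add: proj_def min_def algebra_simps)
      then have "dist x (proj \<gamma> h x) = (1 - ?\<rho> * inverse (norm x)) * norm x"
        using \<open>?\<rho> * inverse (norm x) < 1\<close> by (simp add: dist_norm)
      also have "\<dots> = norm x - ?\<rho>" using x by (simp add: left_diff_distrib mult.assoc)
      also have "\<dots> \<le> norm x - norm z" using z by simp
      also have "\<dots> \<le> dist x z" by (simp add: dist_norm norm_triangle_ineq2)
      finally show ?thesis .
    qed
  qed
qed auto

lemma proj_nonexpansive: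
  fixes x y :: "real ^ 'd"
  assumes "0 < h"
  shows "norm (proj \<gamma> h x - proj \<gamma> h y) \<le> norm (x - y)"
  using closest_point_lipschitz[of "cball 0 (h powr (- (1 / (2 * \<gamma>))))" x y] assms
  by (simp add: proj_eq_closest_point[OF assms] dist_norm)

lemma rpow_le:
  assumes "0 \<le> r" "r \<le> u" "1 \<le> u" "0 \<le> e"
  shows "rpow r e \<le> u powr e"
proof (cases "e = 0")
  case True
  then show ?thesis using assms by (simp add: rpow_def)
next
  case False
  then show ?thesis using assms by (simp add: rpow_def powr_mono2)
qed

text \<open>In the ball of radius \<rho> = h^(-1/(2 \<gamma>)) the drift A + F has Lipschitz
  constant at most (\<Lambda> + 3 C1) \<rho>^(\<gamma> - 1). When the square is expanded,
  dissipativity contributes -2 a h and the quadratic term, by \<open>small\<close>, at most a h; the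
  balance is the stated rate.\<close>

lemma euler_contraction:
  fixes A :: "real ^ 'd ^ 'd" and F :: "real ^ 'd \<Rightarrow> real ^ 'd"
  assumes h: "0 < h" "h < 1" and \<gamma>: "1 \<le> \<gamma>" and C1: "0 < C1" and \<Lambda>: "0 \<le> \<Lambda>" and a: "0 < a"
    and AL: "\<And>x. norm (A *v x) \<le> \<Lambda> * norm x"
    and lip: "\<And>x y. norm (F x - F y) \<le> C1 * (1 + rpow (norm x) (\<gamma> - 1) + rpow (norm y) (\<gamma> - 1)) * norm (x - y)"
    and dissip: "\<And>x y. (x - y) \<bullet> (A *v (x - y) + F x - F y) \<le> - a * (norm (x - y))\<^sup>2"
    and small: "h powr (1 / \<gamma>) * (\<Lambda> + 3 * C1)\<^sup>2 \<le> a"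
  defines "\<Psi> \<equiv> \<lambda>x. proj \<gamma> h x + h *\<^sub>R (A *v proj \<gamma> h x) + h *\<^sub>R F (proj \<gamma> h x)"
  shows "(norm (\<Psi> x - \<Psi> y))\<^sup>2 \<le> (1 - a * h) * (norm (x - y))\<^sup>2"
proof -
  define \<rho> where "\<rho> = h powr (- (1 / (2 * \<gamma>)))"
  have \<rho>1: "1 \<le> \<rho>" using h \<gamma> by (simp add: \<rho>_def powr_minus one_le_inverse_iff powr_le1)
  define q where "q = \<rho> powr (\<gamma> - 1)"
  have q1: "1 \<le> q" using \<rho>1 \<gamma> by (simp add: q_def ge_one_powr_ge_zero)
  \<comment> \<open>The exponent of the cut-off radius is made for this identity: h \<rho>^(2
    (\<gamma> - 1)) = h^(1/\<gamma>).\<close>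
  have q2: "h * q\<^sup>2 = h powr (1 / \<gamma>)"
  proof -
    have "q\<^sup>2 = h powr (- (1 / (2 * \<gamma>)) * (\<gamma> - 1) * 2)"
      using h by (simp add: q_def \<rho>_def powr_powr powr_power mult.commute)
    also have "- (1 / (2 * \<gamma>)) * (\<gamma> - 1) * 2 = 1 / \<gamma> - 1" using \<gamma> by (simp add: field_simps)
    finally have "h * q\<^sup>2 = h powr 1 * h powr (1 / \<gamma> - 1)" using h by simp
    also have "\<dots> = h powr (1 + (1 / \<gamma> - 1))" by (rule powr_add[symmetric])
    also have "1 + (1 / \<gamma> - 1) = 1 / \<gamma>" by simp
    finally show ?thesis .
  qed
  have ball: "(norm ((u + h *\<^sub>R (A *v u) + h *\<^sub>R F u) - (v + h *\<^sub>R (A *v v) + h *\<^sub>R F v)))\<^sup>2 \<le> (1 - a * h) * (norm (u - v))\<^sup>2"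
    if u: "norm u \<le> \<rho>" and v: "norm v \<le> \<rho>" for u v
  proof -
    define D where "D = A *v (u - v) + F u - F v"
    have "norm (F u - F v) \<le> C1 * (1 + rpow (norm u) (\<gamma> - 1) + rpow (norm v) (\<gamma> - 1)) * norm (u - v)" by (rule lip)
    also have "\<dots> \<le> C1 * (q + q + q) * norm (u - v)"
      using u v \<rho>1 q1 C1 \<gamma> unfolding q_def
      by (intro mult_right_mono mult_left_mono add_mono rpow_le) auto
    finally have Fb: "norm (F u - F v) \<le> 3 * C1 * q * norm (u - v)" by simp
    have "\<Lambda> * norm (u - v) \<le> \<Lambda> * (q * norm (u - v))"
      using \<Lambda> q1 by (intro mult_left_mono) (auto simp: mult_le_cancel_right1)
    then have Ab: "norm (A *v (u - v)) \<le> \<Lambda> * q * norm (u - v)" using AL[of "u - v"] by simp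
    have "norm D \<le> (\<Lambda> + 3 * C1) * q * norm (u - v)"
      using norm_triangle_ineq[of "A *v (u - v)" "F u - F v"] Fb Ab by (simp add: D_def algebra_simps)
    then have "(norm D)\<^sup>2 \<le> ((\<Lambda> + 3 * C1) * q * norm (u - v))\<^sup>2" by (intro power_mono) auto
    then have "h\<^sup>2 * (norm D)\<^sup>2 \<le> h\<^sup>2 * ((\<Lambda> + 3 * C1) * q * norm (u - v))\<^sup>2" by (intro mult_left_mono) auto
    also have "\<dots> = h * ((h * q\<^sup>2) * (\<Lambda> + 3 * C1)\<^sup>2) * (norm (u - v))\<^sup>2"
      by (simp add: power_mult_distrib power2_eq_square)
    also have "\<dots> \<le> h * a * (norm (u - v))\<^sup>2"
      unfolding q2 using h small by (intro mult_right_mono mult_left_mono) auto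
    finally have Db: "h\<^sup>2 * (norm D)\<^sup>2 \<le> h * a * (norm (u - v))\<^sup>2" .
    have gen: "(norm (w + h *\<^sub>R D))\<^sup>2 = (norm w)\<^sup>2 + 2 * h * (w \<bullet> D) + h\<^sup>2 * (norm D)\<^sup>2" for w
      by (simp only: power2_norm_eq_inner inner_add_left inner_add_right inner_scaleR_left inner_scaleR_right inner_commute[of D w])
         (simp add: power2_eq_square distrib_left mult.assoc)
    have "(u + h *\<^sub>R (A *v u) + h *\<^sub>R F u) - (v + h *\<^sub>R (A *v v) + h *\<^sub>R F v) = (u - v) + h *\<^sub>R D"
      by (simp add: D_def matrix_vector_mult_diff_distrib algebra_simps)
    then have "(norm ((u + h *\<^sub>R (A *v u) + h *\<^sub>R F u) - (v + h *\<^sub>R (A *v v) + h *\<^sub>R F v)))\<^sup>2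
       = (norm (u - v))\<^sup>2 + 2 * h * ((u - v) \<bullet> D) + h\<^sup>2 * (norm D)\<^sup>2"
      by (simp only: gen)
    also have "\<dots> \<le> (norm (u - v))\<^sup>2 + 2 * h * (- a * (norm (u - v))\<^sup>2) + h * a * (norm (u - v))\<^sup>2"
      using Db dissip[of u v] h by (intro add_mono mult_left_mono order.refl) (auto simp: D_def)
    finally show ?thesis by (simp add: algebra_simps)
  qed
  \<comment> \<open>Follows from \<open>ball\<close> at 0 and a unit vector, which lies in the ball
    since \<rho> >= 1. With a nonnegative factor the projected distance may be replaced by the
    distance of x and y.\<close>
  have ah: "0 \<le> 1 - a * h"
  proof -
    have "0 \<le> (1 - a * h) * (norm (axis undefined 1 - 0 :: real ^ 'd))\<^sup>2"
      by (rule order.trans[OF zero_le_power2 ball]) (use \<rho>1 in \<open>auto simp: norm_axis_1\<close>)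
    then show ?thesis by (simp add: norm_axis_1)
  qed
  have "(norm (\<Psi> x - \<Psi> y))\<^sup>2 \<le> (1 - a * h) * (norm (proj \<gamma> h x - proj \<gamma> h y))\<^sup>2"
    unfolding \<Psi>_def by (rule ball) (auto simp: \<rho>_def norm_proj_bound)
  also have "\<dots> \<le> (1 - a * h) * (norm (x - y))\<^sup>2"
    using ah h by (intro mult_left_mono power_mono proj_nonexpansive) auto
  finally show ?thesis .
qed

text \<open>With q = (p + 1)/2 the restriction reads h < (a / ((1 + \<mu>) \<kappa>^2))^q. Taking
  the q-th root gives h^(1/q) \<kappa>^2 < a / (1 + \<mu>), and \<gamma> < q with h < 1 permits the
  larger exponent 1/\<gamma>.\<close>

lemma step_size_bound:
  fixes a \<kappa> \<mu> p \<gamma> h :: real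
  assumes h: "0 < h" "h < 1" and \<gamma>: "1 \<le> \<gamma>" "\<gamma> < (p + 1) / 2" and a: "0 < a" and \<kappa>: "0 < \<kappa>" and \<mu>: "0 < \<mu>"
    and hle: "h < a powr ((p + 1) / 2) / ((1 + \<mu>) powr ((p + 1) / 2) * \<kappa> powr (p + 1))"
  shows "h powr (1 / \<gamma>) * \<kappa>\<^sup>2 \<le> a"
proof -
  define q where "q = (p + 1) / 2"
  have q: "0 < q" "\<gamma> < q" using \<gamma> by (auto simp: q_def)
  have "p + 1 = 2 * q" by (simp add: q_def add_divide_distrib distrib_left)
  then have "\<kappa> powr (p + 1) = \<kappa> powr (2 * q)" by simp
  also have "\<dots> = (\<kappa>\<^sup>2) powr q"
    using \<kappa> by (simp only: powr_powr[symmetric]) simp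
  finally have "\<kappa> powr (p + 1) = (\<kappa>\<^sup>2) powr q" .
  then have "h < (a / ((1 + \<mu>) * \<kappa>\<^sup>2)) powr q"
    using hle a \<mu> \<kappa> by (simp add: q_def[symmetric] powr_divide powr_mult)
  then have "h powr (1 / q) < ((a / ((1 + \<mu>) * \<kappa>\<^sup>2)) powr q) powr (1 / q)"
    using h q by (intro powr_less_mono2) auto
  also have "\<dots> = a / ((1 + \<mu>) * \<kappa>\<^sup>2)" using q a \<mu> \<kappa> by (simp add: powr_powr)
  also have "\<dots> = (a / (1 + \<mu>)) / \<kappa>\<^sup>2" by simp
  finally have lt: "h powr (1 / q) < (a / (1 + \<mu>)) / \<kappa>\<^sup>2" .
  have "0 < \<kappa>\<^sup>2" using \<kappa> by simp
  from lt[unfolded pos_less_divide_eq[OF this]]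
  have "h powr (1 / q) * \<kappa>\<^sup>2 \<le> a / (1 + \<mu>)" by (rule less_imp_le)
  also have "\<dots> \<le> a" using a \<mu> by (simp add: field_simps)
  finally have 1: "h powr (1 / q) * \<kappa>\<^sup>2 \<le> a" .
  have "h powr (1 / \<gamma>) \<le> h powr (1 / q)"
    using h q \<gamma> by (intro powr_mono') (auto simp: field_simps)
  then have "h powr (1 / \<gamma>) * \<kappa>\<^sup>2 \<le> h powr (1 / q) * \<kappa>\<^sup>2" by (intro mult_right_mono) auto
  with 1 show ?thesis by linarith
qed

section \<open>Periodicity, spectral bounds and the main result\<close>

lemma periodic_shift_int:
  fixes \<phi> :: "real \<Rightarrow> 'a"
  assumes per: "\<And>t. \<phi> (t + \<tau>) = \<phi> t"
  shows "\<phi> (t + of_int n * \<tau>) = \<phi> t"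
proof -
  have nat: "\<phi> (t + real n * \<tau>) = \<phi> t" for n t
  proof (induction n)
    case (Suc n)
    have "\<phi> (t + real (Suc n) * \<tau>) = \<phi> ((t + real n * \<tau>) + \<tau>)" by (simp add: algebra_simps)
    then show ?case using per Suc by simp
  qed simp
  show ?thesis
  proof (cases "0 \<le> n")
    case True
    then show ?thesis using nat[of t "nat n"] by simp
  next
    case False
    then show ?thesis using nat[of "t + of_int n * \<tau>" "nat (- n)"] by simp
  qed
qed

lemma floor_period:
  fixes t \<tau> :: real
  assumes "0 < \<tau>"
  shows "of_int \<lfloor>t / \<tau>\<rfloor> * \<tau> \<le> t" and "t < of_int \<lfloor>t / \<tau>\<rfloor> * \<tau> + \<tau>"
proof -
  have "of_int \<lfloor>t / \<tau>\<rfloor> \<le> t / \<tau>" "t / \<tau> < of_int \<lfloor>t / \<tau>\<rfloor> + 1" by linarith+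
  from this[unfolded pos_le_divide_eq[OF assms] pos_divide_less_eq[OF assms]]
  show "of_int \<lfloor>t / \<tau>\<rfloor> * \<tau> \<le> t" "t < of_int \<lfloor>t / \<tau>\<rfloor> * \<tau> + \<tau>"
    by (simp_all add: distrib_right)
qed

lemma reduce_to_period:
  fixes t \<tau> :: real
  assumes "0 < \<tau>"
  obtains n :: int where "t + of_int n * \<tau> \<in> {0..<\<tau>}"
proof
  show "t + of_int (- \<lfloor>t / \<tau>\<rfloor>) * \<tau> \<in> {0..<\<tau>}"
    using floor_period[OF assms, of t] by simp
qed

text \<open>Continuity adds the right endpoint, so that neighbouring closed periods share a point;
  gluing the finitely many periods that cover an interval keeps the constant.\<close>

lemma periodic_lipschitz:
  fixes \<phi> :: "real \<Rightarrow> 'e::real_normed_vector"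
  assumes \<tau>: "0 < \<tau>" and per: "\<And>t. \<phi> (t + \<tau>) = \<phi> t" and cont: "continuous_on UNIV \<phi>"
    and lip: "\<And>s t. s \<in> {0..<\<tau>} \<Longrightarrow> t \<in> {0..<\<tau>} \<Longrightarrow> norm (\<phi> t - \<phi> s) \<le> L * \<bar>t - s\<bar>" and L: "0 \<le> L"
  shows "norm (\<phi> t - \<phi> s) \<le> L * \<bar>t - s\<bar>"
proof -
  have "L-lipschitz_on {0..<\<tau>} \<phi>"
    by (intro lipschitz_onI L) (use lip in \<open>auto simp: dist_norm\<close>)
  then have "L-lipschitz_on (closure {0..<\<tau>}) \<phi>"
    by (rule lipschitz_on_closure) (rule continuous_on_subset[OF cont], simp)
  then have base: "L-lipschitz_on {0..\<tau>} \<phi>" using \<tau> by simp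
  have piece: "L-lipschitz_on {of_int n * \<tau>..of_int n * \<tau> + \<tau>} \<phi>" for n :: int
  proof (intro lipschitz_onI L)
    fix x y assume xy: "x \<in> {of_int n * \<tau>..of_int n * \<tau> + \<tau>}" "y \<in> {of_int n * \<tau>..of_int n * \<tau> + \<tau>}"
    have "\<phi> z = \<phi> (z - of_int n * \<tau>)" for z
      using periodic_shift_int[of \<phi> \<tau> "z - of_int n * \<tau>" n, OF per] by simp
    then have "dist (\<phi> x) (\<phi> y) = dist (\<phi> (x - of_int n * \<tau>)) (\<phi> (y - of_int n * \<tau>))" by metis
    also have "\<dots> \<le> L * dist (x - of_int n * \<tau>) (y - of_int n * \<tau>)"
      using xy by (intro lipschitz_onD[OF base]) auto
    finally show "dist (\<phi> x) (\<phi> y) \<le> L * dist x y" by (simp add: dist_real_def)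
  qed
  have ordered: "norm (\<phi> t - \<phi> s) \<le> L * \<bar>t - s\<bar>" if "s \<le> t" for s t
  proof -
    have "L-lipschitz_on {s..t} \<phi>"
    proof (rule lipschitz_on_closed_Union[where I = "{\<lfloor>s / \<tau>\<rfloor>..\<lfloor>t / \<tau>\<rfloor>}" and U = "\<lambda>n. {of_int n * \<tau>..of_int n * \<tau> + \<tau>}"])
      show "{s..t} \<subseteq> (\<Union>n\<in>{\<lfloor>s / \<tau>\<rfloor>..\<lfloor>t / \<tau>\<rfloor>}. {of_int n * \<tau>..of_int n * \<tau> + \<tau>})"
      proof
        fix r assume r: "r \<in> {s..t}"
        have "\<lfloor>r / \<tau>\<rfloor> \<in> {\<lfloor>s / \<tau>\<rfloor>..\<lfloor>t / \<tau>\<rfloor>}"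
          using r \<tau> by (auto intro!: floor_mono divide_right_mono)
        moreover have "r \<in> {of_int \<lfloor>r / \<tau>\<rfloor> * \<tau>..of_int \<lfloor>r / \<tau>\<rfloor> * \<tau> + \<tau>}"
          using floor_period[OF \<tau>, of r] by simp
        ultimately show "r \<in> (\<Union>n\<in>{\<lfloor>s / \<tau>\<rfloor>..\<lfloor>t / \<tau>\<rfloor>}. {of_int n * \<tau>..of_int n * \<tau> + \<tau>})" by blast
      qed
    qed (auto intro: piece L)
    then have "dist (\<phi> t) (\<phi> s) \<le> L * dist t s" by (rule lipschitz_onD) (use that in auto)
    then show ?thesis by (simp add: dist_norm dist_real_def)
  qed
  show ?thesis
    using ordered[of s t] ordered[of t s] by (cases "s \<le> t") (auto simp: norm_minus_commute abs_minus_commute)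
qed

text \<open>Parseval's identity in the eigenbasis: both quantities are weighted sums of squared
  coefficients, compared with the smallest and the largest eigenvalue of -A.\<close>

lemma eigenbasis_bounds:
  fixes A :: "real ^ 'd ^ 'd" and e :: "nat \<Rightarrow> real ^ 'd" and lam :: "nat \<Rightarrow> real"
  assumes orth: "\<And>i j. i \<in> {1..CARD('d)} \<Longrightarrow> j \<in> {1..CARD('d)} \<Longrightarrow> e i \<bullet> e j = (if i = j then 1 else 0)"
    and span: "span (e ` {1..CARD('d)}) = UNIV"
    and eig: "\<And>i. i \<in> {1..CARD('d)} \<Longrightarrow> A *v e i = - lam i *\<^sub>R e i"
    and pos: "\<And>i. i \<in> {1..CARD('d)} \<Longrightarrow> 0 < lam i" and mono: "mono_on {1..CARD('d)} lam"
  shows "x \<bullet> (A *v x) \<le> - lam 1 * (norm x)\<^sup>2" and "norm (A *v x) \<le> lam CARD('d) * norm x"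
proof -
  let ?I = "{1..CARD('d)}"
  have d: "1 \<in> ?I" "CARD('d) \<in> ?I" using zero_less_card_finite[where 'a = 'd] by (auto simp: Suc_le_eq)
  have inj: "inj_on e ?I"
  proof (rule inj_onI)
    fix i j assume ij: "i \<in> ?I" "j \<in> ?I" "e i = e j"
    then have "e i \<bullet> e j = 1" using orth[of i i] by simp
    then show "i = j" using orth[OF ij(1,2)] by (auto split: if_splits)
  qed
  have expand: "y = (\<Sum>i\<in>?I. (y \<bullet> e i) *\<^sub>R e i)" for y
  proof -
    have "(\<Sum>b\<in>e ` ?I. (y \<bullet> b) *\<^sub>R b) = y"
    proof (rule orthonormal_basis_expand)
      show "pairwise orthogonal (e ` ?I)"
        by (auto simp: pairwise_def orthogonal_def orth)
      show "norm b = 1" if "b \<in> e ` ?I" for b using that orth by (auto simp: norm_eq_sqrt_inner)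
    qed (use span in auto)
    then show ?thesis using inj by (simp add: sum.reindex)
  qed
  have dot: "(\<Sum>i\<in>?I. b i *\<^sub>R e i) \<bullet> (\<Sum>i\<in>?I. c i *\<^sub>R e i) = (\<Sum>i\<in>?I. b i * c i)" for b c
  proof -
    have "(\<Sum>i\<in>?I. b i *\<^sub>R e i) \<bullet> (\<Sum>i\<in>?I. c i *\<^sub>R e i) = (\<Sum>i\<in>?I. \<Sum>j\<in>?I. b i * (c j * (e i \<bullet> e j)))"
      unfolding inner_sum_left by (intro sum.cong refl) (simp add: inner_sum_right mult.left_commute)
    also have "\<dots> = (\<Sum>i\<in>?I. \<Sum>j\<in>?I. if i = j then b i * c i else 0)"
      by (intro sum.cong refl) (auto simp: orth)
    finally show ?thesis by simp
  qed
  define c where "c i = x \<bullet> e i" for i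
  have x: "x = (\<Sum>i\<in>?I. c i *\<^sub>R e i)" unfolding c_def by (rule expand)
  have "A *v x = (\<Sum>i\<in>?I. c i *\<^sub>R (A *v e i))"
    unfolding x by (simp add: linear_sum[OF matrix_vector_mul_linear] linear_scale[OF matrix_vector_mul_linear])
  also have "\<dots> = (\<Sum>i\<in>?I. (- (lam i * c i)) *\<^sub>R e i)"
    by (intro sum.cong refl) (simp add: eig mult.commute)
  finally have Ax: "A *v x = (\<Sum>i\<in>?I. (- (lam i * c i)) *\<^sub>R e i)" .
  have nx: "(norm x)\<^sup>2 = (\<Sum>i\<in>?I. c i * c i)"
    unfolding power2_norm_eq_inner by (subst (1 2) x) (rule dot)
  have "x \<bullet> (A *v x) = (\<Sum>i\<in>?I. c i * (- (lam i * c i)))"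
    unfolding Ax by (subst x) (rule dot)
  also have "\<dots> \<le> (\<Sum>i\<in>?I. - lam 1 * (c i * c i))"
  proof (intro sum_mono)
    fix i assume "i \<in> ?I"
    then have "lam 1 \<le> lam i" using d by (intro mono_onD[OF mono]) auto
    then have "lam 1 * (c i * c i) \<le> lam i * (c i * c i)" by (intro mult_right_mono) auto
    then show "c i * (- (lam i * c i)) \<le> - lam 1 * (c i * c i)" by (simp add: mult_ac)
  qed
  also have "\<dots> = - lam 1 * (norm x)\<^sup>2" unfolding nx by (rule sum_distrib_left[symmetric])
  finally show "x \<bullet> (A *v x) \<le> - lam 1 * (norm x)\<^sup>2" .
  have "(norm (A *v x))\<^sup>2 = (\<Sum>i\<in>?I. (- (lam i * c i)) * (- (lam i * c i)))"
    unfolding power2_norm_eq_inner Ax by (rule dot)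
  also have "\<dots> \<le> (\<Sum>i\<in>?I. (lam CARD('d))\<^sup>2 * (c i * c i))"
  proof (intro sum_mono)
    fix i assume i: "i \<in> ?I"
    then have "lam i \<le> lam CARD('d)" using d by (intro mono_onD[OF mono]) auto
    then have "(lam i)\<^sup>2 \<le> (lam CARD('d))\<^sup>2" using pos[OF i] by (intro power_mono) auto
    then have "(lam i)\<^sup>2 * (c i * c i) \<le> (lam CARD('d))\<^sup>2 * (c i * c i)" by (intro mult_right_mono) auto
    then show "(- (lam i * c i)) * (- (lam i * c i)) \<le> (lam CARD('d))\<^sup>2 * (c i * c i)"
      by (simp add: power2_eq_square mult_ac)
  qed
  also have "\<dots> = (lam CARD('d) * norm x)\<^sup>2"
    unfolding power_mult_distrib nx by (rule sum_distrib_left[symmetric])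
  finally show "norm (A *v x) \<le> lam CARD('d) * norm x"
    by (rule power2_le_imp_le) (use pos[OF d(2)] in auto)
qed

text \<open>Mean value inequality for F minus its linearisation along the segment. There 1 + |u| +
  |x| <= 2 (1 + |x| + |z|), the source of the factor 2^n.\<close>

lemma taylor_remainder_bound:
  fixes F :: "real ^ 'd \<Rightarrow> real ^ 'd" and D :: "real ^ 'd \<Rightarrow> real ^ 'd \<Rightarrow> real ^ 'd"
  assumes der: "\<And>x. (F has_derivative D x) (at x)" and C: "0 \<le> C"
    and lip: "\<And>x y z. norm (D x z - D y z) \<le> C * (1 + norm x + norm y) ^ n * norm (x - y) * norm z"
  shows "norm (F (x + z) - F x - D x z) \<le> C * 2 ^ n * (1 + norm x + norm z) ^ n * (norm z)\<^sup>2"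
proof -
  let ?B = "C * (2 * (1 + norm x + norm z)) ^ n * norm z"
  have "norm (F (x + z) - F x - D x (x + z - x)) \<le> norm (x + z - x) * ?B"
  proof (rule differentiable_bound_linearization[where S = "closed_segment x (x + z)" and f' = D and ?x0.0 = x])
    show "x + t *\<^sub>R (x + z - x) \<in> closed_segment x (x + z)" if "t \<in> {0..1}" for t
      using that by (auto simp: in_segment algebra_simps intro!: exI[of _ t])
    show "(F has_derivative D u) (at u within closed_segment x (x + z))" for u
      using der by (rule has_derivative_at_withinI)
    show "onorm (D u - D x) \<le> ?B" if "u \<in> closed_segment x (x + z)" for u
    proof (rule onorm_le)
      fix y
      obtain t where t: "0 \<le> t" "t \<le> 1" "u = (1 - t) *\<^sub>R x + t *\<^sub>R (x + z)" using \<open>u \<in> _\<close> by (auto simp: in_segment)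
      then have u: "u = x + t *\<^sub>R z" by (simp add: algebra_simps)
      have tz: "norm (t *\<^sub>R z) \<le> norm z" using t by (simp add: mult_left_le_one_le)
      have "norm u \<le> norm x + norm z" unfolding u using norm_triangle_ineq[of x "t *\<^sub>R z"] tz by linarith
      then have "1 + norm u + norm x \<le> 2 * (1 + norm x + norm z)"
        using norm_ge_zero[of z] unfolding distrib_left by linarith
      then have pw: "(1 + norm u + norm x) ^ n \<le> (2 * (1 + norm x + norm z)) ^ n" by (intro power_mono) auto
      have "norm ((D u - D x) y) = norm (D u y - D x y)" by simp
      also have "\<dots> \<le> C * (1 + norm u + norm x) ^ n * norm (u - x) * norm y" by (rule lip)
      also have "\<dots> \<le> ?B * norm y"
        using C pw tz by (intro mult_right_mono mult_mono mult_left_mono) (auto simp: u)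
      finally show "norm ((D u - D x) y) \<le> ?B * norm y" .
    qed
  qed simp
  moreover have "norm (x + z - x) * ?B = C * 2 ^ n * (1 + norm x + norm z) ^ n * (norm z)\<^sup>2"
    by (simp only: add_diff_cancel_left' power_mult_distrib power2_eq_square mult_ac)
  ultimately show ?thesis by (simp only: add_diff_cancel_left')
qed

theorem theorem4p5:
  fixes M :: "'w measure"
    and W :: "real \<Rightarrow> 'w \<Rightarrow> real ^ 'm"
    and A :: "real ^ 'd ^ 'd"
    and f :: "real \<Rightarrow> real ^ 'd \<Rightarrow> real ^ 'd"
    and g :: "real \<Rightarrow> real ^ 'm ^ 'd"
    and \<xi> :: "nat \<Rightarrow> 'w \<Rightarrow> real ^ 'd"
    and X :: "nat \<Rightarrow> real \<Rightarrow> 'w \<Rightarrow> real ^ 'd"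
    and lam :: "nat \<Rightarrow> real"
    and \<tau> p1 \<gamma> C1 cf L2 \<mu>1 \<mu>2 :: real
  assumes prob: "prob_space M"
    and compl: "complete_measure M"
    and wiener: "two_sided_wiener M W"
    and A: "assumption_A M \<tau> A lam f (\<lambda>t x. g t) p1 \<gamma> C1 \<xi>"
    and B: "assumption_B \<tau> lam f g p1 \<gamma> cf"
    and init: "\<And>k. \<xi> k \<in> borel_measurable (wiener_filtration M W (- (real k * \<tau>)))"
    and sol: "\<And>k. sde_solution M W A f g (- (real k * \<tau>)) (\<xi> k) (X k)"
    and L2: "L2 = 3 * C1"
    and mu1: "\<mu>1 \<in> {0<..<lam 1 - cf}"
    and mu2: "\<mu>2 > 0"
  shows "\<exists>C>0. \<forall>h \<in> {0<..<Min {(lam 1 - cf) powr ((p1 + 1) / 2)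
                / ((1 + \<mu>2) powr ((p1 + 1) / 2) * (lam CARD('d) + L2) powr (p1 + 1)),
              1 / (lam 1 - cf - \<mu>1),
              1}}.
           (SUP k. SUP j. \<integral>\<^sup>+ \<omega>. ennreal ((norm (X k (- (real k * \<tau>) + real j * h) \<omega>
                - proj_euler W \<tau> A f g \<gamma> h (\<xi> k) k j \<omega>))\<^sup>2) \<partial>M)
             \<le> ennreal (C * h\<^sup>2)"
proof -
  define \<Lambda> where "\<Lambda> = lam CARD('d)"
  have "\<forall>i\<in>{1..CARD('d)}. 0 < lam i" using A unfolding assumption_A_def by (elim conjE)
  then have lam_pos: "\<And>i. i \<in> {1..CARD('d)} \<Longrightarrow> 0 < lam i" by blast
  have lam_mono: "mono_on {1..CARD('d)} lam" using A unfolding assumption_A_def by (elim conjE)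
  have "\<exists>e :: nat \<Rightarrow> real ^ 'd.
        (\<forall>i\<in>{1..CARD('d)}. \<forall>j\<in>{1..CARD('d)}. e i \<bullet> e j = (if i = j then 1 else 0)) \<and>
        span (e ` {1..CARD('d)}) = UNIV \<and>
        (\<forall>i\<in>{1..CARD('d)}. A *v e i = - lam i *\<^sub>R e i)"
    using A unfolding assumption_A_def by (elim conjE)
  then obtain e :: "nat \<Rightarrow> real ^ 'd" where
    e: "\<And>i j. i \<in> {1..CARD('d)} \<Longrightarrow> j \<in> {1..CARD('d)} \<Longrightarrow> e i \<bullet> e j = (if i = j then 1 else 0)"
        "span (e ` {1..CARD('d)}) = UNIV" "\<And>i. i \<in> {1..CARD('d)} \<Longrightarrow> A *v e i = - lam i *\<^sub>R e i"
    by blast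
  have \<tau>: "0 < \<tau>" and C1: "0 < C1" using A unfolding assumption_A_def by auto
  have f_cont: "continuous_on UNIV (\<lambda>(t, x). f t x)" using A unfolding assumption_A_def by (elim conjE)
  have "\<forall>t x. f (t + \<tau>) x = f t x" using A unfolding assumption_A_def by (elim conjE)
  then have f_per: "f (t + \<tau>) = f t" for t by (intro ext) blast
  have "\<forall>t x y. max (norm (f t x - f t y)) (norm (g t - g t))
        \<le> C1 * (1 + rpow (norm x) (\<gamma> - 1) + rpow (norm y) (\<gamma> - 1)) * norm (x - y)"
    using A unfolding assumption_A_def by (elim conjE)
  then have fg_lip: "norm (f t x - f t y) \<le> C1 * (1 + rpow (norm x) (\<gamma> - 1) + rpow (norm y) (\<gamma> - 1)) * norm (x - y)"
    for t x y by (meson max.bounded_iff)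
  have "\<exists>C > 0. \<forall>x. \<forall>s\<in>{0..<\<tau>}. \<forall>t\<in>{0..<\<tau>}. max (norm (f t x - f s x)) (norm (g t - g s))
          \<le> C * (1 + norm x powr \<gamma>) * \<bar>t - s\<bar>"
    using A unfolding assumption_A_def by (elim conjE)
  then obtain Ct where Ct: "0 < Ct" and f_time0: "\<And>x s t. s \<in> {0..<\<tau>} \<Longrightarrow> t \<in> {0..<\<tau>} \<Longrightarrow>
      norm (f t x - f s x) \<le> Ct * (1 + norm x powr \<gamma>) * \<bar>t - s\<bar>"
    by (meson max.bounded_iff)
  have "\<forall>p \<ge> 1. \<exists>Cs > 0. \<forall>k. (\<integral>\<^sup>+ \<omega>. ennreal (norm (\<xi> k \<omega>) powr (2 * p)) \<partial>M) \<le> ennreal Cs"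
    using A unfolding assumption_A_def by (elim conjE)
  then have xi: "\<exists>Cs>0. \<forall>k. (\<integral>\<^sup>+ \<omega>. ennreal (norm (\<xi> k \<omega>) powr (2 * p)) \<partial>M) \<le> ennreal Cs" if "1 \<le> p" for p
    using that by blast
  have g_cont: "continuous_on UNIV g" using B unfolding assumption_B_def by (elim conjE)
  have "\<forall>t. g (t + \<tau>) = g t" using B unfolding assumption_B_def by (elim conjE)
  then have g_per: "g (t + \<tau>) = g t" for t by blast
  have "\<exists>cg > 0. (\<forall>t\<in>{0..<\<tau>}. norm (g t) \<le> cg) \<and>
        (\<forall>t1\<in>{0..<\<tau>}. \<forall>t2\<in>{0..<\<tau>}. norm (g t1 - g t2) \<le> cg * \<bar>t2 - t1\<bar>)"
    using B unfolding assumption_B_def by (elim conjE)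
  then obtain cg where cg: "0 < cg" "\<And>t. t \<in> {0..<\<tau>} \<Longrightarrow> norm (g t) \<le> cg"
        "\<And>s t. s \<in> {0..<\<tau>} \<Longrightarrow> t \<in> {0..<\<tau>} \<Longrightarrow> norm (g s - g t) \<le> cg * \<bar>t - s\<bar>"
    by blast
  have "\<exists>Df :: real \<times> (real ^ 'd) \<Rightarrow> (real \<times> (real ^ 'd)) \<Rightarrow>\<^sub>L (real ^ 'd).
        continuous_on UNIV Df \<and> (\<forall>z. ((\<lambda>(t, x). f t x) has_derivative blinfun_apply (Df z)) (at z))"
    using B unfolding assumption_B_def by (elim conjE)
  then obtain DF :: "real \<times> (real ^ 'd) \<Rightarrow> (real \<times> (real ^ 'd)) \<Rightarrow>\<^sub>L (real ^ 'd)"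
    where DF_cont: "continuous_on UNIV DF" and DF: "\<And>z. ((\<lambda>(t, x). f t x) has_derivative blinfun_apply (DF z)) (at z)"
    by blast
  have \<gamma>: "1 \<le> \<gamma>" "\<gamma> < (p1 + 1) / 2" and cf: "cf < lam 1"
    using B unfolding assumption_B_def by (auto)
  have "\<forall>x y. \<forall>t\<in>{0..<\<tau>}. (x - y) \<bullet> (f t x - f t y) \<le> cf * (norm (x - y))\<^sup>2"
    using B unfolding assumption_B_def by (elim conjE)
  then have f_mono0: "\<And>x y t. t \<in> {0..<\<tau>} \<Longrightarrow> (x - y) \<bullet> (f t x - f t y) \<le> cf * (norm (x - y))\<^sup>2" by blast
  have "\<exists>C > 0. \<forall>x y z. \<forall>t\<in>{0..<\<tau>}.
        norm (frechet_derivative (f t) (at x) z - frechet_derivative (f t) (at y) z)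
          \<le> C * (1 + norm x + norm y) powr (max (\<gamma> - 2) 0) * norm (x - y) * norm z"
    using B unfolding assumption_B_def by (elim conjE)
  then obtain Cb where Cb: "0 < Cb" and D_lip0: "\<And>x y z t. t \<in> {0..<\<tau>} \<Longrightarrow>
        norm (frechet_derivative (f t) (at x) z - frechet_derivative (f t) (at y) z)
          \<le> Cb * (1 + norm x + norm y) powr (max (\<gamma> - 2) 0) * norm (x - y) * norm z"
    by blast
  \<comment> \<open>The state derivative is the total derivative in directions without time
    component. Continuity of the total derivative then bounds it at state 0 over a compact
    period.\<close>
  define Df where "Df t x z = blinfun_apply (DF (t, x)) (0, z)" for t x z
  have Df_der: "(f t has_derivative Df t x) (at x)" for t x
  proof -
    have "((\<lambda>y. (t, y)) has_derivative (\<lambda>z. (0, z))) (at x)"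
      by (auto intro!: derivative_eq_intros)
    from has_derivative_compose[OF this DF[of "(t, x)"]]
    show ?thesis by (simp add: Df_def[abs_def])
  qed
  have Df_eq: "frechet_derivative (f t) (at x) = Df t x" for t x
    by (rule frechet_derivative_at[OF Df_der, symmetric])
  have Df_per: "Df (t + \<tau>) = Df t" for t
    unfolding Df_eq[symmetric, abs_def] f_per ..
  \<comment> \<open>Rounding \<gamma> up allows natural powers. The extra power in \<open>m\<close>
    absorbs the factor |x| that appears when growth is derived from the difference to the value at
    0.\<close>
  define m0 where "m0 = nat \<lceil>\<gamma>\<rceil>"
  define m where "m = Suc m0"
  have m0: "\<gamma> \<le> real m0" by (simp add: m0_def real_nat_ceiling_ge)
  have pow_le: "u powr r \<le> u ^ m0" if "1 \<le> u" "r \<le> \<gamma>" for u r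
  proof -
    have "u powr r \<le> u powr real m0" using that m0 by (intro powr_mono) auto
    then show ?thesis using that by (simp add: powr_realpow)
  qed
  have m0m: "u ^ m0 \<le> u ^ m" if "1 \<le> u" for u :: real
    using that by (intro power_increasing) (auto simp: m_def)
  have f_lip0: "norm (f t x - f t y) \<le> 3 * C1 * (1 + norm x + norm y) ^ m0 * norm (x - y)" for t x y
  proof -
    have r: "rpow (norm u) (\<gamma> - 1) \<le> (1 + norm x + norm y) ^ m0" if "u = x \<or> u = y" for u
      using that \<gamma> by (intro order.trans[OF rpow_le[of "norm u" "1 + norm x + norm y"] pow_le]) auto
    have "norm (f t x - f t y) \<le> C1 * (1 + rpow (norm x) (\<gamma> - 1) + rpow (norm y) (\<gamma> - 1)) * norm (x - y)"
      by (rule fg_lip)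
    also have "\<dots> \<le> C1 * ((1 + norm x + norm y) ^ m0 + (1 + norm x + norm y) ^ m0 + (1 + norm x + norm y) ^ m0) * norm (x - y)"
      using C1 by (intro mult_right_mono mult_left_mono add_mono r) auto
    finally show ?thesis by simp
  qed
  have f_time1: "norm (f t x - f s x) \<le> Ct * (1 + norm x powr \<gamma>) * \<bar>t - s\<bar>" for t s x
  proof (rule periodic_lipschitz[OF \<tau>, of "\<lambda>t. f t x"])
    show "continuous_on UNIV (\<lambda>t. f t x)"
      using continuous_on_compose2[OF f_cont continuous_on_Pair[OF continuous_on_id continuous_on_const]] by simp
    show "norm (f t x - f s x) \<le> Ct * (1 + norm x powr \<gamma>) * \<bar>t - s\<bar>" if "s \<in> {0..<\<tau>}" "t \<in> {0..<\<tau>}" for s t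
      using that by (rule f_time0)
  qed (use f_per Ct in auto)
  have f_time: "norm (f t x - f s x) \<le> 2 * Ct * (1 + norm x) ^ m0 * \<bar>t - s\<bar>" for t s x
  proof -
    have "norm x powr \<gamma> \<le> (1 + norm x) powr \<gamma>" using \<gamma> by (intro powr_mono2) auto
    also have "\<dots> \<le> (1 + norm x) ^ m0" by (rule pow_le) auto
    finally have "norm x powr \<gamma> \<le> (1 + norm x) ^ m0" .
    moreover have "1 \<le> (1 + norm x) ^ m0" by (rule one_le_power) simp
    ultimately have "1 + norm x powr \<gamma> \<le> 2 * (1 + norm x) ^ m0" by linarith
    then have "Ct * (1 + norm x powr \<gamma>) * \<bar>t - s\<bar> \<le> Ct * (2 * (1 + norm x) ^ m0) * \<bar>t - s\<bar>"
      using Ct by (intro mult_right_mono mult_left_mono) auto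
    then show ?thesis using f_time1[of t x s] by (simp add: mult_ac)
  qed
  obtain F0 where F0: "0 < F0" "\<And>t. norm (f t 0) \<le> F0"
  proof -
    have "continuous_on {0..\<tau>} (\<lambda>t. f t 0)"
      by (rule continuous_on_subset[of UNIV])
         (use continuous_on_compose2[OF f_cont continuous_on_Pair[OF continuous_on_id continuous_on_const]] in simp_all)
    then have "bounded ((\<lambda>t. f t 0) ` {0..\<tau>})"
      by (intro compact_imp_bounded compact_continuous_image) auto
    then obtain c where c: "0 < c" "\<And>t. t \<in> {0..\<tau>} \<Longrightarrow> norm (f t 0) \<le> c" by (auto simp: bounded_pos)
    have "norm (f t 0) \<le> c" for t
    proof -
      obtain n where n: "t + of_int n * \<tau> \<in> {0..<\<tau>}" using reduce_to_period[OF \<tau>] .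
      show ?thesis using c(2)[of "t + of_int n * \<tau>"] n periodic_shift_int[of f, OF f_per] by simp
    qed
    then show ?thesis using that c by blast
  qed
  obtain D0 where D0: "0 < D0" "\<And>t z. norm (Df t 0 z) \<le> D0 * norm z"
  proof -
    have "continuous_on {0..\<tau>} (\<lambda>t. DF (t, 0))"
      by (rule continuous_on_compose2[OF DF_cont]) (auto intro!: continuous_intros)
    then have "bounded ((\<lambda>t. DF (t, 0)) ` {0..\<tau>})"
      by (intro compact_imp_bounded compact_continuous_image) auto
    then obtain c where c: "0 < c" "\<And>t. t \<in> {0..\<tau>} \<Longrightarrow> norm (DF (t, 0)) \<le> c" by (auto simp: bounded_pos)
    have "norm (Df t 0 z) \<le> c * norm z" for t z
    proof -
      obtain n where n: "t + of_int n * \<tau> \<in> {0..<\<tau>}" using reduce_to_period[OF \<tau>] .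
      have "Df t 0 z = Df (t + of_int n * \<tau>) 0 z" using periodic_shift_int[of Df, OF Df_per] by simp
      also have "norm \<dots> \<le> norm (DF (t + of_int n * \<tau>, 0)) * norm (0 :: real, z)"
        unfolding Df_def by (rule norm_blinfun)
      also have "\<dots> \<le> c * norm z" using c(2)[of "t + of_int n * \<tau>"] n by (simp add: norm_Pair mult_right_mono)
      finally show ?thesis .
    qed
    then show ?thesis using that c by blast
  qed
  have Df_lip: "norm (Df t x z - Df t y z) \<le> Cb * (1 + norm x + norm y) ^ m0 * norm (x - y) * norm z" for t x y z
  proof -
    obtain n where n: "t + of_int n * \<tau> \<in> {0..<\<tau>}" using reduce_to_period[OF \<tau>] .
    have "Df t = Df (t + of_int n * \<tau>)" using periodic_shift_int[of Df, OF Df_per] by simp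
    then have "norm (Df t x z - Df t y z) \<le> Cb * (1 + norm x + norm y) powr (max (\<gamma> - 2) 0) * norm (x - y) * norm z"
      using D_lip0[OF n, of x z y] unfolding Df_eq by simp
    also have "\<dots> \<le> Cb * (1 + norm x + norm y) ^ m0 * norm (x - y) * norm z"
      using Cb \<gamma> by (intro mult_right_mono mult_left_mono pow_le) auto
    finally show ?thesis .
  qed
  have Df_bound: "norm (Df t x z) \<le> (D0 + Cb) * (1 + norm x) ^ m * norm z" for t x z
  proof -
    have "norm (Df t x z) \<le> norm (Df t 0 z) + norm (Df t x z - Df t 0 z)"
      using norm_triangle_ineq[of "Df t 0 z" "Df t x z - Df t 0 z"] by simp
    also have "\<dots> \<le> D0 * norm z + Cb * (1 + norm x) ^ m0 * norm x * norm z"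
      using D0(2)[of t z] Df_lip[of t x z 0] by simp
    also have "\<dots> \<le> D0 * (1 + norm x) ^ m * norm z + Cb * (1 + norm x) ^ m * norm z"
    proof (intro add_mono mult_right_mono)
      show "D0 \<le> D0 * (1 + norm x) ^ m" using D0(1) one_le_power[of "1 + norm x" m] by simp
      have "(1 + norm x) ^ m0 * norm x \<le> (1 + norm x) ^ m0 * (1 + norm x)" by (intro mult_left_mono) auto
      then have "Cb * ((1 + norm x) ^ m0 * norm x) \<le> Cb * (1 + norm x) ^ m"
        using Cb by (intro mult_left_mono) (auto simp: m_def mult.commute)
      then show "Cb * (1 + norm x) ^ m0 * norm x \<le> Cb * (1 + norm x) ^ m" by (simp add: mult.assoc)
    qed auto
    finally show ?thesis by (simp add: distrib_right)
  qed
  have f_growth: "norm (f t x) \<le> (F0 + 3 * C1) * (1 + norm x) ^ m" for t x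
  proof -
    have "norm (f t x) \<le> norm (f t 0) + norm (f t x - f t 0)"
      using norm_triangle_ineq[of "f t 0" "f t x - f t 0"] by simp
    also have "\<dots> \<le> F0 + 3 * C1 * (1 + norm x) ^ m0 * norm x"
      using F0(2)[of t] f_lip0[of t x 0] by simp
    also have "\<dots> \<le> F0 * (1 + norm x) ^ m + 3 * C1 * (1 + norm x) ^ m"
    proof (intro add_mono)
      show "F0 \<le> F0 * (1 + norm x) ^ m" using F0(1) one_le_power[of "1 + norm x" m] by simp
      have "(1 + norm x) ^ m0 * norm x \<le> (1 + norm x) ^ m0 * (1 + norm x)" by (intro mult_left_mono) auto
      then have "3 * C1 * ((1 + norm x) ^ m0 * norm x) \<le> 3 * C1 * (1 + norm x) ^ m"
        using C1 by (intro mult_left_mono) (auto simp: m_def mult.commute)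
      then show "3 * C1 * (1 + norm x) ^ m0 * norm x \<le> 3 * C1 * (1 + norm x) ^ m" by (simp add: mult.assoc)
    qed
    finally show ?thesis by (simp add: distrib_right)
  qed
  have g_bound: "norm (g t) \<le> cg" for t
  proof -
    obtain n where n: "t + of_int n * \<tau> \<in> {0..<\<tau>}" using reduce_to_period[OF \<tau>] .
    show ?thesis using cg(2)[OF n] periodic_shift_int[of g, OF g_per] by simp
  qed
  have g_lip: "norm (g t - g s) \<le> cg * \<bar>t - s\<bar>" for s t
  proof (rule periodic_lipschitz[OF \<tau> g_per g_cont])
    show "norm (g t - g s) \<le> cg * \<bar>t - s\<bar>" if "s \<in> {0..<\<tau>}" "t \<in> {0..<\<tau>}" for s t
      using cg(3)[OF that] by (simp only: norm_minus_commute)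
  qed (use cg in simp)
  define a where "a = lam 1 - cf"
  have a: "0 < a" using cf by (simp add: a_def)
  note eig = eigenbasis_bounds[OF e lam_pos lam_mono]
  have d: "CARD('d) \<in> {1..CARD('d)}" using zero_less_card_finite[where 'a = 'd] by (auto simp: Suc_le_eq)
  have \<Lambda>: "0 < \<Lambda>" unfolding \<Lambda>_def by (rule lam_pos[OF d])
  have dissip: "(x - y) \<bullet> (A *v (x - y) + f t x - f t y) \<le> - a * (norm (x - y))\<^sup>2" for x y t
  proof -
    obtain n where n: "t + of_int n * \<tau> \<in> {0..<\<tau>}" using reduce_to_period[OF \<tau>] .
    have "f t = f (t + of_int n * \<tau>)" using periodic_shift_int[of f, OF f_per] by simp
    then have "(x - y) \<bullet> (f t x - f t y) \<le> cf * (norm (x - y))\<^sup>2" using f_mono0[OF n, of x y] by simp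
    moreover have "(x - y) \<bullet> (A *v (x - y)) \<le> - lam 1 * (norm (x - y))\<^sup>2" by (rule eig(1))
    moreover have "(x - y) \<bullet> (A *v (x - y) + f t x - f t y) = (x - y) \<bullet> (A *v (x - y)) + (x - y) \<bullet> (f t x - f t y)"
      by (simp only: inner_add_right inner_diff_right add_diff_eq)
    ultimately show ?thesis by (simp add: a_def left_diff_distrib)
  qed
  \<comment> \<open>All summands are positive, so the sum dominates each constant and each
    combination listed next.\<close>
  define K where "K = 3 * C1 + 2 * Ct + F0 + D0 + Cb * 2 ^ m0 + Cb + \<Lambda> + cg"
  have K: "3 * C1 \<le> K" "2 * Ct \<le> K" "F0 + 3 * C1 \<le> K" "D0 + Cb \<le> K" "Cb * 2 ^ m0 \<le> K" "\<Lambda> \<le> K" "cg \<le> K" "0 < K"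
    using C1 Ct F0 D0 Cb \<Lambda> cg by (auto simp: K_def intro!: add_pos_pos add_nonneg_nonneg)
  have Kle: "c * u ^ m0 * v \<le> K * u ^ m * v" if "c \<le> K" "1 \<le> u" "0 \<le> v" for c u v
  proof -
    have "c * u ^ m0 \<le> K * u ^ m0" using that by (intro mult_right_mono) auto
    also have "\<dots> \<le> K * u ^ m" using that K(8) by (intro mult_left_mono m0m) auto
    finally show ?thesis using that by (intro mult_right_mono)
  qed
  have Kle': "c * u ^ m \<le> K * u ^ m" if "c \<le> K" "1 \<le> u" for c u
    using that by (intro mult_right_mono) auto
  interpret wiener M W
    using prob wiener by (simp add: wiener_def wiener_axioms_def)
  have xi_bdd: "bdd_moments M UNIV \<xi>"
  proof (rule bdd_moments_even[OF _ prob])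
    show "\<xi> k \<in> borel_measurable M" for k by (rule past_measurable[OF init])
    fix p :: nat assume p: "1 \<le> p"
    obtain Cs where Cs: "0 < Cs" "\<And>k. (\<integral>\<^sup>+ \<omega>. ennreal (norm (\<xi> k \<omega>) powr (2 * real p)) \<partial>M) \<le> ennreal Cs"
      using xi[of "real p"] p by auto
    \<comment> \<open>Real and natural powers agree even at norm 0, because the exponent is
      positive.\<close>
    have "norm (\<xi> k \<omega>) ^ (2 * p) = norm (\<xi> k \<omega>) powr (2 * real p)" for k \<omega>
      using p powr_realpow'[of "norm (\<xi> k \<omega>)" "2 * p"] by simp
    then show "\<exists>K\<ge>0. \<forall>k\<in>UNIV. (\<integral>\<^sup>+ \<omega>. ennreal (norm (\<xi> k \<omega>) ^ (2 * p)) \<partial>M) \<le> ennreal K"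
      using Cs by (intro exI[of _ Cs]) auto
  qed
  interpret additive_sde M W A f g Df a K m "\<lambda>k. - (real k * \<tau>)" \<xi> X
  proof (intro additive_sde.intro additive_sde_axioms.intro)
    show "wiener M W" by (rule wiener_axioms)
    show "complete_measure M" by (rule compl)
    show "0 < a" "0 < K" by (rule a) (rule K)
    show "continuous_on UNIV (\<lambda>(t, x). f t x)" by (rule f_cont)
    show "(x - y) \<bullet> (A *v (x - y) + f t x - f t y) \<le> - a * (norm (x - y))\<^sup>2" for x y t by (rule dissip)
    show "norm (f t x - f t y) \<le> K * (1 + norm x + norm y) ^ m * norm (x - y)" for t x y
      by (rule order.trans[OF f_lip0 Kle]) (auto simp: K)
    show "norm (f t x - f s x) \<le> K * (1 + norm x) ^ m * \<bar>t - s\<bar>" for t x s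
      by (rule order.trans[OF f_time Kle]) (auto simp: K)
    show "norm (f t x) \<le> K * (1 + norm x) ^ m" for t x
      by (rule order.trans[OF f_growth Kle']) (auto simp: K)
    show "linear (Df t x)" for t x using Df_der has_derivative_linear by blast
    show "norm (Df t x z) \<le> K * (1 + norm x) ^ m * norm z" for t x z
      by (rule order.trans[OF Df_bound mult_right_mono[OF Kle']]) (auto simp: K)
    show "continuous_on UNIV (\<lambda>x. Df t x z)" for t z
      unfolding Df_def by (intro continuous_intros continuous_on_compose2[OF DF_cont]) auto
    show "norm (f t (x + z) - f t x - Df t x z) \<le> K * (1 + norm x + norm z) ^ m * (norm z)\<^sup>2" for t x z
      by (rule order.trans[OF taylor_remainder_bound[OF Df_der _ Df_lip] Kle]) (use Cb in \<open>auto simp: K\<close>)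
    show "norm (A *v x) \<le> K * norm x" for x
      using eig(2)[of x] mult_right_mono[OF K(6), of "norm x"] by (simp add: \<Lambda>_def)
    show "norm (g t) \<le> K" for t using g_bound[of t] K(7) by simp
    show "norm (g t - g s) \<le> K * \<bar>t - s\<bar>" for t s
      using g_lip[of t s] mult_right_mono[OF K(7), of "\<bar>t - s\<bar>"] by simp
    show "sde_solution M W A f g (- (real k * \<tau>)) (\<xi> k) (X k)" for k by (rule sol)
    show "bdd_moments M UNIV \<xi>" by (rule xi_bdd)
  qed
  obtain C where C: "0 \<le> C"
    "\<And>k j h Y. 0 < h \<Longrightarrow> h < 1 \<Longrightarrow>
       (\<And>t x y. (norm (euler_map \<gamma> h t x - euler_map \<gamma> h t y))\<^sup>2 \<le> (1 - a * h) * (norm (x - y))\<^sup>2) \<Longrightarrow>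
       euler_scheme \<gamma> h k Y \<Longrightarrow>
       (\<integral>\<^sup>+ \<omega>. ennreal ((norm (X k (- (real k * \<tau>) + real j * h) \<omega> - Y j \<omega>))\<^sup>2) \<partial>M) \<le> ennreal (C * h\<^sup>2)"
    using global_error[OF \<gamma>(1) init] by blast
  show ?thesis
  \<comment> \<open>C may vanish, while a positive constant is asked for.\<close>
  proof (intro exI[of _ "C + 1"] conjI ballI)
    show "0 < C + 1" using C(1) by simp
    fix h
    assume "h \<in> {0<..<Min {(lam 1 - cf) powr ((p1 + 1) / 2)
                / ((1 + \<mu>2) powr ((p1 + 1) / 2) * (lam CARD('d) + L2) powr (p1 + 1)),
              1 / (lam 1 - cf - \<mu>1), 1}}"
    then have h: "0 < h" "h < 1"
      and hle: "h < a powr ((p1 + 1) / 2) / ((1 + \<mu>2) powr ((p1 + 1) / 2) * (\<Lambda> + 3 * C1) powr (p1 + 1))"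
      by (auto simp: a_def \<Lambda>_def L2)
    have small: "h powr (1 / \<gamma>) * (\<Lambda> + 3 * C1)\<^sup>2 \<le> a"
      using \<Lambda> C1 by (intro step_size_bound[OF h \<gamma> a _ mu2 hle]) auto
    have contr: "(norm (euler_map \<gamma> h t x - euler_map \<gamma> h t y))\<^sup>2 \<le> (1 - a * h) * (norm (x - y))\<^sup>2" for t x y
      unfolding euler_map_def
    proof (rule euler_contraction[OF h \<gamma>(1) C1 _ a _ _ dissip small])
      show "0 \<le> \<Lambda>" using \<Lambda> by simp
      show "norm (A *v x) \<le> \<Lambda> * norm x" for x using eig(2)[of x] by (simp add: \<Lambda>_def)
      show "norm (f t x - f t y) \<le> C1 * (1 + rpow (norm x) (\<gamma> - 1) + rpow (norm y) (\<gamma> - 1)) * norm (x - y)" for x y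
        by (rule fg_lip)
    qed
    have scheme: "euler_scheme \<gamma> h k (proj_euler W \<tau> A f g \<gamma> h (\<xi> k) k)" for k
    proof -
      \<comment> \<open>A shift by -k whole periods turns evaluation at j h into evaluation at the
        true time.\<close>
      have "f (- (real k * \<tau>) + s) = f s" "g (- (real k * \<tau>) + s) = g s" for s
        using periodic_shift_int[of f \<tau> s "- int k", OF f_per] periodic_shift_int[of g \<tau> s "- int k", OF g_per]
        by (simp_all add: add.commute)
      then show ?thesis
        unfolding euler_scheme_def euler_map_def by (simp only: proj_euler.simps Let_def) simp
    qed
    show "(SUP k. SUP j. \<integral>\<^sup>+ \<omega>. ennreal ((norm (X k (- (real k * \<tau>) + real j * h) \<omega>
                - proj_euler W \<tau> A f g \<gamma> h (\<xi> k) k j \<omega>))\<^sup>2) \<partial>M) \<le> ennreal ((C + 1) * h\<^sup>2)"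
    proof (intro SUP_least)
      fix k j
      have "(\<integral>\<^sup>+ \<omega>. ennreal ((norm (X k (- (real k * \<tau>) + real j * h) \<omega>
                - proj_euler W \<tau> A f g \<gamma> h (\<xi> k) k j \<omega>))\<^sup>2) \<partial>M) \<le> ennreal (C * h\<^sup>2)"
        by (rule C(2)[OF h contr scheme])
      also have "\<dots> \<le> ennreal ((C + 1) * h\<^sup>2)" by (intro ennreal_leI mult_right_mono) auto
      finally show "(\<integral>\<^sup>+ \<omega>. ennreal ((norm (X k (- (real k * \<tau>) + real j * h) \<omega>
                - proj_euler W \<tau> A f g \<gamma> h (\<xi> k) k j \<omega>))\<^sup>2) \<partial>M) \<le> ennreal ((C + 1) * h\<^sup>2)" .
    qed
  qed
qed

end
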